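(* There exist absolute constants $c>0$, $c'>0$ and $x_0$ such that the following holds. Let $x\geq x_0$ be real and let $A\subset[1,x]$ be a set of primes, and define $\alpha$ by $|A|=\alpha x(\log x)^{-1}$. If $\alpha\geq c(\log x)^{-1/2}\log\log x$, then $$|A+A|\geq c'\,\frac{\log x}{\log\log (3\alpha^{-1})}\,|A|.$$
   Context: $A+A=\{a_1+a_2: a_1,a_2\in A\}$. Logarithms are natural. *)

theory Defs
  imports Complex_Main "HOL-Library.Set_Algebras" "HOL-Computational_Algebra.Primes"
begin

end

theory Submission
  imports Defs "HOL-Analysis.Analysis" "HOL-Number_Theory.Number_Theory" "HOL-Real_Asymp.Real_Asymp"
begin

text \<open>
  Let \<open>S = A + A\<close>. Every pair \<open>(a, b)\<close> of elements of \<open>A\<close> gives a pair \<open>(a, s)\<close> with \<open>s - a\<close> a prime, so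
  \<open>|A|\<^sup>2\<close> is at most the sum over \<open>A \<times> S\<close> of an upper bound sieve at \<open>s - a\<close>. The sieve is exact
  for the primes up to \<open>z \<approx> \<alpha> powr (-3/2)\<close> and uses the square of Selberg weights for the
  primes between \<open>z\<close> and a small power of \<open>x\<close>. The frequency \<open>0\<close> of the Selberg part gives the main term. All
  other frequencies have a denominator above \<open>z\<close>, and the large sieve for \<open>S\<close> together with the improved
  large sieve for the primes in \<open>A\<close> makes them negligible. In the main term one has to bound
  the number of pairs \<open>(a, s)\<close> with \<open>s - a\<close> free of primes up to \<open>z\<close>. Splitting off the primes up to
  \<open>2 k\<close> with \<open>k \<approx> log (1/\<alpha>)\<close>, Hoelder's inequality with exponent \<open>k\<close> reduces
  the density of \<open>A\<close> to a constant factor, and the \<open>k\<close>-th moment is computed exactly by the Chinese remainder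
  theorem because the primes involved are large compared with \<open>k\<close>. The primes up to \<open>2 k\<close> that are not exploited cost
  the factor \<open>log k \<approx> log log (3/\<alpha>)\<close>.
\<close>

section \<open>Chebyshev and Mertens estimates\<close>

text \<open>Two constraints fix z. The large sieve bounds the energies of the non-principal
  frequencies only in total, so the sole saving is the weight, about q^(-7/8) at denominator q;
  small denominators cannot be discarded and the primes up to z must be sieved exactly. With |A| =
  \<alpha> x / log x and |S| = O(\<alpha> x), the error is about z^(-13/16) log z times x (\<alpha>
  x / log x) / log x. It has to be small against |A|^2, so z^(-13/16) log z has to be small against
  \<alpha>, which the exponent -3/2 ensures. On the other hand the exact sieve works modulo the
  primorial of z, of size exp(O(z)), which must stay below a fixed power of x; the lower bound for
  \<alpha> gives z = O((log x)^(3/4)).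

  The obstacle in the main term is that A may be concentrated in few residue classes and that S is
  sparse. Brun-Titchmarsh limits the concentration, and both losses are at most powers of
  1/\<alpha>; a k-th root with k about log (1/\<alpha>) makes them constants.\<close>

definition chebyshev_psi :: "nat \<Rightarrow> real" where "chebyshev_psi N = (\<Sum>n\<in>{1..N}. mangoldt n)"

lemma chebyshev_psi_mono: "m \<le> n \<Longrightarrow> chebyshev_psi m \<le> chebyshev_psi n"
  unfolding chebyshev_psi_def by (intro sum_mono2) (auto simp: mangoldt_nonneg)

lemma chebyshev_psi_diff: "m \<le> n \<Longrightarrow> chebyshev_psi n - chebyshev_psi m = (\<Sum>d\<in>{m<..n}. mangoldt d)"
proof -
  assume "m \<le> n"
  then have "{1..n} = {1..m} \<union> {m<..n}" by auto
  then have "(\<Sum>d\<in>{1..n}. mangoldt d :: real) = (\<Sum>d\<in>{1..m}. mangoldt d) + (\<Sum>d\<in>{m<..n}. mangoldt d)"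
    by (simp only:) (subst sum.union_disjoint, auto)
  then show ?thesis unfolding chebyshev_psi_def by simp
qed

text \<open>Legendre's formula: the step from N to N + 1 adds log (N + 1), the sum of
  \<open>mangoldt\<close> over the divisors of N + 1. Terms with d > N vanish, so \<open>X\<close>
  may exceed N; this lets the five factorials of Chebyshev's combination share one range of
  summation.\<close>

lemma ln_fact_eq_sum_mangoldt:
  assumes "N \<le> X"
  shows "ln (fact N) = (\<Sum>d\<in>{1..X}. mangoldt d * real (N div d))"
  using assms
proof (induction N)
  case (Suc N)
  have div: "real (Suc N div d) = real (N div d) + (if d dvd Suc N then 1 else 0)" for d
    by (auto simp: div_Suc dvd_eq_mod_eq_0)
  have "(\<Sum>d\<in>{1..X}. mangoldt d * real (Suc N div d)) =
      (\<Sum>d\<in>{1..X}. mangoldt d * real (N div d)) + (\<Sum>d\<in>{1..X}. if d dvd Suc N then mangoldt d else 0)"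
    unfolding div by (simp add: sum.distrib[symmetric] algebra_simps if_distrib cong: if_cong)
  also have "(\<Sum>d\<in>{1..X}. if d dvd Suc N then mangoldt d else 0) = (\<Sum>d | d dvd Suc N. mangoldt d :: real)"
  proof (intro sum.mono_neutral_cong_right)
    have "d \<in> {1..X}" if "d dvd Suc N" for d
      using dvd_imp_le[OF that] dvd_pos_nat[OF _ that] Suc.prems by simp
    then show "{d. d dvd Suc N} \<subseteq> {1..X}" by blast
  qed auto
  also have "\<dots> = ln (real (Suc N))"
    using mangoldt_sum[of "Suc N", where ?'a=real] by simp
  finally show ?case using Suc by (simp add: ln_mult)
qed simp

lemma ln_fact_bounds:
  assumes "n > 0"
  shows "real n * ln n - n \<le> ln (fact n)" "ln (fact n) \<le> real n * ln n - n + ln n + 1"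
  using assms
proof (induction n rule: nat_induct_non_zero)
  case (Suc n)
  have fact: "ln (fact (Suc n) :: real) = ln (Suc n) + ln (fact n)" by (simp add: ln_mult del: of_nat_Suc)
  { case 1
    have "ln (1 + 1 / real n) \<le> 1 / real n" using Suc by (intro ln_add_one_self_le_self) auto
    then have "real n * ln (1 + 1 / real n) \<le> 1" using Suc by (simp add: field_simps)
    moreover have "1 + 1 / real n = real (Suc n) / real n" using Suc by (simp add: field_simps)
    ultimately have "real n * (ln (Suc n) - ln n) \<le> 1" using Suc by (simp add: ln_div)
    then show ?case unfolding fact using Suc by (simp add: algebra_simps) }
  { case 2
    have "ln (real n / Suc n) \<le> real n / Suc n - 1" using Suc by (intro ln_le_minus_one) auto
    then have "ln (real n) - ln (Suc n) \<le> - 1 / Suc n" using Suc by (simp add: ln_div field_simps)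
    then have "(real n + 1) * (ln (Suc n) - ln n) \<ge> 1" by (simp add: field_simps)
    then show ?case unfolding fact using Suc by (simp add: algebra_simps) }
qed auto

text \<open>Chebyshev's combination of floor functions: \<open>T(N) - T(N/2) - T(N/3) - T(N/5) + T(N/30)\<close> for \<open>T(N) = log N!\<close>.\<close>

definition cheb :: "nat \<Rightarrow> real" where
  "cheb m = real m - real (m div 2) - real (m div 3) - real (m div 5) + real (m div 30)"

text \<open>As 1 - 1/2 - 1/3 - 1/5 + 1/30 = 0, \<open>cheb\<close> has period 30 and thirty residues
  decide everything. The value 1 on 7..9, past the zero at 6, is what allows extra terms to be kept
  in the upper bound for psi.\<close>

lemma cheb_bounds:
  shows "0 \<le> cheb m" "cheb m \<le> 1" "m \<in> {1..5} \<union> {7..9} \<Longrightarrow> cheb m = 1"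
proof -
  define q r where "q = m div 30" and "r = m mod 30"
  have m: "m = 30 * q + r" and "r < 30" by (auto simp: q_def r_def)
  then have "r \<in> {0,1,2,3,4,5,6,7,8,9,10,11,12,13,14,15,16,17,18,19,20,21,22,23,24,25,26,27,28,29}"
    by (simp only: insert_iff empty_iff) arith
  moreover have "m div 2 = 15 * q + r div 2" "m div 3 = 10 * q + r div 3" "m div 5 = 6 * q + r div 5"
    "m div 30 = q + r div 30" unfolding m by simp_all
  ultimately show "0 \<le> cheb m" "cheb m \<le> 1" unfolding cheb_def m by (auto simp del: div_mult_self1 div_mult_self2)
  assume "m \<in> {1..5} \<union> {7..9}"
  then have "m \<in> {1,2,3,4,5,7,8,9}" by auto
  then show "cheb m = 1" by (auto simp: cheb_def)
qed

text \<open>Coefficient of M in the combination of log-factorials at N = 30 M; the terms M log M and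
  the linear terms of Stirling's formula cancel. It is thirty times Chebyshev's constant, about
  27.64.\<close>

definition cheb_const :: real where
  "cheb_const = 30 * ln 30 - 15 * ln 15 - 10 * ln 10 - 6 * ln 6"

lemma exp_1_ge: "(27/10::real) \<le> exp 1"
proof -
  have "(27/10::real) \<le> (1 + 1/100) ^ 100" by (simp add: power_divide divide_simps)
  also have "\<dots> \<le> exp (1/100) ^ 100" using exp_ge_add_one_self[of "1/100::real"] by (intro power_mono) auto
  also have "\<dots> = exp 1" by (simp add: exp_of_nat_mult[symmetric])
  finally show ?thesis .
qed

lemma cheb_const_bounds: "0 < cheb_const" "cheb_const \<le> 28"
proof -
  have e: "ln (30::real) = ln 2 + ln 3 + ln 5" "ln (15::real) = ln 3 + ln 5"
    "ln (10::real) = ln 2 + ln 5" "ln (6::real) = ln 2 + ln 3"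
    using ln_mult[of "2::real" 3] ln_mult[of "2::real" 5] ln_mult[of "3::real" 5] ln_mult[of "6::real" 5] by auto
  have c: "cheb_const = 14 * ln 2 + 9 * ln 3 + 5 * ln 5" unfolding cheb_const_def e by simp
  have "ln (2::real) > 0" "ln (3::real) > 0" "ln (5::real) > 0" by simp_all
  then show "0 < cheb_const" unfolding c by linarith
  have "cheb_const = ln (2 ^ 14 * 3 ^ 9 * 5 ^ 5)" unfolding c
  proof -
    have "ln (2 ^ 14 * 3 ^ 9 * 5 ^ 5 :: real) = ln (2 ^ 14) + ln (3 ^ 9) + ln (5 ^ 5)"
      by (subst ln_mult_pos, simp, simp, subst ln_mult_pos) simp_all
    also have "\<dots> = 14 * ln 2 + 9 * ln 3 + 5 * ln 5"
      using ln_realpow[of "2::real" 14] ln_realpow[of "3::real" 9] ln_realpow[of "5::real" 5] by linarith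
    finally show "14 * ln 2 + 9 * ln 3 + 5 * ln 5 = ln (2 ^ 14 * 3 ^ 9 * 5 ^ 5 :: real)" ..
  qed
  also have "\<dots> \<le> ln ((27/10) ^ 28)" by (subst ln_le_cancel_iff) (auto simp: power_divide divide_simps)
  also have "\<dots> = 28 * ln (27/10)" by (simp add: ln_realpow)
  also have "ln (27/10::real) \<le> 1"
    using exp_1_ge by (metis exp_gt_zero ln_exp ln_mono zero_less_numeral zero_less_divide_iff)
  finally show "cheb_const \<le> 28" by simp
qed

lemma cheb_sum:
  assumes "M > 0"
  shows "(\<Sum>d\<in>{1..30*M}. mangoldt d * cheb (30 * M div d)) =
     ln (fact (30*M)) - ln (fact (15*M)) - ln (fact (10*M)) - ln (fact (6*M)) + ln (fact M)"
proof -
  have "15*M div d = 30*M div d div 2" "10*M div d = 30*M div d div 3" "6*M div d = 30*M div d div 5"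
    "M div d = 30*M div d div 30" for d
    by (simp_all add: div_mult2_eq[symmetric] mult.commute[of d] div_mult2_eq)
  then have "mangoldt d * cheb (30 * M div d) = mangoldt d * real (30*M div d) - mangoldt d * real (15*M div d)
    - mangoldt d * real (10*M div d) - mangoldt d * real (6*M div d) + mangoldt d * real (M div d)" for d
    unfolding cheb_def by (simp add: algebra_simps)
  then show ?thesis
    using ln_fact_eq_sum_mangoldt[of _ "30*M"] by (simp add: sum.distrib sum_subtractf)
qed

lemma cheb_sum_bounds:
  fixes M :: nat and S :: real
  assumes "M > 0"
  defines "S \<equiv> (\<Sum>d\<in>{1..30*M}. mangoldt d * cheb (30 * M div d))"
  shows "S \<le> cheb_const * real M + 2 * (ln (30 * real M) + 1)" "S \<ge> cheb_const * real M - 3 * (ln (30 * real M) + 1)"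
proof -
  have pos: "0 < 30 * M" "0 < 15 * M" "0 < 10 * M" "0 < 6 * M" using assms by auto
  note b = ln_fact_bounds[OF pos(1)] ln_fact_bounds[OF pos(2)] ln_fact_bounds[OF pos(3)]
    ln_fact_bounds[OF pos(4)] ln_fact_bounds[OF assms(1)]
  have m: "ln (real M) \<le> ln (30 * real M)" "ln (15 * real M) \<le> ln (30 * real M)"
     "ln (10 * real M) \<le> ln (30 * real M)" "ln (6 * real M) \<le> ln (30 * real M)" using assms by auto
  have k: "cheb_const * real M = 30 * (M * ln (30 * real M)) - 15 * (M * ln (15 * real M))
      - 10 * (M * ln (10 * real M)) - 6 * (M * ln (6 * real M)) + M * ln (real M)"
    using assms unfolding cheb_const_def by (simp add: ln_mult algebra_simps)
  have r: "real (30 * M) = 30 * real M" "real (15 * M) = 15 * real M" "real (10 * M) = 10 * real M"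
    "real (6 * M) = 6 * real M" by simp_all
  note b' = b[unfolded r mult.assoc]
  show "S \<le> cheb_const * real M + 2 * (ln (30 * real M) + 1)"
    unfolding S_def cheb_sum[OF assms(1)] k r using b' m by argo
  show "S \<ge> cheb_const * real M - 3 * (ln (30 * real M) + 1)"
    unfolding S_def cheb_sum[OF assms(1)] k r using b' m by argo
qed

lemma chebyshev_psi_lower:
  assumes "M > 0"
  shows "chebyshev_psi (30 * M) \<ge> cheb_const * M - 3 * (ln (30 * M) + 1)"
proof -
  have "(\<Sum>d\<in>{1..30*M}. mangoldt d * cheb (30 * M div d)) \<le> chebyshev_psi (30 * M)"
    unfolding chebyshev_psi_def using cheb_bounds(2) by (intro sum_mono) (auto intro!: mult_right_le_one_le simp: mangoldt_nonneg cheb_bounds)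
  then show ?thesis using cheb_sum_bounds(2)[OF assms] by simp
qed

text \<open>For d in (N/6, N] the quotient \<open>N div d\<close> lies in 1..5, for d in (N/10, N/7]
  in 7..9. There \<open>cheb\<close> is 1, and elsewhere it is nonnegative, so both blocks of psi
  together are bounded by the combination of factorials.\<close>

lemma chebyshev_psi_upper_rec:
  fixes M N :: nat
  assumes "M > 0"
  defines "N \<equiv> 30 * M"
  shows "chebyshev_psi N \<le> chebyshev_psi (N div 6) + chebyshev_psi (N div 10) - chebyshev_psi (N div 7) + cheb_const * M + 2 * (ln N + 1)"
proof -
  have N: "N > 0" using assms by auto
  have "chebyshev_psi N - chebyshev_psi (N div 6) + (chebyshev_psi (N div 7) - chebyshev_psi (N div 10)) = 
      (\<Sum>d\<in>{N div 6<..N}. mangoldt d) + (\<Sum>d\<in>{N div 10<..N div 7}. mangoldt d)"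
    by (simp add: chebyshev_psi_diff div_le_mono2)
  also have "\<dots> = (\<Sum>d\<in>{N div 6<..N} \<union> {N div 10<..N div 7}. mangoldt d)"
  proof (rule sum.union_disjoint[symmetric])
    have "N div 7 \<le> N div 6" by (simp add: div_le_mono2)
    then show "{N div 6<..N} \<inter> {N div 10<..N div 7} = {}" by auto
  qed auto
  also have "\<dots> = (\<Sum>d\<in>{N div 6<..N} \<union> {N div 10<..N div 7}. mangoldt d * cheb (N div d))"
  proof (rule sum.cong)
    fix d assume d: "d \<in> {N div 6<..N} \<union> {N div 10<..N div 7}"
    then have d0: "d > 0" by auto
    have "N div d \<in> {1..5} \<union> {7..9}"
    proof (cases "d \<in> {N div 6<..N}")
      case True
      then have "1 \<le> N div d" using d0 by (simp add: div_greater_zero_iff Suc_le_eq)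
      moreover have "N div d < 6" using True d0 by (auto simp: div_less_iff_less_mult mult.commute)
      ultimately show ?thesis by auto
    next
      case False
      then have *: "d \<in> {N div 10<..N div 7}" using d by auto
      then have "7 \<le> N div d" using d0 by (simp add: less_eq_div_iff_mult_less_eq mult.commute)
      moreover have "N div d < 10" using * d0 by (auto simp: div_less_iff_less_mult mult.commute)
      ultimately show ?thesis by auto
    qed
    then show "mangoldt d = mangoldt d * cheb (N div d)" by (simp add: cheb_bounds(3))
  qed simp
  also have "\<dots> \<le> (\<Sum>d\<in>{1..N}. mangoldt d * cheb (N div d))"
    by (intro sum_mono2) (auto simp: mangoldt_nonneg cheb_bounds intro: order_trans[OF _ div_le_dividend])
  finally show ?thesis using cheb_sum_bounds(1)[OF assms(1)] unfolding N_def by simp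
qed

lemma real_div_nat_ge: "real n / real d - 1 \<le> real (n div d)"
  using floor_divide_of_nat_eq[of n d, where ?'a=real] by linarith

lemma ln_le_two_sqrt: "x > 0 \<Longrightarrow> ln x \<le> 2 * sqrt x"
  using ln_le_minus_one[of "sqrt x"] by (simp add: ln_sqrt)

lemma chebyshev_psi_trivial: "chebyshev_psi N \<le> real N * real N"
proof -
  have "chebyshev_psi N \<le> (\<Sum>n\<in>{1..N}. real N)" unfolding chebyshev_psi_def
  proof (intro sum_mono)
    fix n assume n: "n \<in> {1..N}"
    then have "(mangoldt n :: real) \<le> ln n" by (intro mangoldt_le) auto
    also have "\<dots> \<le> real n" using n ln_le_minus_one[of "real n"] by simp
    also have "\<dots> \<le> N" using n by simp
    finally show "mangoldt n \<le> real N" .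
  qed
  then show ?thesis by simp
qed

text \<open>
  Chebyshev's own constant \<open>6/5 * cheb_const/30 < 1.1056\<close> does not suffice: \<open>log log (3/\<alpha>)\<close> must stay away from \<open>0\<close>, which
  needs a constant below \<open>3/e < 1.1037\<close>. Keeping the terms \<open>N/7\<close> and \<open>N/10\<close> and using the lower bound at \<open>N/7\<close> yields \<open>12/11\<close>.
\<close>

lemma chebyshev_psi_upper: "chebyshev_psi N \<le> 12/11 * N + 10000 * sqrt N"
proof (induction N rule: less_induct)
  case (less N)
  show ?case
  proof (cases "N < 270")
    case True
    have "chebyshev_psi N \<le> real N * real N" by (rule chebyshev_psi_trivial)
    also have "\<dots> = real N * sqrt N * sqrt N" by simp
    also have "\<dots> \<le> 270 * 17 * sqrt N"
    proof -
      have "sqrt N \<le> 17" using True by (intro real_le_lsqrt) auto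
      then have "real N * sqrt N \<le> 270 * 17" using True by (intro mult_mono) auto
      then show ?thesis by (intro mult_right_mono) auto
    qed
    also have "\<dots> \<le> 12/11 * N + 10000 * sqrt N"
      using real_sqrt_ge_zero[of N] by simp
    finally show ?thesis .
  next
    case False
    define M where "M = N div 30 + 1"
    have M: "30 * M \<le> N + 30" "N \<le> 30 * M" "M \<ge> 10" using False unfolding M_def by auto
    \<comment> \<open>From N = 270 on, N/30 + 1 \<le> N/27; hence the threshold of the base
      case.\<close>
    have M27: "27 * M \<le> N" using M False by auto
    have "chebyshev_psi N \<le> chebyshev_psi (30 * M)" using M by (intro chebyshev_psi_mono)
    also have "\<dots> \<le> chebyshev_psi (30*M div 6) + chebyshev_psi (30*M div 10) - chebyshev_psi (30*M div 7) + cheb_const * M + 2 * (ln (real (30*M)) + 1)"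
      using chebyshev_psi_upper_rec[of M] M by simp
    finally have "chebyshev_psi N \<le> chebyshev_psi (5 * M) + chebyshev_psi (3 * M) - chebyshev_psi (30*M div 7) + cheb_const * M + 2 * (ln (real (30*M)) + 1)"
      by simp
    moreover have "chebyshev_psi (5 * M) \<le> 12/11 * real (5 * M) + 10000 * sqrt (real (5 * M))" by (intro less) (use M in auto)
    moreover have "chebyshev_psi (3 * M) \<le> 12/11 * real (3 * M) + 10000 * sqrt (real (3 * M))" by (intro less) (use M in auto)
    moreover have "chebyshev_psi (30 * M div 7) \<ge> cheb_const * M / 7 - 28 - 3 * (ln (real (30 * M)) + 1)"
    proof -
      have pos: "M div 7 > 0" using M by (simp add: div_greater_zero_iff)
      have "real (M div 7) \<ge> real M / 7 - 1" using real_div_nat_ge[of M 7] by simp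
      then have "cheb_const * (real M / 7 - 1) \<le> cheb_const * real (M div 7)"
        using cheb_const_bounds by (intro mult_left_mono) auto
      moreover have "ln (real (30 * (M div 7))) \<le> ln (real (30 * M))" using pos by (subst ln_le_cancel_iff) auto
      moreover have "chebyshev_psi (30 * (M div 7)) \<le> chebyshev_psi (30 * M div 7)" by (intro chebyshev_psi_mono) simp
      ultimately show ?thesis using chebyshev_psi_lower[OF pos] cheb_const_bounds by (simp add: algebra_simps)
    qed
    \<comment> \<open>12/11 is the fixed point of this recursion: with 28 in place of
      \<open>cheb_const\<close>, it solves 8 c + (6/7) 28 = 30 c.\<close>
    ultimately have *: "chebyshev_psi N \<le> 96/11 * M + 6/7 * (cheb_const * M) + 33 + 5 * ln (real (30 * M)) + 
       10000 * (sqrt (real (5 * M)) + sqrt (real (3 * M)))" by (simp add: algebra_simps)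
    have "cheb_const * real M \<le> 28 * real M" using cheb_const_bounds by (intro mult_right_mono) auto
    \<comment> \<open>The square-root terms contract, as 431/1000 + 334/1000 < 1; the rest of 10000
      sqrt N absorbs the logarithm and the constants.\<close>
    moreover have "sqrt (real (5 * M)) \<le> 431/1000 * sqrt N"
      using M27 by (intro real_le_lsqrt) (auto simp: power_mult_distrib power2_eq_square)
    moreover have "sqrt (real (3 * M)) \<le> 334/1000 * sqrt N"
      using M27 by (intro real_le_lsqrt) (auto simp: power_mult_distrib power2_eq_square)
    moreover have "ln (real (30 * M)) \<le> 4 * sqrt N"
    proof -
      have "ln (real (30 * M)) \<le> 2 * sqrt (real (30 * M))" by (intro ln_le_two_sqrt) (use M in auto)
      also have "sqrt (real (30 * M)) \<le> 2 * sqrt N"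
        using M27 by (intro real_le_lsqrt) (auto simp: power_mult_distrib power2_eq_square)
      finally show ?thesis by simp
    qed
    moreover have "1 \<le> sqrt N" using False by simp
    moreover have "30 * real M \<le> real N + 30" using M by linarith
    ultimately show ?thesis using * by argo
  qed
qed

lemma chebyshev_psi_linear: "chebyshev_psi N \<le> 10002 * N"
proof -
  have "sqrt N \<le> real N"
    by (cases "N = 0") (auto intro!: real_le_lsqrt simp: power2_eq_square)
  then show ?thesis using chebyshev_psi_upper[of N] by simp
qed

section \<open>Primorials and the number of primes\<close>

lemma finite_primes_le [simp]: "finite {p::nat. prime p \<and> p \<le> N}"
  by (rule finite_subset[of _ "{..N}"]) auto

lemma sum_ln_primes_le_chebyshev_psi: "(\<Sum>p | prime p \<and> p \<le> N. ln (real p)) \<le> chebyshev_psi N"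
proof -
  have "(\<Sum>p | prime p \<and> p \<le> N. ln (real p)) = (\<Sum>p | prime p \<and> p \<le> N. mangoldt p)"
    by (intro sum.cong) auto
  also have "\<dots> \<le> chebyshev_psi N" unfolding chebyshev_psi_def
    by (intro sum_mono2) (auto simp: mangoldt_nonneg prime_ge_1_nat Suc_le_eq prime_gt_0_nat)
  finally show ?thesis .
qed

lemma primorial_le:
  fixes N :: nat
  shows "real (\<Prod>p | prime p \<and> p \<le> N. p) \<le> exp (10002 * N)"
proof -
  have "real (\<Prod>p | prime p \<and> p \<le> N. p) = exp (\<Sum>p | prime p \<and> p \<le> N. ln (real p))"
    by (simp add: exp_sum prime_gt_0_nat)
  then show ?thesis using sum_ln_primes_le_chebyshev_psi[of N] chebyshev_psi_linear[of N] by simp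
qed

text \<open>Primes below x^(995/1000) are too few to matter, and every larger one has log p \<ge>
  (995/1000) log x. As (12/11) / (995/1000) < 11/10, there is room for the lower-order
  terms.\<close>

lemma prime_count_le:
  "\<forall>\<^sub>F x in at_top. real (card {p::nat. prime p \<and> real p \<le> x}) \<le> 11/10 * x / ln x"
proof -
  have "\<forall>\<^sub>F x::real in at_top. x powr (995/1000) + (12/11 * x + 10000 * sqrt x) / (995/1000 * ln x) \<le> 11/10 * x / ln x"
    by real_asymp
  then show ?thesis using eventually_gt_at_top[of 3]
  proof eventually_elim
    case (elim x)
    define N where "N = nat \<lfloor>x\<rfloor>"
    have eq: "{p::nat. prime p \<and> real p \<le> x} = {p. prime p \<and> p \<le> N}"
      using elim by (auto simp: N_def le_nat_iff le_floor_iff)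
    have Nx: "real N \<le> x" using elim by (simp add: N_def)
    define B where "B = {p. prime p \<and> p \<le> N \<and> real p > x powr (995/1000)}"
    have lnx: "ln x > 0" using elim by simp
    have "{p. prime p \<and> p \<le> N} \<subseteq> {1..nat \<lfloor>x powr (995/1000)\<rfloor>} \<union> B"
      using elim by (auto simp: B_def le_nat_iff le_floor_iff prime_ge_1_nat Suc_le_eq prime_gt_0_nat)
    then have "card {p. prime p \<and> p \<le> N} \<le> card ({1..nat \<lfloor>x powr (995/1000)\<rfloor>} \<union> B)"
      by (intro card_mono) (auto simp: B_def)
    also have "\<dots> \<le> card {1..nat \<lfloor>x powr (995/1000)\<rfloor>} + card B" by (rule card_Un_le)
    also have "card {1..nat \<lfloor>x powr (995/1000)\<rfloor>} = nat \<lfloor>x powr (995/1000)\<rfloor>" by simp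
    finally have "real (card {p. prime p \<and> p \<le> N}) \<le> real (nat \<lfloor>x powr (995/1000)\<rfloor>) + card B" by linarith
    also have "real (nat \<lfloor>x powr (995/1000)\<rfloor>) \<le> x powr (995/1000)" by simp
    also have "real (card B) \<le> (12/11 * x + 10000 * sqrt x) / (995/1000 * ln x)"
    proof -
      have "real (card B) * (995/1000 * ln x) = (\<Sum>p\<in>B. 995/1000 * ln x)" by simp
      also have "\<dots> \<le> (\<Sum>p\<in>B. ln (real p))"
      proof (intro sum_mono)
        fix p assume p: "p \<in> B"
        have "995/1000 * ln x = ln (x powr (995/1000))" using elim by (simp add: ln_powr)
        also have "\<dots> \<le> ln p" using p elim by (subst ln_le_cancel_iff) (auto simp: B_def prime_gt_0_nat)
        finally show "995/1000 * ln x \<le> ln (real p)" .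
      qed
      also have "\<dots> \<le> (\<Sum>p | prime p \<and> p \<le> N. ln (real p))"
        by (intro sum_mono2) (auto simp: B_def prime_gt_0_nat Suc_le_eq intro!: ln_ge_zero)
      also have "\<dots> \<le> 12/11 * N + 10000 * sqrt N" using sum_ln_primes_le_chebyshev_psi[of N] chebyshev_psi_upper[of N] by simp
      also have "\<dots> \<le> 12/11 * x + 10000 * sqrt x" using Nx by (intro add_mono mult_left_mono) auto
      finally show ?thesis using lnx by (simp add: field_simps)
    qed
    also note elim(1)
    finally show ?case using eq by simp
  qed
qed

section \<open>Upper bounds of Mertens type\<close>

definition mertens_prod :: "nat \<Rightarrow> real" where
  "mertens_prod N = (\<Prod>p | prime p \<and> p \<le> N. real p / (real p - 1))"

text \<open>Legendre's formula is compared with N! \<le> N^N. Replacing \<open>N div d\<close> by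
  N/d - 1 costs psi(N), which the linear Chebyshev bound turns into the additive constant.\<close>

lemma sum_ln_prime_over_prime_le:
  fixes N :: nat
  assumes "N > 0"
  shows "(\<Sum>p | prime p \<and> p \<le> N. ln (real p) / p) \<le> ln N + 10002"
proof -
  have "(\<Sum>d\<in>{1..N}. mangoldt d * (N / d - 1)) \<le> (\<Sum>d\<in>{1..N}. mangoldt d * real (N div d))"
    using real_div_nat_ge[of N] by (intro sum_mono mult_left_mono) (auto simp: mangoldt_nonneg algebra_simps)
  also have "\<dots> = ln (fact N)" using ln_fact_eq_sum_mangoldt[of N N] by simp
  also have "\<dots> \<le> N * ln N"
  proof -
    have "ln (fact N) \<le> ln (real (N ^ N))"
      using assms fact_le_power[of N, where 'a=real] by (subst ln_le_cancel_iff) auto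
    then show ?thesis using assms by (simp add: ln_realpow)
  qed
  finally have "N * (\<Sum>d\<in>{1..N}. mangoldt d / d) - chebyshev_psi N \<le> N * ln N"
    by (simp add: chebyshev_psi_def sum_subtractf algebra_simps sum_distrib_left)
  then have "N * (\<Sum>d\<in>{1..N}. mangoldt d / d) \<le> N * (ln N + 10002)"
    using chebyshev_psi_linear[of N] by (simp add: algebra_simps)
  then have "(\<Sum>d\<in>{1..N}. mangoldt d / real d) \<le> ln N + 10002" using assms by simp
  moreover have "(\<Sum>p | prime p \<and> p \<le> N. ln (real p) / p) = (\<Sum>p | prime p \<and> p \<le> N. mangoldt p / p)"
    by (intro sum.cong) auto
  moreover have "\<dots> \<le> (\<Sum>d\<in>{1..N}. mangoldt d / real d)"
    by (intro sum_mono2) (auto simp: mangoldt_nonneg Suc_le_eq prime_gt_0_nat)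
  ultimately show ?thesis by simp
qed

lemma primes_le_Suc: "{p. prime p \<and> p \<le> Suc n} = (if prime (Suc n) then insert (Suc n) {p. prime p \<and> p \<le> n} else {p. prime p \<and> p \<le> n})"
  by (auto simp: le_Suc_eq)

text \<open>Partial summation as an induction on N. The prime sum minus s(N)/log N grows by s(n)
  (1/log n - 1/log (n+1)); the part log n of the bound for s(n) yields at most log log (n+1) - log
  log n, and the constant part telescopes.\<close>

lemma sum_inverse_primes_le: "\<exists>C. \<forall>N\<ge>2::nat. (\<Sum>p | prime p \<and> p \<le> N. 1 / real p) \<le> ln (ln N) + C"
proof (intro exI allI impI)
  define s where "s N = (\<Sum>p | prime p \<and> p \<le> N. ln (real p) / p)" for N
  have primes2: "{p::nat. prime p \<and> p \<le> 2} = {2}" by (auto dest: prime_ge_2_nat)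
  fix N :: nat assume N: "N \<ge> 2"
  then have "(\<Sum>p | prime p \<and> p \<le> N. 1 / real p) - s N / ln N
     \<le> ln (ln N) - ln (ln 2) + 10002 * (1 / ln 2 - 1 / ln N)"
  proof (induction N rule: dec_induct)
    case base
    show ?case by (simp add: s_def primes2)
  next
    case (step n)
    have ln: "ln (real n) > 0" "ln (real (Suc n)) > 0" "ln (real n) \<le> ln (real (Suc n))" using step by auto
    have s: "s (Suc n) = s n + (if prime (Suc n) then ln (Suc n) / Suc n else 0)"
      unfolding s_def primes_le_Suc by auto
    have "(\<Sum>p | prime p \<and> p \<le> Suc n. 1 / real p) - s (Suc n) / ln (Suc n) =
       (\<Sum>p | prime p \<and> p \<le> n. 1 / real p) - s n / ln n + s n * (1 / ln n - 1 / ln (Suc n))"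
      unfolding s primes_le_Suc using ln
      by (auto simp: algebra_simps add_divide_distrib simp del: of_nat_Suc)
    moreover have "s n * (1 / ln n - 1 / ln (Suc n)) \<le> (ln n + 10002) * (1 / ln n - 1 / ln (Suc n))"
      using sum_ln_prime_over_prime_le[of n] step ln unfolding s_def
      by (intro mult_right_mono) (auto simp: frac_le)
    moreover have "ln (ln n / ln (Suc n)) \<le> ln n / ln (Suc n) - 1" using ln by (intro ln_le_minus_one) auto
    then have "ln n * (1 / ln n - 1 / ln (Suc n)) \<le> ln (ln (Suc n)) - ln (ln n)"
      using ln by (simp add: ln_divide_pos right_diff_distrib)
    ultimately show ?case using step.IH by (simp only: distrib_right right_diff_distrib)
  qed
  moreover have "s N / ln N \<le> 1 + 10002 * (1 / ln 2)"
  proof -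
    have "s N / ln N \<le> (ln N + 10002) / ln N" using sum_ln_prime_over_prime_le[of N] N
      unfolding s_def by (intro divide_right_mono) auto
    also have "\<dots> = 1 + 10002 / ln N" using N by (simp add: field_simps)
    also have "\<dots> \<le> 1 + 10002 / ln 2" using N by (intro add_mono divide_left_mono) auto
    also have "\<dots> = 1 + 10002 * (1 / ln 2)" by simp
    finally show ?thesis .
  qed
  moreover have "0 \<le> 10002 * (1 / ln (real N))" using N by simp
  ultimately show "(\<Sum>p | prime p \<and> p \<le> N. 1 / real p) \<le> ln (ln N) + (1 + 2 * (10002 * (1 / ln 2)) - ln (ln 2))"
    by (simp only: right_diff_distrib)
qed

lemma sum_telescope_inverse: "(\<Sum>n\<in>{2..Suc N}. 1 / (real n * (real n - 1))) = 1 - 1 / Suc N"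
proof (induction N)
  case (Suc N)
  have "1 - 1 / real (Suc N) + 1 / (real (Suc (Suc N)) * (real (Suc (Suc N)) - 1)) = 1 - 1 / real (Suc (Suc N))"
    by (simp add: divide_simps) (simp add: algebra_simps)
  then show ?case using Suc by simp
qed simp

text \<open>p/(p-1) = 1 + 1/p + 1/(p(p-1)) \<le> exp (1/p + 1/(p(p-1))), and the last terms have a
  bounded sum.\<close>

lemma mertens_prod_le: "\<exists>C>0. \<forall>N\<ge>2. mertens_prod N \<le> C * ln N"
proof -
  obtain C where C: "\<And>N::nat. N \<ge> 2 \<Longrightarrow> (\<Sum>p | prime p \<and> p \<le> N. 1 / real p) \<le> ln (ln N) + C"
    using sum_inverse_primes_le by blast
  have "mertens_prod N \<le> exp (C + 1) * ln N" if N: "N \<ge> 2" for N :: nat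
  proof -
    have "mertens_prod N \<le> (\<Prod>p | prime p \<and> p \<le> N. exp (1 / p + 1 / (real p * (real p - 1))))"
      unfolding mertens_prod_def
    proof (intro prod_mono conjI)
      fix p assume "p \<in> {p. prime p \<and> p \<le> N}"
      then have p: "real p \<ge> 2" using prime_ge_2_nat[of p] by simp
      then show "0 \<le> real p / (real p - 1)" by simp
      have "real p / (real p - 1) = 1 + (1 / p + 1 / (real p * (real p - 1)))" using p by (simp add: field_simps)
      then show "real p / (real p - 1) \<le> exp (1 / p + 1 / (real p * (real p - 1)))"
        using exp_ge_add_one_self by metis
    qed
    also have "\<dots> = exp ((\<Sum>p | prime p \<and> p \<le> N. 1 / real p) + (\<Sum>p | prime p \<and> p \<le> N. 1 / (real p * (real p - 1))))"
      by (subst exp_sum[symmetric]) (simp_all add: sum.distrib)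
    also have "(\<Sum>p | prime p \<and> p \<le> N. 1 / (real p * (real p - 1))) \<le> (\<Sum>n\<in>{2..Suc N}. 1 / (real n * (real n - 1)))"
      by (intro sum_mono2) (auto dest: prime_ge_2_nat)
    also have "\<dots> \<le> 1" unfolding sum_telescope_inverse by simp
    finally have "mertens_prod N \<le> exp ((ln (ln N) + C) + 1)" using C[OF N] by (smt (verit) exp_le_cancel_iff)
    then show ?thesis using N by (simp add: exp_add mult.commute mult.left_commute)
  qed
  then show ?thesis by (intro exI[of _ "exp (C + 1)"]) auto
qed

section \<open>The large sieve\<close>

definition unit_exp :: "real \<Rightarrow> complex" where "unit_exp t = cis (2 * pi * t)"

lemma unit_exp_add: "unit_exp (s + t) = unit_exp s * unit_exp t" by (simp add: unit_exp_def cis_mult ring_distribs)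
lemma norm_unit_exp [simp]: "norm (unit_exp t) = 1" by (simp add: unit_exp_def)
lemma cnj_unit_exp [simp]: "cnj (unit_exp t) = unit_exp (- t)" by (simp add: unit_exp_def cis_cnj)
lemma unit_exp_0 [simp]: "unit_exp 0 = 1" by (simp add: unit_exp_def)
lemma unit_exp_of_int [simp]: "unit_exp (of_int n) = 1"
  by (simp add: unit_exp_def cis_multiple_2pi)
lemma unit_exp_power: "unit_exp t ^ n = unit_exp (real n * t)"
  by (induction n) (simp_all add: unit_exp_add ring_distribs)

text \<open>Jordan's inequality, by concavity: sine lies above its chord.\<close>

lemma sin_lower: 
  assumes "0 \<le> x" "x \<le> pi / 2"
  shows "2 / pi * x \<le> sin x"
proof -
  have "convex_on {0..pi} (\<lambda>x. - sin x)"
  proof (rule f''_ge0_imp_convex)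
    show "((\<lambda>x. - sin x) has_real_derivative - cos x) (at x)" for x by (auto intro!: derivative_eq_intros)
    show "((\<lambda>x. - cos x) has_real_derivative sin x) (at x)" for x by (auto intro!: derivative_eq_intros)
  qed (auto simp: sin_ge_zero)
  moreover have "2 / pi * x \<le> 1" using assms by (simp add: field_simps)
  ultimately have "- sin ((1 - 2 / pi * x) *\<^sub>R 0 + (2 / pi * x) *\<^sub>R (pi / 2)) \<le> (1 - 2 / pi * x) * (- sin 0) + (2 / pi * x) * (- sin (pi / 2))"
    using assms by (intro convex_onD) auto
  then show ?thesis by simp
qed

lemma norm_one_minus_unit_exp: "norm (1 - unit_exp t) = 2 * \<bar>sin (pi * t)\<bar>"
  using dist_exp_i_1[of "2 * pi * t"] by (simp add: unit_exp_def cis_conv_exp norm_minus_commute)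

lemma norm_one_minus_unit_exp_ge:
  assumes "\<delta> \<le> t" "t \<le> 1 - \<delta>" "0 \<le> \<delta>"
  shows "4 * \<delta> \<le> norm (1 - unit_exp t)"
proof -
  have *: "4 * u \<le> 2 * \<bar>sin (pi * u)\<bar>" if "0 \<le> u" "u \<le> 1/2" for u
    using sin_lower[of "pi * u"] that by (simp add: field_simps)
  have "sin (pi * (1 - t)) = sin (pi * t)" by (simp add: right_diff_distrib)
  then show ?thesis unfolding norm_one_minus_unit_exp
    using *[of t] *[of "1 - t"] assms by (cases "t \<le> 1/2") auto
qed

lemma norm_geometric_unit_exp_le:
  assumes "\<delta> \<le> t" "t \<le> 1 - \<delta>" "0 < \<delta>"
  shows "norm (\<Sum>j<M. unit_exp (real j * t)) \<le> 1 / (2 * \<delta>)"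
proof -
  have "(\<Sum>j<M. unit_exp (real j * t)) = (\<Sum>j<M. unit_exp t ^ j)" by (simp add: unit_exp_power)
  moreover have "(1 - unit_exp t) * (\<Sum>j<M. unit_exp t ^ j) = 1 - unit_exp t ^ M" by (rule one_diff_power_eq[symmetric])
  ultimately have "norm (1 - unit_exp t) * norm (\<Sum>j<M. unit_exp (real j * t)) = norm (1 - unit_exp (real M * t))"
    by (simp add: norm_mult[symmetric] unit_exp_power)
  also have "\<dots> \<le> 2" using norm_triangle_ineq4[of 1 "unit_exp (real M * t)"] by simp
  finally have "norm (1 - unit_exp t) * norm (\<Sum>j<M. unit_exp (real j * t)) \<le> 2" .
  moreover have "4 * \<delta> * norm (\<Sum>j<M. unit_exp (real j * t)) \<le> norm (1 - unit_exp t) * norm (\<Sum>j<M. unit_exp (real j * t))"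
    using assms by (intro mult_right_mono norm_one_minus_unit_exp_ge) auto
  ultimately have "4 * \<delta> * norm (\<Sum>j<M. unit_exp (real j * t)) \<le> 2" by linarith
  then show ?thesis using assms by (simp add: field_simps)
qed

lemma sum_inverse_squares_le: "(\<Sum>k\<in>{1..n}. 1 / real k ^ 2) \<le> 2"
proof (cases "n = 0")
  case False
  then have "n > 0" by simp
  then have "(\<Sum>k\<in>{1..n}. 1 / real k ^ 2) \<le> 2 - 1 / real n"
  proof (induction n rule: nat_induct_non_zero)
    case (Suc n)
    have "1 / real (Suc n) ^ 2 \<le> 1 / (real n * real (Suc n))"
      using Suc by (intro divide_left_mono) (auto simp: power2_eq_square intro!: mult_right_mono)
    also have "\<dots> = 1 / real n - 1 / real (Suc n)" using Suc by (simp add: field_simps)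
    finally show ?case using Suc by simp
  qed simp
  moreover have "0 \<le> 1 / real n" by simp
  ultimately show ?thesis by linarith
qed simp

text \<open>Each interval [m \<delta>, (m+1) \<delta>) holds at most one of the points, and none for
  m = 0, so the sum is dominated by that of 1/(m \<delta>)^2.\<close>

lemma sum_inverse_squares_spaced_le:
  fixes t :: "'a \<Rightarrow> real"
  assumes "finite J" "\<delta> > 0" "\<And>j. j \<in> J \<Longrightarrow> t j \<ge> \<delta>"
    and sep: "\<And>i j. i \<in> J \<Longrightarrow> j \<in> J \<Longrightarrow> i \<noteq> j \<Longrightarrow> \<bar>t i - t j\<bar> \<ge> \<delta>"
  shows "(\<Sum>j\<in>J. 1 / t j ^ 2) \<le> 2 / \<delta> ^ 2"
proof -
  define k where "k j = nat \<lfloor>t j / \<delta>\<rfloor>" for j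
  have k: "k j \<ge> 1" "real (k j) * \<delta> \<le> t j" "t j < (real (k j) + 1) * \<delta>" if "j \<in> J" for j
  proof -
    have "t j / \<delta> \<ge> 1" using assms(2,3) that by simp
    then show 1: "k j \<ge> 1" unfolding k_def by (simp add: le_nat_iff le_floor_iff)
    have "real (k j) = of_int \<lfloor>t j / \<delta>\<rfloor>" using 1 unfolding k_def by simp
    then have "real (k j) \<le> t j / \<delta>" "t j / \<delta> < real (k j) + 1" by linarith+
    then show "real (k j) * \<delta> \<le> t j" "t j < (real (k j) + 1) * \<delta>" using assms(2) by (simp_all add: field_simps)
  qed
  have inj: "inj_on k J"
  proof (rule inj_onI, rule ccontr)
    fix i j assume ij: "i \<in> J" "j \<in> J" "k i = k j" "i \<noteq> j"
    have "\<bar>t i - t j\<bar> < \<delta>" using k[OF ij(1)] k[OF ij(2)] ij(3) by (auto simp: abs_if algebra_simps)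
    then show False using sep[OF ij(1,2,4)] by simp
  qed
  have "(\<Sum>j\<in>J. 1 / t j ^ 2) \<le> (\<Sum>j\<in>J. 1 / \<delta>^2 * (1 / real (k j) ^ 2))"
  proof (intro sum_mono)
    fix j assume j: "j \<in> J"
    have "(real (k j) * \<delta>) ^ 2 \<le> t j ^ 2" using k[OF j] assms(2) by (intro power_mono) auto
    moreover have "0 < (real (k j) * \<delta>) ^ 2" using k(1)[OF j] assms(2) by (intro zero_less_power mult_pos_pos) auto
    ultimately have "1 / t j ^ 2 \<le> 1 / (real (k j) * \<delta>) ^ 2" by (intro frac_le) auto
    then show "1 / t j ^ 2 \<le> 1 / \<delta>^2 * (1 / real (k j) ^ 2)" by (simp add: power_mult_distrib mult.commute)
  qed
  also have "\<dots> = 1 / \<delta>^2 * (\<Sum>n\<in>k ` J. 1 / real n ^ 2)"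
    by (simp add: sum_distrib_left sum.reindex[OF inj])
  also have "(\<Sum>n\<in>k ` J. 1 / real n ^ 2) \<le> (\<Sum>n\<in>{1..Max (k ` J)}. 1 / real n ^ 2)"
    using assms(1) k by (intro sum_mono2) auto
  also have "\<dots> \<le> 2" by (rule sum_inverse_squares_le)
  finally show ?thesis by (simp add: divide_right_mono)
qed

definition geom_sum_exp :: "nat \<Rightarrow> real \<Rightarrow> complex" where "geom_sum_exp M t = (\<Sum>j<M. unit_exp (real j * t))"

lemma geom_sum_exp_add_int: "geom_sum_exp M (t + of_int n) = geom_sum_exp M t"
proof -
  have "unit_exp (real j * (t + of_int n)) = unit_exp (real j * t)" for j
    using unit_exp_of_int[of "int j * n"] by (simp add: ring_distribs unit_exp_add)
  then show ?thesis unfolding geom_sum_exp_def by simp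
qed

lemma norm_geom_sum_exp_le_of_nat: "norm (geom_sum_exp M t) \<le> real M"
  unfolding geom_sum_exp_def by (rule order_trans[OF norm_sum]) simp

lemma norm_geom_sum_exp_minus: "norm (geom_sum_exp M (- t)) = norm (geom_sum_exp M t)"
proof -
  have "geom_sum_exp M (- t) = cnj (geom_sum_exp M t)" unfolding geom_sum_exp_def by (simp add: cnj_sum)
  then show ?thesis by simp
qed

text \<open>\<delta>-separation on the circle R/Z; quantifying over the integers n replaces the
  distance to the nearest integer.\<close>

definition spaced :: "'a set \<Rightarrow> ('a \<Rightarrow> real) \<Rightarrow> real \<Rightarrow> bool" where
  "spaced I \<xi> \<delta> \<longleftrightarrow> (\<forall>i\<in>I. \<forall>j\<in>I. i \<noteq> j \<longrightarrow> (\<forall>n::int. \<bar>\<xi> i - \<xi> j - of_int n\<bar> \<ge> \<delta>))"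

text \<open>A row sum of the Fejer-type matrix. Off the diagonal, with t the fractional part of the
  difference, an entry is at most 1/(4 d^2) for d = min t (1 - t). The values t and the values 1 - t
  are each \<delta>-spaced, and each family contributes at most 1/(2 \<delta>^2).\<close>

lemma sum_geom_sum_exp_spaced_le:
  assumes "finite I" "\<delta> > 0" "spaced I \<xi> \<delta>" "i \<in> I"
  shows "(\<Sum>j\<in>I. norm (geom_sum_exp M (\<xi> i - \<xi> j)) ^ 2) \<le> real M ^ 2 + 1 / \<delta> ^ 2"
proof -
  define t where "t j = frac (\<xi> i - \<xi> j)" for j
  have t_eq: "\<xi> i - \<xi> j = t j + of_int \<lfloor>\<xi> i - \<xi> j\<rfloor>" for j by (simp add: t_def frac_def)
  have t: "\<delta> \<le> t j" "\<delta> \<le> 1 - t j" if "j \<in> I - {i}" for j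
  proof -
    have *: "\<bar>\<xi> i - \<xi> j - of_int n\<bar> \<ge> \<delta>" for n
      using assms(3)[unfolded spaced_def, rule_format, of i j] assms(4) that by auto
    have "0 \<le> t j" "t j < 1" by (simp_all add: t_def frac_lt_1)
    moreover have "\<bar>t j\<bar> \<ge> \<delta>" using *[of "\<lfloor>\<xi> i - \<xi> j\<rfloor>"] by (simp add: t_def frac_def)
    moreover have "\<bar>t j - 1\<bar> \<ge> \<delta>" using *[of "\<lfloor>\<xi> i - \<xi> j\<rfloor> + 1"] by (simp add: t_def frac_def algebra_simps)
    ultimately show "\<delta> \<le> t j" "\<delta> \<le> 1 - t j" by linarith+
  qed
  have sep: "\<bar>t j - t l\<bar> \<ge> \<delta>" if "j \<in> I - {i}" "l \<in> I - {i}" "j \<noteq> l" for j l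
  proof -
    have "\<xi> l - \<xi> j - of_int (\<lfloor>\<xi> i - \<xi> j\<rfloor> - \<lfloor>\<xi> i - \<xi> l\<rfloor>) = t j - t l"
      using t_eq[of j] t_eq[of l] by simp
    then show ?thesis using assms(3)[unfolded spaced_def, rule_format, of l j] that by (metis DiffD1)
  qed
  have "(\<Sum>j\<in>I - {i}. norm (geom_sum_exp M (\<xi> i - \<xi> j)) ^ 2) \<le> (\<Sum>j\<in>I - {i}. 1/4 * (1 / t j ^ 2) + 1/4 * (1 / (1 - t j) ^ 2))"
  proof (intro sum_mono)
    fix j assume j: "j \<in> I - {i}"
    define d where "d = min (t j) (1 - t j)"
    have d: "d > 0" using t[OF j] assms(2) by (simp add: d_def)
    have "geom_sum_exp M (\<xi> i - \<xi> j) = geom_sum_exp M (t j)" by (subst t_eq) (rule geom_sum_exp_add_int)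
    moreover have "norm (geom_sum_exp M (t j)) \<le> 1 / (2 * d)"
      unfolding geom_sum_exp_def using d by (intro norm_geometric_unit_exp_le) (auto simp: d_def)
    ultimately have "norm (geom_sum_exp M (\<xi> i - \<xi> j)) ^ 2 \<le> (1 / (2 * d)) ^ 2" by (simp add: power_mono)
    also have "\<dots> = 1/4 * (1 / d ^ 2)" by (simp add: power_divide power_mult_distrib)
    also have "\<dots> \<le> 1/4 * (1 / t j ^ 2) + 1/4 * (1 / (1 - t j) ^ 2)" by (auto simp: d_def min_def)
    finally show "norm (geom_sum_exp M (\<xi> i - \<xi> j)) ^ 2 \<le> 1/4 * (1 / t j ^ 2) + 1/4 * (1 / (1 - t j) ^ 2)" .
  qed
  also have "\<dots> = 1/4 * (\<Sum>j\<in>I - {i}. 1 / t j ^ 2) + 1/4 * (\<Sum>j\<in>I - {i}. 1 / (1 - t j) ^ 2)"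
    by (simp add: sum.distrib sum_distrib_left)
  also have "\<dots> \<le> 1/4 * (2 / \<delta>^2) + 1/4 * (2 / \<delta>^2)"
    using assms(1,2) t sep by (intro add_mono mult_left_mono sum_inverse_squares_spaced_le) (auto simp: abs_minus_commute)
  also have "\<dots> = 1 / \<delta>^2" by simp
  finally have "(\<Sum>j\<in>I - {i}. norm (geom_sum_exp M (\<xi> i - \<xi> j)) ^ 2) \<le> 1 / \<delta>^2" .
  moreover have "norm (geom_sum_exp M (\<xi> i - \<xi> i)) ^ 2 \<le> real M ^ 2"
    using norm_geom_sum_exp_le_of_nat by (intro power_mono) auto
  ultimately show ?thesis unfolding sum.remove[OF assms(1,4)] by linarith
qed

text \<open>Averaging over the differences j - l gives each pair of frequencies the weight |G|^2,
  which decays quadratically in their distance. A sharp interval would only give linear decay and a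
  logarithm in the row sums.\<close>

lemma sum_exponential_polynomial_sq_eq:
  fixes c :: "'a \<Rightarrow> complex"
  assumes "finite I"
  shows "complex_of_real (\<Sum>j<M. \<Sum>l<M. norm (\<Sum>i\<in>I. c i * unit_exp ((real j - real l) * \<xi> i)) ^ 2) =
     (\<Sum>i\<in>I. \<Sum>i'\<in>I. c i * cnj (c i') * complex_of_real (norm (geom_sum_exp M (\<xi> i - \<xi> i')) ^ 2))"
proof -
  let ?t = "\<lambda>i i' j l. c i * cnj (c i') * (unit_exp (real j * (\<xi> i - \<xi> i')) * cnj (unit_exp (real l * (\<xi> i - \<xi> i'))))"
  let ?u = "\<lambda>i j l. unit_exp ((real j - real l) * \<xi> i)"
  have "complex_of_real (norm (\<Sum>i\<in>I. c i * (?u i j l)) ^ 2) =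
     (\<Sum>i\<in>I. \<Sum>i'\<in>I. (?t i i' j l))" for j l
  proof -
    have e: "(?u i j l) * cnj (unit_exp ((real j - real l) * \<xi> i')) =
       unit_exp (real j * (\<xi> i - \<xi> i')) * cnj (unit_exp (real l * (\<xi> i - \<xi> i')))" for i i'
      by (simp add: unit_exp_add[symmetric] algebra_simps)
    have "complex_of_real (norm (\<Sum>i\<in>I. c i * (?u i j l)) ^ 2) =
       (\<Sum>i\<in>I. c i * (?u i j l)) * cnj (\<Sum>i\<in>I. c i * (?u i j l))"
      by (rule complex_norm_square)
    also have "\<dots> = (\<Sum>i\<in>I. \<Sum>i'\<in>I. c i * cnj (c i') * ((?u i j l) * cnj (unit_exp ((real j - real l) * \<xi> i'))))"
      by (simp add: cnj_sum sum_product mult_ac)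
    finally show ?thesis unfolding e .
  qed
  then have "complex_of_real (\<Sum>j<M. \<Sum>l<M. norm (\<Sum>i\<in>I. c i * (?u i j l)) ^ 2) =
     (\<Sum>j<M. \<Sum>l<M. \<Sum>i\<in>I. \<Sum>i'\<in>I. (?t i i' j l))"
    by simp
  also have "\<dots> = (\<Sum>j<M. \<Sum>i\<in>I. \<Sum>l<M. \<Sum>i'\<in>I. (?t i i' j l))"
    by (intro sum.cong refl sum.swap)
  also have "\<dots> = (\<Sum>i\<in>I. \<Sum>j<M. \<Sum>l<M. \<Sum>i'\<in>I. (?t i i' j l))"
    by (rule sum.swap)
  also have "\<dots> = (\<Sum>i\<in>I. \<Sum>j<M. \<Sum>i'\<in>I. \<Sum>l<M. (?t i i' j l))"
    by (intro sum.cong refl sum.swap)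
  also have "\<dots> = (\<Sum>i\<in>I. \<Sum>i'\<in>I. \<Sum>j<M. \<Sum>l<M. (?t i i' j l))"
    by (intro sum.cong refl sum.swap)
  also have "\<dots> = (\<Sum>i\<in>I. \<Sum>i'\<in>I. c i * cnj (c i') * complex_of_real (norm (geom_sum_exp M (\<xi> i - \<xi> i')) ^ 2))"
    unfolding complex_norm_square geom_sum_exp_def cnj_sum sum_product by (simp add: sum_distrib_left)
  finally show ?thesis .
qed

text \<open>Every t < N is a difference (l + t) - l for N + \<Delta> values of l, all inside the
  square of side M = 2 (N + \<Delta>), so the averaged sum dominates N + \<Delta> copies of the
  sharp one. Schur's test bounds it by row sums of at most M^2 + \<Delta>^2 \<le> 5 (N +
  \<Delta>)^2.\<close>

lemma dual_large_sieve:
  fixes c :: "'a \<Rightarrow> complex" and N \<Delta> :: nat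
  assumes "finite I" "\<Delta> > 0" "spaced I \<xi> (1 / \<Delta>)"
  shows "(\<Sum>t<N. norm (\<Sum>i\<in>I. c i * unit_exp (real t * \<xi> i)) ^ 2) \<le> 8 * real (N + \<Delta>) * (\<Sum>i\<in>I. norm (c i) ^ 2)"
proof -
  define M where "M = 2 * (N + \<Delta>)"
  define P where "P u = norm (\<Sum>i\<in>I. c i * unit_exp (u * \<xi> i)) ^ 2" for u
  define k where "k i i' = norm (geom_sum_exp M (\<xi> i - \<xi> i')) ^ 2" for i i'
  have k_sym: "k i i' = k i' i" for i i'
    using norm_geom_sum_exp_minus[of M "\<xi> i - \<xi> i'"] unfolding k_def by simp
  have "real (N + \<Delta>) * (\<Sum>t<N. P (real t)) \<le> (\<Sum>l<N+\<Delta>. \<Sum>t<N. P (real t))" by simp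
  also have "\<dots> = (\<Sum>(l,t)\<in>{..<N+\<Delta>} \<times> {..<N}. P (real (l + t) - real l))"
    by (subst sum.cartesian_product) simp
  also have "\<dots> = (\<Sum>(j,l)\<in>(\<lambda>(l,t). (l+t,l)) ` ({..<N+\<Delta>} \<times> {..<N}). P (real j - real l))"
    by (subst sum.reindex) (auto simp: inj_on_def case_prod_unfold)
  also have "\<dots> \<le> (\<Sum>(j,l)\<in>{..<M} \<times> {..<M}. P (real j - real l))"
    by (intro sum_mono2) (auto simp: M_def P_def)
  also have "\<dots> = (\<Sum>j<M. \<Sum>l<M. P (real j - real l))" by (simp add: sum.cartesian_product)
  also have "\<dots> = norm (complex_of_real \<dots>)" unfolding norm_of_real by (simp add: P_def sum_nonneg)
  also have "\<dots> = norm (\<Sum>i\<in>I. \<Sum>i'\<in>I. c i * cnj (c i') * complex_of_real (k i i'))"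
    unfolding P_def k_def by (subst sum_exponential_polynomial_sq_eq[OF assms(1)]) simp
  also have "\<dots> \<le> (\<Sum>i\<in>I. \<Sum>i'\<in>I. norm (c i) * norm (c i') * k i i')"
    by (intro sum_norm_le) (auto simp: norm_mult norm_power k_def)
  also have "\<dots> \<le> (\<Sum>i\<in>I. \<Sum>i'\<in>I. (norm (c i) ^ 2 / 2 + norm (c i') ^ 2 / 2) * k i i')"
  proof (intro sum_mono mult_right_mono)
    fix i i' show "norm (c i) * norm (c i') \<le> norm (c i) ^ 2 / 2 + norm (c i') ^ 2 / 2"
      using sum_squares_bound[of "norm (c i)" "norm (c i')"] by simp
  qed (simp add: k_def)
  also have "\<dots> = (\<Sum>i\<in>I. \<Sum>i'\<in>I. norm (c i) ^ 2 / 2 * k i i') + (\<Sum>i\<in>I. \<Sum>i'\<in>I. norm (c i') ^ 2 / 2 * k i i')"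
    by (simp add: distrib_right sum.distrib)
  also have "(\<Sum>i\<in>I. \<Sum>i'\<in>I. norm (c i') ^ 2 / 2 * k i i') = (\<Sum>i'\<in>I. \<Sum>i\<in>I. norm (c i') ^ 2 / 2 * k i' i)"
    by (subst sum.swap) (simp add: k_sym)
  also have "(\<Sum>i\<in>I. \<Sum>i'\<in>I. norm (c i) ^ 2 / 2 * k i i') + \<dots> = (\<Sum>i\<in>I. norm (c i) ^ 2 * (\<Sum>i'\<in>I. k i i'))"
    by (simp add: sum_distrib_left sum_distrib_right sum.distrib[symmetric] mult.commute)
  also have "\<dots> \<le> (\<Sum>i\<in>I. norm (c i) ^ 2 * (8 * real (N + \<Delta>) ^ 2))"
  proof (intro sum_mono mult_left_mono)
    fix i assume "i \<in> I"
    then have "(\<Sum>i'\<in>I. k i i') \<le> real M ^ 2 + 1 / (1 / real \<Delta>) ^ 2"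
      unfolding k_def using assms by (intro sum_geom_sum_exp_spaced_le) auto
    also have "real M ^ 2 = 4 * real (N + \<Delta>) ^ 2" unfolding M_def by (simp add: power2_eq_square algebra_simps)
    also have "1 / (1 / real \<Delta>) ^ 2 \<le> real (N + \<Delta>) ^ 2"
      by (auto simp: power_divide intro!: power_mono)
    also have "4 * real (N + \<Delta>) ^ 2 + real (N + \<Delta>) ^ 2 \<le> 8 * real (N + \<Delta>) ^ 2" using zero_le_power2[of "real (N + \<Delta>)"] by linarith
    finally show "(\<Sum>i'\<in>I. k i i') \<le> 8 * real (N + \<Delta>) ^ 2" by simp
  qed auto
  also have "\<dots> = real (N + \<Delta>) * (8 * real (N + \<Delta>) * (\<Sum>i\<in>I. norm (c i) ^ 2))"
    unfolding sum_distrib_right[symmetric] power2_eq_square by (simp only: mult_ac)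
  finally show ?thesis using assms(2) unfolding P_def by (subst (asm) mult_le_cancel_left_pos) auto
qed

text \<open>Duality: the left side X is the sum of f(t) times a dual polynomial whose coefficients
  are the conjugates of the inner sums. Cauchy-Schwarz and the dual bound give X^2 \<le> X times the
  claimed bound.\<close>

lemma large_sieve:
  fixes f :: "nat \<Rightarrow> complex" and N \<Delta> :: nat
  assumes "finite I" "\<Delta> > 0" "spaced I \<xi> (1 / \<Delta>)"
  shows "(\<Sum>i\<in>I. norm (\<Sum>t<N. f t * unit_exp (real t * \<xi> i)) ^ 2) \<le> 8 * real (N + \<Delta>) * (\<Sum>t<N. norm (f t) ^ 2)"
proof -
  define S where "S i = (\<Sum>t<N. f t * unit_exp (real t * \<xi> i))" for i
  define X where "X = (\<Sum>i\<in>I. norm (S i) ^ 2)"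
  define F where "F = (\<Sum>t<N. norm (f t) ^ 2)"
  define T where "T t = (\<Sum>i\<in>I. cnj (S i) * unit_exp (real t * \<xi> i))" for t
  have X0: "X \<ge> 0" unfolding X_def by (intro sum_nonneg) auto
  have "complex_of_real X = (\<Sum>i\<in>I. S i * cnj (S i))"
    unfolding X_def by (simp add: complex_norm_square[symmetric] del: of_real_power)
  also have "\<dots> = (\<Sum>i\<in>I. \<Sum>t<N. f t * (cnj (S i) * unit_exp (real t * \<xi> i)))"
    by (subst (1) S_def) (simp add: sum_distrib_left sum_distrib_right mult_ac)
  also have "\<dots> = (\<Sum>t<N. f t * T t)"
    unfolding T_def sum_distrib_left by (rule sum.swap)
  finally have "X = norm (\<Sum>t<N. f t * T t)" using X0 by (metis norm_of_real abs_of_nonneg)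
  also have "\<dots> \<le> (\<Sum>t<N. norm (f t) * norm (T t))"
    by (rule order_trans[OF norm_sum]) (simp add: norm_mult)
  finally have "X ^ 2 \<le> (\<Sum>t<N. norm (f t) * norm (T t)) ^ 2" using X0 by (intro power_mono)
  also have "\<dots> \<le> F * (\<Sum>t<N. norm (T t) ^ 2)"
    unfolding F_def by (rule Cauchy_Schwarz_ineq_sum)
  also have "\<dots> \<le> F * (8 * real (N + \<Delta>) * (\<Sum>i\<in>I. norm (cnj (S i)) ^ 2))"
    unfolding T_def by (intro mult_left_mono dual_large_sieve assms) (auto simp: F_def sum_nonneg)
  also have "\<dots> = X * (8 * real (N + \<Delta>) * F)" by (simp add: X_def mult_ac)
  finally have "X * X \<le> X * (8 * real (N + \<Delta>) * F)" by (simp add: power2_eq_square)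
  then have "X \<le> 8 * real (N + \<Delta>) * F"
    by (cases "X = 0") (use X0 in \<open>auto simp: F_def sum_nonneg\<close>)
  then show ?thesis by (simp add: X_def F_def S_def)
qed

section \<open>Sets of primes and their characters\<close>

text \<open>A squarefree integer is represented by its set \<open>D\<close> of prime factors. Then
  \<open>phi\<close> is Euler's function, \<open>dens P R\<close> is the normalising sum of
  Selberg's sieve, and \<open>chi p\<close> is the Ramanujan sum modulo p.\<close>

definition phi :: "nat set \<Rightarrow> real" where "phi D = (\<Prod>p\<in>D. real p - 1)"
definition fam :: "nat set \<Rightarrow> nat \<Rightarrow> nat set set" where "fam P R = {D. D \<subseteq> P \<and> \<Prod>D \<le> R}"
definition dens :: "nat set \<Rightarrow> nat \<Rightarrow> real" where "dens P R = (\<Sum>D\<in>fam P R. 1 / phi D)"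
definition chi :: "nat \<Rightarrow> int \<Rightarrow> real" where "chi p n = (if int p dvd n then real p else 0) - 1"
definition Chi :: "nat set \<Rightarrow> int \<Rightarrow> real" where "Chi E n = (\<Prod>p\<in>E. chi p n)"

definition primeset :: "nat set \<Rightarrow> bool" where "primeset P \<longleftrightarrow> finite P \<and> (\<forall>p\<in>P. prime p)"

lemma primesetD: "primeset P \<Longrightarrow> finite P" "primeset P \<Longrightarrow> p \<in> P \<Longrightarrow> prime p"
  "primeset P \<Longrightarrow> p \<in> P \<Longrightarrow> 2 \<le> p"
  by (auto simp: primeset_def prime_ge_2_nat)

lemma primeset_subset: "primeset P \<Longrightarrow> D \<subseteq> P \<Longrightarrow> primeset D"
  by (auto simp: primeset_def finite_subset)

lemma primeset_Un: "primeset P \<Longrightarrow> primeset Q \<Longrightarrow> primeset (P \<union> Q)"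
  by (auto simp: primeset_def)

lemma phi_pos: "primeset D \<Longrightarrow> phi D > 0"
  unfolding phi_def by (intro prod_pos) (auto dest: primesetD(3))

lemma phi_empty [simp]: "phi {} = 1" by (simp add: phi_def)

lemma finite_fam: "finite P \<Longrightarrow> finite (fam P R)"
  unfolding fam_def by (rule finite_subset[of _ "Pow P"]) auto

lemma prod_primeset_pos: "primeset D \<Longrightarrow> \<Prod>D > 0"
  by (intro prod_pos) (auto dest: primesetD(3))

lemma fam_primeset: "primeset P \<Longrightarrow> D \<in> fam P R \<Longrightarrow> primeset D"
  by (auto simp: fam_def intro: primeset_subset)

lemma inverse_phi_nonneg: "primeset P \<Longrightarrow> D \<subseteq> P \<Longrightarrow> 0 \<le> 1 / phi D"
  using phi_pos[OF primeset_subset] by (simp add: less_imp_le)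

lemma dens_nonneg: "primeset P \<Longrightarrow> 0 \<le> dens P R"
  unfolding dens_def by (intro sum_nonneg) (auto simp: fam_def inverse_phi_nonneg simp del: zero_le_divide_1_iff)

lemma dens_mono: "primeset P \<Longrightarrow> R \<le> R' \<Longrightarrow> dens P R \<le> dens P R'"
  unfolding dens_def
  by (intro sum_mono2 finite_fam)
    (auto simp: fam_def primesetD inverse_phi_nonneg simp del: zero_le_divide_1_iff)

lemma dens_ge_1:
  assumes "primeset P" "R \<ge> 1"
  shows "dens P R \<ge> 1"
proof -
  have "(\<Sum>D\<in>{{}}. 1 / phi D) \<le> dens P R" unfolding dens_def
    using assms by (intro sum_mono2 finite_fam)
      (auto simp: fam_def primesetD inverse_phi_nonneg simp del: zero_le_divide_1_iff)
  then show ?thesis by simp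
qed

lemma dens_insert:
  assumes "primeset P" "prime p" "p \<notin> P"
  shows "dens (insert p P) R = dens P R + dens P (R div p) / (real p - 1)"
proof -
  have p0: "p > 0" using assms(2) by (simp add: prime_gt_0_nat)
  have fin: "finite D" if "D \<subseteq> P" for D using assms(1) that by (auto simp: primeset_def finite_subset)
  have notin: "p \<notin> D" if "D \<subseteq> P" for D using assms(3) that by auto
  have "fam (insert p P) R = fam P R \<union> insert p ` fam P (R div p)"
  proof (intro equalityI subsetI)
    fix D assume D: "D \<in> fam (insert p P) R"
    show "D \<in> fam P R \<union> insert p ` fam P (R div p)"
    proof (cases "p \<in> D")
      case True
      then have D': "D = insert p (D - {p})" "D - {p} \<subseteq> P" using D by (auto simp: fam_def)
      have "p * \<Prod>(D - {p}) = \<Prod>D" using D' fin by (metis Diff_iff insertI1 prod.insert finite.simps)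
      then have "D - {p} \<in> fam P (R div p)" using D D'(2) p0
        by (auto simp: fam_def less_eq_div_iff_mult_less_eq mult.commute)
      then show ?thesis using D'(1) by blast
    qed (use D in \<open>auto simp: fam_def\<close>)
  next
    fix D assume "D \<in> fam P R \<union> insert p ` fam P (R div p)"
    then show "D \<in> fam (insert p P) R"
    proof
      assume "D \<in> insert p ` fam P (R div p)"
      then obtain D' where D': "D = insert p D'" "D' \<subseteq> P" "\<Prod>D' \<le> R div p" by (auto simp: fam_def)
      then have "\<Prod>D = p * \<Prod>D'" using fin notin by simp
      also have "\<dots> \<le> p * (R div p)" using D' by simp
      also have "\<dots> \<le> R" by simp
      finally show ?thesis using D' by (auto simp: fam_def)
    qed (auto simp: fam_def)
  qed
  then have "dens (insert p P) R = dens P R + (\<Sum>D\<in>insert p ` fam P (R div p). 1 / phi D)"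
    unfolding dens_def using assms(1,3)
    by (simp, intro sum.union_disjoint) (auto simp: finite_fam primesetD fam_def)
  also have "(\<Sum>D\<in>insert p ` fam P (R div p). 1 / phi D) = (\<Sum>D\<in>fam P (R div p). 1 / phi (insert p D))"
    by (subst sum.reindex) (use assms(3) in \<open>auto simp: inj_on_def fam_def\<close>)
  also have "\<dots> = (\<Sum>D\<in>fam P (R div p). 1 / phi D / (real p - 1))"
    using fin notin by (intro sum.cong) (auto simp: phi_def fam_def)
  finally show ?thesis by (simp add: dens_def sum_divide_distrib)
qed

text \<open>By \<open>dens_insert\<close>, adjoining one prime p multiplies \<open>dens\<close> by
  at most 1 + 1/(p-1) = p/(p-1).\<close>

lemma dens_Un_le:
  assumes "finite P" "primeset P'" "primeset P"
  shows "dens (P \<union> P') R \<le> (\<Prod>p\<in>P. real p / (real p - 1)) * dens P' R"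
  using assms(1,3)
proof (induction P rule: finite_induct)
  case (insert p P)
  have P: "primeset P" "prime p" using insert.prems by (auto simp: primeset_def)
  have p: "real p \<ge> 2" using prime_ge_2_nat[OF P(2)] by simp
  have dn: "0 \<le> dens (P \<union> P') R"
    by (intro dens_nonneg primeset_Un P assms)
  have "dens (insert p P \<union> P') R \<le> real p / (real p - 1) * dens (P \<union> P') R"
  proof (cases "p \<in> P'")
    case True
    then have "insert p P \<union> P' = P \<union> P'" by auto
    moreover have "1 * dens (P \<union> P') R \<le> real p / (real p - 1) * dens (P \<union> P') R"
      using dn p by (intro mult_right_mono) auto
    ultimately show ?thesis by simp
  next
    case False
    have "dens (insert p P \<union> P') R = dens (P \<union> P') R + dens (P \<union> P') (R div p) / (real p - 1)"
      using dens_insert[of "P \<union> P'" p R] False insert P assms(2) by (simp add: primeset_Un)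
    also have "\<dots> \<le> dens (P \<union> P') R + dens (P \<union> P') R / (real p - 1)"
      using p P assms(2) by (intro add_left_mono divide_right_mono dens_mono primeset_Un) auto
    also have "\<dots> = real p / (real p - 1) * dens (P \<union> P') R" using p by (simp add: field_simps)
    finally show ?thesis .
  qed
  also have "\<dots> \<le> real p / (real p - 1) * ((\<Prod>p\<in>P. real p / (real p - 1)) * dens P' R)"
    using p insert.IH[OF P(1)] by (intro mult_left_mono) auto
  finally show ?case using insert by (simp add: mult_ac)
qed simp

section \<open>Lower bound for Selberg's sum through the harmonic sum\<close>

definition smooth :: "nat set \<Rightarrow> nat \<Rightarrow> nat set" where
  "smooth P R = {n. 0 < n \<and> n \<le> R \<and> (\<forall>p. prime p \<longrightarrow> p dvd n \<longrightarrow> p \<in> P)}"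

lemma finite_smooth [simp]: "finite (smooth P R)"
  unfolding smooth_def by (rule finite_subset[of _ "{..R}"]) auto

text \<open>The multiples of p are p times integers of the same kind up to \<open>R div p\<close>,
  with p still allowed because n may contain p repeatedly; hence a recursion in
  \<open>R\<close>.\<close>

lemma sum_smooth_insert:
  assumes "prime p" "p \<notin> P"
  shows "(\<Sum>n\<in>smooth (insert p P) R. 1 / real n) = (\<Sum>n\<in>smooth P R. 1 / real n) + (\<Sum>n\<in>smooth (insert p P) (R div p). 1 / real n) / p"
proof -
  have p0: "p > 0" using assms(1) by (simp add: prime_gt_0_nat)
  let ?M = "(*) p ` smooth (insert p P) (R div p)"
  have "smooth (insert p P) R = smooth P R \<union> ?M"
  proof (intro equalityI subsetI)
    fix n assume n: "n \<in> smooth (insert p P) R"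
    show "n \<in> smooth P R \<union> ?M"
    proof (cases "p dvd n")
      case True
      then obtain m where m: "n = p * m" by auto
      then have "m \<in> smooth (insert p P) (R div p)" using n p0
        by (auto simp: smooth_def less_eq_div_iff_mult_less_eq mult.commute)
      then show ?thesis using m by blast
    qed (use n in \<open>auto simp: smooth_def\<close>)
  next
    fix n assume "n \<in> smooth P R \<union> ?M"
    then show "n \<in> smooth (insert p P) R"
    proof
      assume "n \<in> ?M"
      then obtain m where m: "n = p * m" "m > 0" "m \<le> R div p" "\<And>q. prime q \<Longrightarrow> q dvd m \<Longrightarrow> q \<in> insert p P"
        by (auto simp: smooth_def)
      have "n \<le> p * (R div p)" using m by simp
      also have "\<dots> \<le> R" by simp
      finally have "n \<le> R" .
      moreover have "q \<in> insert p P" if "prime q" "q dvd n" for q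
        using that m assms(1) by (auto simp: prime_dvd_mult_iff primes_dvd_imp_eq)
      ultimately show ?thesis using m p0 by (auto simp: smooth_def)
    qed (auto simp: smooth_def)
  qed
  moreover have "smooth P R \<inter> ?M = {}"
    using assms by (auto simp: smooth_def)
  ultimately have "(\<Sum>n\<in>smooth (insert p P) R. 1 / real n) = (\<Sum>n\<in>smooth P R. 1 / real n) + (\<Sum>n\<in>?M. 1 / real n)"
    by (simp add: sum.union_disjoint)
  also have "(\<Sum>n\<in>?M. 1 / real n) = (\<Sum>n\<in>smooth (insert p P) (R div p). 1 / real n / p)"
    by (subst sum.reindex) (use p0 in \<open>auto simp: inj_on_def mult.commute\<close>)
  finally show ?thesis by (simp add: sum_divide_distrib)
qed

text \<open>The n with radical \<open>\<Prod>D\<close> have reciprocals summing to 1/phi(D), and the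
  radical of n is at most n. Instead of this infinite expansion the proof uses a double induction,
  on \<open>P\<close> and on \<open>R\<close>.\<close>

lemma sum_smooth_le_dens:
  assumes "finite P" "primeset P"
  shows "(\<Sum>n\<in>smooth P R. 1 / real n) \<le> dens P R"
  using assms
proof (induction P arbitrary: R rule: finite_induct)
  case empty
  have "smooth {} R \<subseteq> {1}" using prime_factor_nat by (auto simp: smooth_def)
  then have "smooth {} R = {} \<or> smooth {} R = {1}" by auto
  moreover have "dens {} R = (if R \<ge> 1 then 1 else 0)"
  proof -
    have "fam {} R = (if R \<ge> 1 then {{}} else {})" by (auto simp: fam_def)
    then show ?thesis by (simp add: dens_def)
  qed
  moreover have "smooth {} 0 = {}" by (auto simp: smooth_def)
  ultimately show ?case by (cases "R = 0") auto
next
  case (insert p P)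
  have P: "primeset P" "prime p" using insert.prems by (auto simp: primeset_def)
  have p: "real p \<ge> 2" using prime_ge_2_nat[OF P(2)] by simp
  note IH = insert.IH[OF P(1)]
  show ?case
  proof (induction R rule: less_induct)
    case (less R)
    show ?case
    proof (cases "R = 0")
      case True
      then have "smooth (insert p P) R = {}" by (auto simp: smooth_def)
      moreover have "0 \<le> dens (insert p P) R" by (intro dens_nonneg insert.prems)
      ultimately show ?thesis by simp
    next
      case False
      \<comment> \<open>Adjoining p costs at most p/(p-1), exactly the ratio of 1/(p-1) in
        \<open>dens_insert\<close> to 1/p in \<open>sum_smooth_insert\<close>.\<close>
      have "dens P (R div p div p) \<le> dens P (R div p)" by (intro dens_mono P) simp
      then have "dens (insert p P) (R div p) \<le> dens P (R div p) + dens P (R div p) / (real p - 1)"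
        using dens_insert[OF P insert.hyps(2), of "R div p"] p by (simp add: divide_right_mono)
      also have "\<dots> = dens P (R div p) / (real p - 1) * p" using p by (simp add: field_simps)
      finally have 1: "dens (insert p P) (R div p) / p \<le> dens P (R div p) / (real p - 1)"
        using p by (simp add: pos_divide_le_eq)
      have "R div p < R" using False p by simp
      then have "(\<Sum>n\<in>smooth (insert p P) (R div p). 1 / real n) / p \<le> dens (insert p P) (R div p) / p"
        using less.IH p by (intro divide_right_mono) auto
      then show ?thesis
        using 1 IH[of R] sum_smooth_insert[OF P(2) insert.hyps(2), of R] dens_insert[OF P insert.hyps(2), of R]
        by linarith
    qed
  qed
qed

text \<open>The harmonic sum up to R is at most \<open>dens\<close> of \<open>P \<union> P'\<close>,
  and the primes of \<open>P\<close> are stripped off at the cost of their Euler factors.\<close>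

lemma ln_le_dens:
  assumes "primeset P" "primeset P'" "R > 0" "{p. prime p \<and> p \<le> R} \<subseteq> P \<union> P'"
  shows "ln R \<le> (\<Prod>p\<in>P. real p / (real p - 1)) * dens P' R"
proof -
  have "ln (real R) \<le> harm R"
  proof -
    have "ln (real R) \<le> ln (real R + 1)" using assms by simp
    also have "\<dots> \<le> harm R" using ln_le_harm by simp
    finally show ?thesis .
  qed
  also have "\<dots> = (\<Sum>n\<in>smooth (P \<union> P') R. 1 / real n)"
  proof -
    have "smooth (P \<union> P') R = {1..R}"
    proof (intro equalityI subsetI)
      fix n assume n: "n \<in> {1..R}"
      have "p \<in> P \<union> P'" if "prime p" "p dvd n" for p
        using assms(4) that dvd_imp_le[of p n] n by auto
      then show "n \<in> smooth (P \<union> P') R" using n unfolding smooth_def by simp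
    qed (auto simp: smooth_def)
    then show ?thesis by (simp add: harm_def inverse_eq_divide)
  qed
  also have "\<dots> \<le> dens (P \<union> P') R"
    using assms by (intro sum_smooth_le_dens primeset_Un) (auto dest: primesetD)
  also have "\<dots> \<le> (\<Prod>p\<in>P. real p / (real p - 1)) * dens P' R"
    using assms by (intro dens_Un_le) (auto dest: primesetD)
  finally show ?thesis .
qed


text \<open>
  A fraction \<open>a/q\<close> with squarefree denominator \<open>q = \<Prod>E\<close> is represented by its partial fraction numerators
  \<open>h p\<close>, \<open>p \<in> E\<close>. Then \<open>Chi E\<close> is the Ramanujan sum of modulus \<open>\<Prod>E\<close>, and
  \<open>energy E B\<close> is the sum of \<open>|\<Sum>b\<in>B. e(b a/q)|\<^sup>2\<close> over the reduced residues \<open>a\<close> modulo \<open>q\<close>.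
\<close>

definition freqs :: "nat set \<Rightarrow> (nat \<Rightarrow> nat) set" where "freqs E = PiE E (\<lambda>p. {1..<p})"
definition xi :: "nat set \<Rightarrow> (nat \<Rightarrow> nat) \<Rightarrow> real" where "xi E h = (\<Sum>p\<in>E. real (h p) / real p)"
definition Fhat :: "nat set \<Rightarrow> real \<Rightarrow> complex" where "Fhat B t = (\<Sum>b\<in>B. unit_exp (real b * t))"
definition energy :: "nat set \<Rightarrow> nat set \<Rightarrow> real" where
  "energy E B = (\<Sum>a\<in>B. \<Sum>b\<in>B. Chi E (int a - int b))"

lemma finite_freqs [simp]: "finite E \<Longrightarrow> finite (freqs E)"
  unfolding freqs_def by (intro finite_PiE) auto

lemma unit_exp_sum: "unit_exp (\<Sum>p\<in>E. g p) = (\<Prod>p\<in>E. unit_exp (g p))"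
  by (induction E rule: infinite_finite_induct) (auto simp: unit_exp_add)

lemma unit_exp_eq_1_iff: "unit_exp t = 1 \<longleftrightarrow> t \<in> \<int>"
proof
  assume "unit_exp t = 1"
  then have "sin (pi * t) = 0" using norm_one_minus_unit_exp[of t] by simp
  then obtain i where "pi * t = of_int i * pi" using sin_zero_iff_int2 by blast
  then show "t \<in> \<int>" by simp
qed (auto elim: Ints_cases)

lemma sum_unit_exp_eq_chi:
  assumes "p > 0"
  shows "(\<Sum>j\<in>{1..<p}. unit_exp (of_int n * (real j / real p))) = of_real (chi p n)"
proof -
  define z where "z = unit_exp (of_int n / real p)"
  have zp: "z ^ p = 1" using assms by (simp add: z_def unit_exp_power)
  have "(\<Sum>j<p. unit_exp (of_int n * (real j / real p))) = (\<Sum>j<p. z ^ j)"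
    by (simp add: z_def unit_exp_power mult.commute)
  also have "\<dots> = (if int p dvd n then of_nat p else 0)"
  proof (cases "int p dvd n")
    case True
    then obtain k where "n = int p * k" by auto
    then have "z = 1" using assms by (simp add: z_def)
    then show ?thesis using True by simp
  next
    case False
    have "z \<noteq> 1"
    proof
      assume "z = 1"
      then obtain k where "of_int n / real p = of_int k" unfolding z_def unit_exp_eq_1_iff by (auto elim: Ints_cases)
      then have "real_of_int n = real_of_int (k * int p)" using assms by (simp add: field_simps)
      then have "n = k * int p" by (simp only: of_int_eq_iff)
      then show False using False by simp
    qed
    then show ?thesis using False zp by (simp add: geometric_sum)
  qed
  finally have *: "(\<Sum>j<p. unit_exp (of_int n * (real j / real p))) = (if int p dvd n then of_nat p else 0)" .
  have "{..<p} = insert 0 {1..<p}" using assms by auto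
  then have "(\<Sum>j<p. unit_exp (of_int n * (real j / real p))) = 1 + (\<Sum>j\<in>{1..<p}. unit_exp (of_int n * (real j / real p)))"
    by simp
  then show ?thesis using * by (auto simp: chi_def algebra_simps)
qed

lemma Chi_eq_sum_freqs:
  assumes "primeset E"
  shows "complex_of_real (Chi E n) = (\<Sum>h\<in>freqs E. unit_exp (of_int n * xi E h))"
proof -
  have "complex_of_real (Chi E n) = (\<Prod>p\<in>E. complex_of_real (chi p n))" by (simp add: Chi_def)
  also have "\<dots> = (\<Prod>p\<in>E. \<Sum>j\<in>{1..<p}. unit_exp (of_int n * (real j / real p)))"
    using primesetD(3)[OF assms] by (intro prod.cong refl sum_unit_exp_eq_chi[symmetric]) force
  also have "\<dots> = (\<Sum>h\<in>freqs E. \<Prod>p\<in>E. unit_exp (of_int n * (real (h p) / real p)))"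
    unfolding freqs_def using assms by (intro prod_sum_PiE) (auto simp: primesetD)
  also have "\<dots> = (\<Sum>h\<in>freqs E. unit_exp (of_int n * xi E h))"
    by (simp add: xi_def sum_distrib_left unit_exp_sum)
  finally show ?thesis .
qed

lemma sum_Chi_eq:
  assumes "primeset E"
  shows "complex_of_real (\<Sum>s\<in>C. \<Sum>a\<in>B. Chi E (int s - int a)) = (\<Sum>h\<in>freqs E. Fhat C (xi E h) * cnj (Fhat B (xi E h)))"
proof -
  let ?e = "\<lambda>s a h. unit_exp (of_int (int s - int a) * xi E h)"
  have "complex_of_real (\<Sum>s\<in>C. \<Sum>a\<in>B. Chi E (int s - int a)) = (\<Sum>s\<in>C. \<Sum>a\<in>B. \<Sum>h\<in>freqs E. (?e s a h))"
    by (simp add: Chi_eq_sum_freqs[OF assms])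
  also have "\<dots> = (\<Sum>s\<in>C. \<Sum>h\<in>freqs E. \<Sum>a\<in>B. (?e s a h))"
    by (intro sum.cong refl sum.swap)
  also have "\<dots> = (\<Sum>h\<in>freqs E. \<Sum>s\<in>C. \<Sum>a\<in>B. (?e s a h))"
    by (rule sum.swap)
  also have "\<dots> = (\<Sum>h\<in>freqs E. Fhat C (xi E h) * cnj (Fhat B (xi E h)))"
    unfolding Fhat_def cnj_sum sum_product by (simp add: unit_exp_add[symmetric] algebra_simps)
  finally show ?thesis .
qed

lemma energy_eq: 
  assumes "primeset E"
  shows "energy E B = (\<Sum>h\<in>freqs E. norm (Fhat B (xi E h)) ^ 2)"
proof -
  have "complex_of_real (energy E B) = complex_of_real (\<Sum>h\<in>freqs E. norm (Fhat B (xi E h)) ^ 2)"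
    unfolding energy_def sum_Chi_eq[OF assms] by (simp add: complex_norm_square[symmetric] del: of_real_power)
  then show ?thesis by (simp only: of_real_eq_iff)
qed

lemma energy_nonneg: "primeset E \<Longrightarrow> 0 \<le> energy E B"
  by (simp add: energy_eq sum_nonneg)

lemma sum_Chi_le:
  assumes "primeset E"
  shows "\<bar>\<Sum>s\<in>C. \<Sum>a\<in>B. Chi E (int s - int a)\<bar> \<le> sqrt (energy E C) * sqrt (energy E B)"
proof -
  have "\<bar>\<Sum>s\<in>C. \<Sum>a\<in>B. Chi E (int s - int a)\<bar> = norm (complex_of_real (\<Sum>s\<in>C. \<Sum>a\<in>B. Chi E (int s - int a)))"
    by (simp only: norm_of_real)
  also have "\<dots> \<le> (\<Sum>h\<in>freqs E. norm (Fhat C (xi E h)) * norm (Fhat B (xi E h)))"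
    unfolding sum_Chi_eq[OF assms] by (rule order_trans[OF norm_sum]) (simp add: norm_mult)
  finally have "\<bar>\<Sum>s\<in>C. \<Sum>a\<in>B. Chi E (int s - int a)\<bar> ^ 2 \<le> (\<Sum>h\<in>freqs E. norm (Fhat C (xi E h)) * norm (Fhat B (xi E h))) ^ 2"
    by (intro power_mono) auto
  also have "\<dots> \<le> energy E C * energy E B"
    unfolding energy_eq[OF assms] by (rule Cauchy_Schwarz_ineq_sum)
  finally show ?thesis by (simp add: real_le_rsqrt real_sqrt_mult[symmetric])
qed

text \<open>Distinct fractions differ modulo 1 by at least the reciprocal of the lcm of their
  denominators, hence by 1/D^2. The factor \<open>W\<close> comes from passing to a progression
  modulo \<open>W\<close>; being prime to the denominators, it preserves this.\<close>

lemma freqs_spaced: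
  assumes fin: "finite \<E>" and E: "\<And>E. E \<in> \<E> \<Longrightarrow> primeset E \<and> \<Prod>E \<le> D \<and> (\<forall>p\<in>E. \<not> p dvd W)"
  shows "spaced (Sigma \<E> freqs) (\<lambda>(E, h). real W * xi E h) (1 / real (D ^ 2))"
  unfolding spaced_def
proof (intro ballI impI allI)
  fix i j and n :: int
  assume ij: "i \<in> Sigma \<E> freqs" "j \<in> Sigma \<E> freqs" "i \<noteq> j"
  obtain E h E' h' where eq: "i = (E, h)" "j = (E', h')" by (metis surj_pair)
  then have a: "E \<in> \<E>" "h \<in> freqs E" "E' \<in> \<E>" "h' \<in> freqs E'" and ne: "\<not> (E = E' \<and> h = h')"
    using ij by auto
  \<comment> \<open>Numerators are extended by 0 outside the support. Those inside are nonzero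
    modulo p, so distinct pairs (support, numerators) differ at some prime p; this p divides the
    common denominator \<open>L\<close> but not \<open>W * K\<close>.\<close>
  define g where "g p = (if p \<in> E then int (h p) else 0)" for p
  define g' where "g' p = (if p \<in> E' then int (h' p) else 0)" for p
  define U where "U = E \<union> E'"
  have pE: "primeset E" "primeset E'" using E a by auto
  have fU: "finite U" and prU: "\<And>p. p \<in> U \<Longrightarrow> prime p" using pE by (auto simp: U_def primeset_def)
  define K where "K = (\<Sum>q\<in>U. (g q - g' q) * int (\<Prod>(U - {q})))"
  define L where "L = \<Prod>U"
  have L0: "L > 0" unfolding L_def using prU by (intro prod_pos) (auto simp: prime_gt_0_nat)
  have Lq: "L = q * \<Prod>(U - {q})" if "q \<in> U" for q
    unfolding L_def using prod.remove[OF fU that, of id] by simp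
  have "xi E h = (\<Sum>p\<in>U. real_of_int (g p) / real p)"
    unfolding xi_def using fU by (intro sum.mono_neutral_cong_left) (auto simp: U_def g_def)
  moreover have "xi E' h' = (\<Sum>p\<in>U. real_of_int (g' p) / real p)"
    unfolding xi_def using fU by (intro sum.mono_neutral_cong_left) (auto simp: U_def g'_def)
  ultimately have "xi E h - xi E' h' = (\<Sum>p\<in>U. real_of_int (g p - g' p) / real p)"
    by (simp add: sum_subtractf diff_divide_distrib)
  also have "\<dots> = (\<Sum>p\<in>U. real_of_int ((g p - g' p) * int (\<Prod>(U - {p}))) / real L)"
  proof (intro sum.cong refl)
    fix p assume p: "p \<in> U"
    have "real L = real p * real (\<Prod>(U - {p}))" using Lq[OF p] by (simp only: of_nat_mult)
    moreover have "real (\<Prod>(U - {p})) > 0" using Lq[OF p] L0 by (metis gr0I mult_0_right neq0_conv of_nat_0_less_iff)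
    ultimately show "real_of_int (g p - g' p) / real p = real_of_int ((g p - g' p) * int (\<Prod>(U - {p}))) / real L"
      by (simp add: prU[OF p] prime_gt_0_nat divide_simps del: of_nat_prod)
  qed
  also have "\<dots> = real_of_int K / real L" by (simp add: K_def sum_divide_distrib)
  finally have diff: "xi E h - xi E' h' = real_of_int K / real L" .
  have "\<exists>p\<in>U. g p \<noteq> g' p"
  proof (cases "E = E'")
    case True
    then have "h \<noteq> h'" using ne by simp
    then obtain p where "p \<in> E" "h p \<noteq> h' p"
      using a True unfolding freqs_def by (metis PiE_ext)
    then show ?thesis using True by (auto simp: U_def g_def g'_def)
  next
    case False
    then obtain p where "(p \<in> E \<and> p \<notin> E') \<or> (p \<notin> E \<and> p \<in> E')" by auto
    then show ?thesis using a by (auto simp: U_def g_def g'_def freqs_def PiE_iff intro!: bexI[of _ p])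
  qed
  then obtain p where p: "p \<in> U" "g p \<noteq> g' p" by auto
  have pp: "prime (int p)" using prU[OF p(1)] by simp
  have gb: "0 \<le> g p" "g p < int p" "0 \<le> g' p" "g' p < int p"
    using a p(1) prime_gt_0_nat[OF prU[OF p(1)]] by (auto simp: g_def g'_def freqs_def PiE_iff)
  have nd1: "\<not> int p dvd g p - g' p"
  proof
    assume "int p dvd g p - g' p"
    then have "int p \<le> \<bar>g p - g' p\<bar>" using p(2) by (intro zdvd_imp_le) (auto simp: zdvd_not_zless)
    then show False using gb by auto
  qed
  have nd2: "\<not> int p dvd int (\<Prod>(U - {p}))"
  proof
    assume "int p dvd int (\<Prod>(U - {p}))"
    then have "p dvd \<Prod>(U - {p})" by (simp only: int_dvd_int_iff)
    then obtain q where "q \<in> U - {p}" "p dvd q"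
      using prime_dvd_prod_iff[of "U - {p}" p id] fU prU[OF p(1)] by auto
    then show False using prU p(1) primes_dvd_imp_eq by blast
  qed
  have nd: "\<not> int p dvd int W * K"
  proof -
    have "K = (g p - g' p) * int (\<Prod>(U - {p})) + (\<Sum>q\<in>U - {p}. (g q - g' q) * int (\<Prod>(U - {q})))"
      unfolding K_def by (rule sum.remove[OF fU p(1)])
    moreover have "int p dvd (\<Sum>q\<in>U - {p}. (g q - g' q) * int (\<Prod>(U - {q})))"
    proof (intro dvd_sum dvd_mult)
      fix q assume "q \<in> U - {p}"
      then have "p dvd \<Prod>(U - {q})" using fU p(1) dvd_prodI[of "U - {q}" p id] by auto
      then show "int p dvd int (\<Prod>(U - {q}))" by (simp only: int_dvd_int_iff)
    qed
    moreover have "\<not> int p dvd (g p - g' p) * int (\<Prod>(U - {p}))"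
      using nd1 nd2 pp prime_dvd_mult_iff by blast
    ultimately have "\<not> int p dvd K" by (simp add: dvd_add_left_iff)
    moreover have "\<not> int p dvd int W" using E a p(1) by (auto simp: U_def)
    ultimately show ?thesis using pp prime_dvd_mult_iff by blast
  qed
  have "int W * K - n * int L \<noteq> 0"
  proof
    assume "int W * K - n * int L = 0"
    then have "int W * K = n * int L" by simp
    moreover have "int p dvd int L" using Lq[OF p(1)] by simp
    ultimately show False using nd by simp
  qed
  then have "1 \<le> \<bar>real_of_int (int W * K - n * int L)\<bar>" by linarith
  then have "1 / real L \<le> \<bar>real_of_int (int W * K - n * int L)\<bar> / real L" by (intro divide_right_mono) auto
  also have "\<dots> = \<bar>real_of_int (int W * K - n * int L) / real L\<bar>" by simp
  also have "real_of_int (int W * K - n * int L) / real L = real W * xi E h - real W * xi E' h' - of_int n"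
    using L0 by (simp add: right_diff_distrib[symmetric] diff field_simps)
  finally have 1: "1 / real L \<le> \<bar>real W * xi E h - real W * xi E' h' - of_int n\<bar>" .
  have "L \<le> D ^ 2"
  proof -
    have fin: "finite E" "finite E'" using pE by (auto simp: primeset_def)
    have "L * \<Prod>(E \<inter> E') = \<Prod>E * \<Prod>E'"
      using prod.union_inter[OF fin, of id] by (simp add: L_def U_def)
    moreover have "\<Prod>(E \<inter> E') > 0" by (intro prod_primeset_pos primeset_subset[OF pE(1)]) auto
    ultimately have "L \<le> \<Prod>E * \<Prod>E'" by (metis le_add1 mult.right_neutral mult_le_mono2 Suc_leI One_nat_def)
    also have "\<dots> \<le> D * D" using E a by (intro mult_le_mono) auto
    finally show ?thesis by (simp add: power2_eq_square)
  qed
  then have "real L \<le> real (D ^ 2)" by (simp only: of_nat_le_iff)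
  then have "1 / real (D ^ 2) \<le> 1 / real L" using L0 by (intro frac_le) auto
  then show "1 / real (D ^ 2) \<le> \<bar>(case i of (E, h) \<Rightarrow> real W * xi E h) - (case j of (E, h) \<Rightarrow> real W * xi E h) - of_int n\<bar>"
    using 1 eq by simp
qed

text \<open>In a class modulo \<open>W\<close> one has b = u + W t with t \<le> X div W. The large
  sieve then runs over an interval of length about X/W with frequencies multiplied by
  \<open>W\<close>, and the unimodular factor from u drops out.\<close>

lemma sum_energy_le:
  assumes fin: "finite \<E>" and E: "\<And>E. E \<in> \<E> \<Longrightarrow> primeset E \<and> \<Prod>E \<le> D \<and> (\<forall>p\<in>E. \<not> p dvd W)"
    and "D > 0" "W > 0" and B: "\<And>b. b \<in> B \<Longrightarrow> b \<le> X \<and> b mod W = u"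
  shows "(\<Sum>E\<in>\<E>. energy E B) \<le> 8 * real (X div W + 1 + D ^ 2) * real (card B)"
proof -
  define N where "N = X div W + 1"
  define f :: "nat \<Rightarrow> complex" where "f t = (if u + W * t \<in> B then 1 else 0)" for t
  define T where "T = {t. t < N \<and> u + W * t \<in> B}"
  have BT: "B = (\<lambda>t. u + W * t) ` T"
  proof (intro equalityI subsetI)
    fix b assume b: "b \<in> B"
    have "b = u + W * (b div W)" using B[OF b] mod_mult_div_eq[of b W] by simp
    moreover have "b div W < N" unfolding N_def using B[OF b] by (simp add: div_le_mono less_Suc_eq_le)
    ultimately show "b \<in> (\<lambda>t. u + W * t) ` T" using b unfolding T_def by (intro image_eqI[of _ _ "b div W"]) auto
  qed (auto simp: T_def)
  have inj: "inj_on (\<lambda>t. u + W * t) T" using assms(4) by (auto simp: inj_on_def)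
  have cardB: "card B = card T" unfolding BT by (rule card_image[OF inj])
  have Tf: "(\<Sum>t<N. f t * g t) = (\<Sum>t\<in>T. g t)" for g
    unfolding f_def T_def by (intro sum.mono_neutral_cong_right) auto
  have norm_eq: "norm (Fhat B x) = norm (\<Sum>t<N. f t * unit_exp (real t * (real W * x)))" for x
  proof -
    have "Fhat B x = (\<Sum>t\<in>T. unit_exp (real (u + W * t) * x))"
      unfolding Fhat_def by (subst BT) (simp add: sum.reindex[OF inj])
    also have "\<dots> = unit_exp (real u * x) * (\<Sum>t\<in>T. unit_exp (real t * (real W * x)))"
      by (simp add: sum_distrib_left ring_distribs unit_exp_add mult_ac)
    finally show ?thesis unfolding Tf by (simp add: norm_mult)
  qed
  have finI: "finite (Sigma \<E> freqs)" using fin E by (intro finite_SigmaI finite_freqs) (auto simp: primeset_def)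
  have "(\<Sum>E\<in>\<E>. energy E B) = (\<Sum>E\<in>\<E>. \<Sum>h\<in>freqs E. norm (Fhat B (xi E h)) ^ 2)"
    using E by (intro sum.cong refl energy_eq) auto
  also have "\<dots> = (\<Sum>(E, h)\<in>Sigma \<E> freqs. norm (Fhat B (xi E h)) ^ 2)"
    using fin E by (intro sum.Sigma) (auto simp: primeset_def)
  also have "\<dots> = (\<Sum>i\<in>Sigma \<E> freqs. norm (\<Sum>t<N. f t * unit_exp (real t * (case i of (E, h) \<Rightarrow> real W * xi E h))) ^ 2)"
    by (intro sum.cong refl) (auto simp: norm_eq)
  also have "\<dots> \<le> 8 * real (N + D ^ 2) * (\<Sum>t<N. norm (f t) ^ 2)"
    using assms(3) finI E by (intro large_sieve freqs_spaced fin) auto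
  also have "(\<Sum>t<N. norm (f t) ^ 2) = (\<Sum>t\<in>T. 1)"
    unfolding f_def T_def by (intro sum.mono_neutral_cong_right) auto
  finally show ?thesis by (simp add: cardB N_def)
qed

text \<open>For b prime to p, the sum of e(bj/p) over j = 1..p-1 is -1. So the exponential sum at x
  is minus the sum of its values at x + j/p, and Cauchy-Schwarz over these p - 1 shifts gives the
  factor.\<close>

lemma energy_insert:
  assumes E: "primeset E" "prime p" "p \<notin> E" and B: "\<And>b. b \<in> B \<Longrightarrow> \<not> p dvd b"
  shows "energy E B \<le> (real p - 1) * energy (insert p E) B"
proof -
  have p: "p \<ge> 2" using prime_ge_2_nat[OF E(2)] .
  have fin: "finite E" using E by (simp add: primesetD)
  have pE: "primeset (insert p E)" using E by (auto simp: primeset_def)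
  let ?N = "\<lambda>x. (\<Sum>j\<in>{1..<p}. norm (Fhat B (real j / real p + x)) ^ 2)"
  have key: "norm (Fhat B x) ^ 2 \<le> (real p - 1) * (?N x)" for x
  proof -
    have "(\<Sum>j\<in>{1..<p}. Fhat B (real j / real p + x)) = (\<Sum>b\<in>B. unit_exp (real b * x) * (\<Sum>j\<in>{1..<p}. unit_exp (of_int (int b) * (real j / real p))))"
      unfolding Fhat_def sum_distrib_left by (subst sum.swap) (simp add: ring_distribs unit_exp_add mult_ac)
    also have "\<dots> = (\<Sum>b\<in>B. unit_exp (real b * x) * of_real (chi p (int b)))"
      using p by (subst sum_unit_exp_eq_chi) auto
    also have "\<dots> = (\<Sum>b\<in>B. - unit_exp (real b * x))"
      using B by (intro sum.cong refl) (auto simp: chi_def)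
    also have "\<dots> = - Fhat B x" by (simp add: Fhat_def sum_negf)
    finally have "norm (Fhat B x) = norm (\<Sum>j\<in>{1..<p}. Fhat B (real j / real p + x))" by simp
    also have "\<dots> \<le> (\<Sum>j\<in>{1..<p}. 1 * norm (Fhat B (real j / real p + x)))"
      by (simp add: norm_sum)
    finally have "norm (Fhat B x) ^ 2 \<le> (\<Sum>j\<in>{1..<p}. 1 * norm (Fhat B (real j / real p + x))) ^ 2"
      by (intro power_mono) auto
    also have "\<dots> \<le> (\<Sum>j\<in>{1..<p}. 1 ^ 2) * (?N x)"
      by (rule Cauchy_Schwarz_ineq_sum)
    also have "(\<Sum>j\<in>{1..<p}. 1 ^ 2) = real p - 1" using p by simp
    finally show ?thesis .
  qed
  let ?n = "\<lambda>j h. norm (Fhat B (real j / real p + xi E h)) ^ 2"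
  have "freqs (insert p E) = (\<lambda>(j, h). h(p := j)) ` ({1..<p} \<times> freqs E)"
    unfolding freqs_def by (rule PiE_insert_eq)
  moreover have "inj_on (\<lambda>(j, h). h(p := j)) ({1..<p} \<times> freqs E)"
    unfolding freqs_def by (intro inj_combinator E)
  moreover have "xi (insert p E) (h(p := j)) = real j / real p + xi E h" for h j
    unfolding xi_def using fin E(3) by (auto intro!: sum.cong)
  ultimately have "energy (insert p E) B = (\<Sum>(j,h)\<in>{1..<p} \<times> freqs E. (?n j h))"
    unfolding energy_eq[OF pE] by (simp add: sum.reindex case_prod_unfold)
  also have "\<dots> = (\<Sum>h\<in>freqs E. \<Sum>j\<in>{1..<p}. (?n j h))"
    by (subst sum.cartesian_product[symmetric]) (rule sum.swap)
  finally have "(real p - 1) * energy (insert p E) B = (\<Sum>h\<in>freqs E. (real p - 1) * (\<Sum>j\<in>{1..<p}. (?n j h)))"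
    by (simp add: sum_distrib_left)
  also have "\<dots> \<ge> energy E B" unfolding energy_eq[OF E(1)] by (intro sum_mono key)
  finally show ?thesis .
qed

lemma energy_Un:
  assumes "finite M" "primeset E" "primeset M" "E \<inter> M = {}" "\<And>b p. b \<in> B \<Longrightarrow> p \<in> M \<Longrightarrow> \<not> p dvd b"
  shows "energy E B \<le> phi M * energy (E \<union> M) B"
  using assms
proof (induction M rule: finite_induct)
  case (insert p M)
  have p: "prime p" "primeset M" using insert.prems by (auto simp: primeset_def)
  have "energy E B \<le> phi M * energy (E \<union> M) B" using insert p by auto
  also have "\<dots> \<le> phi M * ((real p - 1) * energy (insert p (E \<union> M)) B)"
    using insert p phi_pos[OF p(2)] by (intro mult_left_mono energy_insert primeset_Un) auto
  also have "\<dots> = phi (insert p M) * energy (E \<union> insert p M) B"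
    using insert by (simp add: phi_def)
  finally show ?case .
qed simp

lemma dvd_prod_le: "finite E \<Longrightarrow> p \<in> E \<Longrightarrow> \<Prod>E > 0 \<Longrightarrow> p \<le> \<Prod>(E::nat set)"
  using dvd_prodI[of E p id] by (auto intro: dvd_imp_le)

text \<open>
  As \<open>B\<close> is coprime to \<open>M\<close>, the energy at \<open>E\<close> is dominated by the one at \<open>E \<union> M\<close>. Letting the primes of \<open>M\<close> exceed \<open>Q\<close>
  makes \<open>E\<close> and \<open>M\<close> recoverable from \<open>E \<union> M\<close>, so that each frequency is counted only once.
\<close>

lemma prime_large_sieve:
  assumes P: "primeset P" "\<And>p. p \<in> P \<Longrightarrow> \<not> p dvd W" and "Q > 0" "R > 0" "W > 0"
    and B: "\<And>b. b \<in> B \<Longrightarrow> b \<le> X \<and> b mod W = u" "\<And>b p. b \<in> B \<Longrightarrow> p \<in> P \<Longrightarrow> \<not> p dvd b"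
  shows "(\<Sum>E\<in>fam P Q. energy E B) * dens {p\<in>P. p > Q} R \<le> 8 * real (X div W + 1 + (Q * R) ^ 2) * real (card B)"
proof -
  define P' where "P' = {p\<in>P. p > Q}"
  have P': "primeset P'" using P(1) by (rule primeset_subset) (auto simp: P'_def)
  have fin: "finite (fam P Q)" "finite (fam P' R)" using P P' by (auto intro!: finite_fam simp: primesetD)
  have EM: "primeset E" "primeset M" "\<And>p. p \<in> E \<Longrightarrow> p \<le> Q" "\<And>p. p \<in> M \<Longrightarrow> p > Q" "E \<inter> M = {}" "E \<union> M \<subseteq> P"
    if EM: "E \<in> fam P Q" "M \<in> fam P' R" for E M
  proof -
    show 1: "primeset E" "primeset M" using that P P' fam_primeset by blast+
    show 2: "p \<le> Q" if "p \<in> E" for p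
      using dvd_prod_le[of E p] prod_primeset_pos[OF 1(1)] 1 that EM by (auto simp: fam_def primesetD)
    show 3: "p > Q" if "p \<in> M" for p using that EM by (auto simp: fam_def P'_def)
    show "E \<inter> M = {}" using 2 3 by fastforce
    show "E \<union> M \<subseteq> P" using EM by (auto simp: fam_def P'_def)
  qed
  let ?F = "fam P Q \<times> fam P' R"
  have inj: "inj_on (\<lambda>(E, M). E \<union> M) (?F)"
  proof (rule inj_onI, clarify)
    fix E M E' M' assume a: "E \<in> fam P Q" "M \<in> fam P' R" "E' \<in> fam P Q" "M' \<in> fam P' R" "E \<union> M = E' \<union> M'"
    have e: "E = {p \<in> E \<union> M. p \<le> Q}" "M = {p \<in> E \<union> M. p > Q}"
      using EM(3,4)[OF a(1,2)] by fastforce+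
    have e': "E' = {p \<in> E' \<union> M'. p \<le> Q}" "M' = {p \<in> E' \<union> M'. p > Q}"
      using EM(3,4)[OF a(3,4)] by fastforce+
    show "E = E' \<and> M = M'" using e e' a(5) by metis
  qed
  have "(\<Sum>E\<in>fam P Q. energy E B) * dens P' R = (\<Sum>(E, M)\<in>?F. energy E B * (1 / phi M))"
    unfolding dens_def sum_product by (simp add: sum.cartesian_product)
  also have "\<dots> \<le> (\<Sum>(E, M)\<in>?F. energy (E \<union> M) B)"
  proof (intro sum_mono, clarify)
    fix E M assume a: "E \<in> fam P Q" "M \<in> fam P' R"
    note EM = EM[OF a]
    have "energy E B \<le> phi M * energy (E \<union> M) B"
      using EM B(2) by (intro energy_Un) (auto simp: primesetD)
    then show "energy E B * (1 / phi M) \<le> energy (E \<union> M) B"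
      using phi_pos[OF EM(2)] by (simp add: pos_divide_le_eq mult.commute)
  qed
  also have "\<dots> = (\<Sum>E\<in>(\<lambda>(E, M). E \<union> M) ` (?F). energy E B)"
    by (subst sum.reindex[OF inj]) (simp add: case_prod_unfold o_def)
  also have "\<dots> \<le> 8 * real (X div W + 1 + (Q * R) ^ 2) * real (card B)"
  proof (intro sum_energy_le)
    fix F assume "F \<in> (\<lambda>(E, M). E \<union> M) ` (?F)"
    then obtain E M where F: "F = E \<union> M" and a: "E \<in> fam P Q" "M \<in> fam P' R" by auto
    note EM = EM[OF a]
    have "\<Prod>F = \<Prod>E * \<Prod>M" unfolding F using EM by (intro prod.union_disjoint) (auto simp: primesetD)
    also have "\<dots> \<le> Q * R" using a by (intro mult_le_mono) (auto simp: fam_def)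
    finally show "primeset F \<and> \<Prod>F \<le> Q * R \<and> (\<forall>p\<in>F. \<not> p dvd W)"
      using EM P(2) unfolding F by (auto intro!: primeset_Un)
  qed (use assms fin in auto)
  finally show ?thesis unfolding P'_def .
qed

text \<open>Montgomery's sieve: for Q = 1 in \<open>prime_large_sieve\<close> only the frequency 0
  remains, and its energy is the square of \<open>card B\<close>.\<close>

lemma sieve_bound:
  assumes P: "primeset P" "\<And>p. p \<in> P \<Longrightarrow> \<not> p dvd W" and "R > 0" "W > 0" "finite B"
    and B: "\<And>b. b \<in> B \<Longrightarrow> b \<le> X \<and> b mod W = u" "\<And>b p. b \<in> B \<Longrightarrow> p \<in> P \<Longrightarrow> \<not> p dvd b"
  shows "real (card B) * dens P R \<le> 8 * real (X div W + 1 + R ^ 2)"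
proof (cases "B = {}")
  case False
  have "fam P 1 = {{}}"
  proof -
    have "D = {}" if "D \<subseteq> P" "\<Prod>D \<le> 1" for D
    proof (rule ccontr)
      assume "D \<noteq> {}"
      then obtain p where p: "p \<in> D" by auto
      have D: "primeset D" by (rule primeset_subset[OF P(1) that(1)])
      then have "p \<le> \<Prod>D" using p prod_primeset_pos[OF D] by (intro dvd_prod_le) (auto simp: primesetD)
      then show False using that(2) primesetD(3)[OF D p] by simp
    qed
    then show ?thesis by (auto simp: fam_def)
  qed
  moreover have "{p\<in>P. p > 1} = P" using primesetD(3)[OF P(1)] by force
  ultimately have "real (card B) * real (card B) * dens P R \<le> 8 * real (X div W + 1 + (1 * R) ^ 2) * real (card B)"
    using prime_large_sieve[OF P, where Q=1 and R=R and B=B and X=X and u=u] assms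
    by (simp add: energy_def Chi_def)
  moreover have "real (card B) > 0" using False assms(5) by (simp add: card_gt_0_iff)
  ultimately show ?thesis by (simp add: mult_ac)
qed simp

section \<open>Selberg weights\<close>

text \<open>Selberg's divisor sum with its optimal coefficients, written in Ramanujan sums; the sign
  is the Moebius function. In this form the frequencies of its square can be read off.\<close>

definition selberg :: "nat set \<Rightarrow> nat \<Rightarrow> int \<Rightarrow> real" where
  "selberg P R n = (\<Sum>D\<in>fam P R. (-1) ^ card D / phi D * Chi D n) / dens P R"

lemma Chi_coprime:
  assumes "finite D" "\<And>p. p \<in> D \<Longrightarrow> \<not> int p dvd n"
  shows "Chi D n = (-1) ^ card D"
proof -
  have "Chi D n = (\<Prod>p\<in>D. -1)" unfolding Chi_def using assms by (intro prod.cong) (auto simp: chi_def)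
  then show ?thesis by simp
qed

lemma selberg_coprime:
  assumes "primeset P" "R \<ge> 1" "\<And>p. p \<in> P \<Longrightarrow> \<not> int p dvd n"
  shows "selberg P R n = 1"
proof -
  have "(\<Sum>D\<in>fam P R. (-1) ^ card D / phi D * Chi D n) = dens P R" unfolding dens_def
  proof (intro sum.cong refl)
    fix D assume D: "D \<in> fam P R"
    then have "primeset D" "D \<subseteq> P" using assms(1) fam_primeset by (auto simp: fam_def)
    then have "Chi D n = (-1) ^ card D" using assms(3) by (intro Chi_coprime) (auto simp: primesetD(1))
    then show "(-1) ^ card D / phi D * Chi D n = 1 / phi D" by (simp add: power_mult_distrib[symmetric])
  qed
  then show ?thesis using dens_ge_1[OF assms(1,2)] by (simp add: selberg_def)
qed

lemma chi_sq: "chi p n * chi p n = (real p - 2) * chi p n + (real p - 1)"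
  by (simp add: chi_def algebra_simps)

text \<open>At a common prime \<open>chi_sq\<close> splits the square into (p-2) chi and p-1.
  \<open>T\<close> collects the common primes where chi survives, so the new support is the
  symmetric difference together with \<open>T\<close>.\<close>

lemma Chi_mult:
  assumes "finite D1" "finite D2"
  shows "Chi D1 n * Chi D2 n = (\<Sum>T\<in>Pow (D1 \<inter> D2). (\<Prod>p\<in>T. real p - 2) * phi (D1 \<inter> D2 - T) * Chi ((D1 - D2) \<union> (D2 - D1) \<union> T) n)"
proof -
  have "Chi D1 n = Chi (D1 - D2) n * Chi (D1 \<inter> D2) n" "Chi D2 n = Chi (D2 - D1) n * Chi (D1 \<inter> D2) n"
    unfolding Chi_def using assms
    by (subst prod.union_disjoint[symmetric]; auto intro!: prod.cong)+
  then have "Chi D1 n * Chi D2 n = Chi (D1 - D2) n * Chi (D2 - D1) n * (\<Prod>p\<in>D1 \<inter> D2. chi p n * chi p n)"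
    by (simp add: Chi_def prod.distrib)
  also have "(\<Prod>p\<in>D1 \<inter> D2. chi p n * chi p n) = (\<Sum>T\<in>Pow (D1 \<inter> D2). (\<Prod>p\<in>T. (real p - 2) * chi p n) * (\<Prod>p\<in>D1 \<inter> D2 - T. real p - 1))"
    unfolding chi_sq using assms by (intro prod_add) auto
  also have "Chi (D1 - D2) n * Chi (D2 - D1) n * \<dots> = (\<Sum>T\<in>Pow (D1 \<inter> D2). (\<Prod>p\<in>T. real p - 2) * phi (D1 \<inter> D2 - T) * (Chi (D1 - D2) n * Chi (D2 - D1) n * Chi T n))"
    by (simp add: sum_distrib_left prod.distrib phi_def Chi_def mult_ac)
  also have "\<dots> = (\<Sum>T\<in>Pow (D1 \<inter> D2). (\<Prod>p\<in>T. real p - 2) * phi (D1 \<inter> D2 - T) * Chi ((D1 - D2) \<union> (D2 - D1) \<union> T) n)"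
  proof (intro sum.cong refl)
    fix T assume T: "T \<in> Pow (D1 \<inter> D2)"
    then have "finite T" using assms by (auto intro: finite_subset)
    moreover have "Chi ((D1 - D2) \<union> (D2 - D1)) n = Chi (D1 - D2) n * Chi (D2 - D1) n"
      unfolding Chi_def using assms by (intro prod.union_disjoint) auto
    moreover have "Chi ((D1 - D2) \<union> (D2 - D1) \<union> T) n = Chi ((D1 - D2) \<union> (D2 - D1)) n * Chi T n"
      unfolding Chi_def using assms T \<open>finite T\<close> by (intro prod.union_disjoint) auto
    ultimately show "(\<Prod>p\<in>T. real p - 2) * phi (D1 \<inter> D2 - T) * (Chi (D1 - D2) n * Chi (D2 - D1) n * Chi T n) =
      (\<Prod>p\<in>T. real p - 2) * phi (D1 \<inter> D2 - T) * Chi ((D1 - D2) \<union> (D2 - D1) \<union> T) n" by simp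
  qed
  finally show ?thesis .
qed

lemma phi_Un: "finite A \<Longrightarrow> finite B \<Longrightarrow> A \<inter> B = {} \<Longrightarrow> phi (A \<union> B) = phi A * phi B"
  unfolding phi_def by (rule prod.union_disjoint)

text \<open>
  The factor \<open>4 ^ card E\<close> counts (crudely) the ways in which \<open>E\<close> arises as the sum of two frequency supports \<open>D1\<close>, \<open>D2\<close>;
  the free common part \<open>V\<close> of \<open>D1\<close> and \<open>D2\<close> contributes \<open>dens P R\<close> and cancels one of the two normalising factors.
\<close>

lemma sum_selberg_sq_le:
  fixes n :: "'a \<Rightarrow> int"
  assumes P: "primeset P" and "R \<ge> 1" "finite J"
  shows "(\<Sum>j\<in>J. selberg P R (n j) ^ 2) \<le>
    (\<Sum>E\<in>fam P (R ^ 2). 4 ^ card E / phi E * \<bar>\<Sum>j\<in>J. Chi E (n j)\<bar>) / dens P R"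
proof -
  define G where "G = dens P R"
  have G: "G > 0" using dens_ge_1[OF P assms(2)] by (simp add: G_def)
  define S where "S E = (\<Sum>j\<in>J. Chi E (n j))" for E
  define F where "F = fam P R"
  have finF: "finite F" unfolding F_def using P by (intro finite_fam) (simp add: primesetD(1))
  have F: "primeset D" "finite D" "D \<subseteq> P" "\<Prod>D \<le> R" if "D \<in> F" for D
    using that fam_primeset[OF P, of D R] primesetD(1)[of D] unfolding F_def by (auto simp: fam_def)
  define e where "e = (\<lambda>(D1, D2, T). (D1 - D2) \<union> (D2 - D1) \<union> T :: nat set)"
  define \<Omega> where "\<Omega> = (SIGMA D1:F. SIGMA D2:F. Pow (D1 \<inter> D2))"
  let ?s = "\<lambda>D1 D2. (-1) ^ card D1 / phi D1 * ((-1) ^ card D2 / phi D2)"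
  let ?q = "\<lambda>T. (\<Prod>p\<in>T. real p - 2)"
  \<comment> \<open>With V the last entry, (D1, D2, T) is recovered from (E, D1 - D2, T, V). For
    given E there are at most 2^card E choices for each of the two middle entries, and V lies in
    \<open>F\<close>.\<close>
  let ?f = "(\<lambda>(D1, D2, T). (e (D1, D2, T), D1 - D2, T, D1 \<inter> D2 - T))"
  let ?X = "(SIGMA E:fam P (R^2). Pow E \<times> Pow E \<times> F)"
  let ?g = "\<lambda>E V. \<bar>S E\<bar> / (phi E * phi V)"
  let ?h = "\<lambda>D1 D2 T. \<bar>S (e (D1, D2, T))\<bar> / (phi (e (D1, D2, T)) * phi (D1 \<inter> D2 - T))"
  have "(\<Sum>j\<in>J. selberg P R (n j) ^ 2) = (\<Sum>j\<in>J. \<Sum>D1\<in>F. \<Sum>D2\<in>F. \<Sum>T\<in>Pow (D1 \<inter> D2).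
     (?s D1 D2) * ((?q T) * phi (D1 \<inter> D2 - T)) * Chi ((D1 - D2) \<union> (D2 - D1) \<union> T) (n j)) / G ^ 2"
  proof -
    have "selberg P R (n j) ^ 2 = (\<Sum>D1\<in>F. \<Sum>D2\<in>F. (?s D1 D2) * (Chi D1 (n j) * Chi D2 (n j))) / G ^ 2" for j
      unfolding selberg_def F_def[symmetric] G_def[symmetric]
      by (simp add: power_divide power2_eq_square[of "sum _ _"] sum_product mult_ac)
    also have "\<dots> j = (\<Sum>D1\<in>F. \<Sum>D2\<in>F. \<Sum>T\<in>Pow (D1 \<inter> D2).
     (?s D1 D2) * ((?q T) * phi (D1 \<inter> D2 - T)) * Chi ((D1 - D2) \<union> (D2 - D1) \<union> T) (n j)) / G ^ 2" for j
      by (intro arg_cong2[of _ _ _ _ "(/)"] sum.cong refl) (simp add: Chi_mult F sum_distrib_left mult_ac)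
    finally show ?thesis by (simp add: sum_divide_distrib)
  qed
  also have "\<dots> = (\<Sum>D1\<in>F. \<Sum>D2\<in>F. \<Sum>T\<in>Pow (D1 \<inter> D2).
     (?s D1 D2) * ((?q T) * phi (D1 \<inter> D2 - T)) * S ((D1 - D2) \<union> (D2 - D1) \<union> T)) / G ^ 2"
  proof -
    have "(\<Sum>j\<in>J. \<Sum>D1\<in>F. \<Sum>D2\<in>F. \<Sum>T\<in>Pow (D1 \<inter> D2). c D1 D2 T * Chi (u D1 D2 T) (n j)) =
        (\<Sum>D1\<in>F. \<Sum>D2\<in>F. \<Sum>T\<in>Pow (D1 \<inter> D2). c D1 D2 T * S (u D1 D2 T))" for c u
    proof -
      have "(\<Sum>j\<in>J. \<Sum>D1\<in>F. \<Sum>D2\<in>F. \<Sum>T\<in>Pow (D1 \<inter> D2). c D1 D2 T * Chi (u D1 D2 T) (n j)) =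
        (\<Sum>D1\<in>F. \<Sum>j\<in>J. \<Sum>D2\<in>F. \<Sum>T\<in>Pow (D1 \<inter> D2). c D1 D2 T * Chi (u D1 D2 T) (n j))"
        by (rule sum.swap)
      also have "\<dots> = (\<Sum>D1\<in>F. \<Sum>D2\<in>F. \<Sum>j\<in>J. \<Sum>T\<in>Pow (D1 \<inter> D2). c D1 D2 T * Chi (u D1 D2 T) (n j))"
        by (intro sum.cong refl sum.swap)
      also have "\<dots> = (\<Sum>D1\<in>F. \<Sum>D2\<in>F. \<Sum>T\<in>Pow (D1 \<inter> D2). \<Sum>j\<in>J. c D1 D2 T * Chi (u D1 D2 T) (n j))"
        by (intro sum.cong refl sum.swap)
      finally show ?thesis by (simp add: S_def sum_distrib_left)
    qed
    then show ?thesis by (simp only:)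
  qed
  also have "\<dots> \<le> (\<Sum>D1\<in>F. \<Sum>D2\<in>F. \<Sum>T\<in>Pow (D1 \<inter> D2). (?h D1 D2 T)) / G ^ 2"
  proof (intro divide_right_mono sum_mono)
    fix D1 D2 T assume D: "D1 \<in> F" "D2 \<in> F" and T: "T \<in> Pow (D1 \<inter> D2)"
    define V where "V = D1 \<inter> D2 - T"
    have fT: "finite T" "primeset T" using T F[OF D(1)] by (auto intro: finite_subset primeset_subset)
    have pos: "phi (D1 - D2) > 0" "phi (D2 - D1) > 0" "phi T > 0" "phi V > 0"
      using F[OF D(1)] F[OF D(2)] T by (auto simp: V_def intro!: phi_pos intro: primeset_subset)
    \<comment> \<open>phi(D1) phi(D2) = phi(E) phi(T) phi(V)^2, so a coefficient of size at most
      phi(T) phi(V) leaves 1/(phi(E) phi(V)).\<close>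
    have d: "phi D1 = phi (D1 - D2) * phi T * phi V" "phi D2 = phi (D2 - D1) * phi T * phi V"
    proof -
      have "D1 = (D1 - D2) \<union> T \<union> V" "D2 = (D2 - D1) \<union> T \<union> V" using T by (auto simp: V_def)
      then have "phi D1 = phi ((D1 - D2) \<union> T \<union> V)" "phi D2 = phi ((D2 - D1) \<union> T \<union> V)" by simp_all
      then show "phi D1 = phi (D1 - D2) * phi T * phi V" "phi D2 = phi (D2 - D1) * phi T * phi V"
        using F[OF D(1)] F[OF D(2)] fT T by (simp, subst phi_Un; (subst phi_Un)?; auto simp: V_def)+
    qed
    have "e (D1, D2, T) = (D1 - D2) \<union> (D2 - D1) \<union> T" by (simp add: e_def)
    moreover have "phi ((D1 - D2) \<union> (D2 - D1) \<union> T) = phi (D1 - D2) * phi (D2 - D1) * phi T"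
      using F[OF D(1)] F[OF D(2)] fT T by (subst phi_Un; (subst phi_Un)?; auto)
    ultimately have e: "phi (e (D1, D2, T)) = phi (D1 - D2) * phi (D2 - D1) * phi T" by simp
    have q: "0 \<le> (?q T)" "(?q T) \<le> phi T"
      using primesetD(3)[OF fT(2)] by (force simp: phi_def intro!: prod_nonneg prod_mono)+
    define X where "X = S (e (D1, D2, T))"
    have "(?s D1 D2) * ((?q T) * phi V) * X
      \<le> \<bar>(?s D1 D2) * ((?q T) * phi V) * X\<bar>" by (rule abs_ge_self)
    also have "\<dots> = (?q T) * (phi V / (phi D1 * phi D2) * \<bar>X\<bar>)"
      using q pos d by (simp add: abs_mult power_abs)
    also have "\<dots> \<le> phi T * (phi V / (phi D1 * phi D2) * \<bar>X\<bar>)"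
      using q pos d by (intro mult_right_mono) auto
    also have "\<dots> = \<bar>X\<bar> / (phi (e (D1, D2, T)) * phi V)" unfolding d e using pos by (simp add: divide_simps)
    finally show "(?s D1 D2) * ((?q T) * phi (D1 \<inter> D2 - T)) * S ((D1 - D2) \<union> (D2 - D1) \<union> T)
        \<le> (?h D1 D2 T)"
      unfolding X_def V_def by (simp add: e_def)
  qed auto
  also have "(\<Sum>D1\<in>F. \<Sum>D2\<in>F. \<Sum>T\<in>Pow (D1 \<inter> D2). (?h D1 D2 T))
     = (\<Sum>(D1, D2, T)\<in>\<Omega>. (?h D1 D2 T))"
    unfolding \<Omega>_def using finF F by (simp add: sum.Sigma)
  also have "\<dots> = (\<Sum>(E, E1, T, V)\<in>?f ` \<Omega>. (?g E V))"
  proof (subst sum.reindex)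
    show "inj_on ?f \<Omega>"
    proof (rule inj_onI)
      fix x y assume xy: "x \<in> \<Omega>" "y \<in> \<Omega>"
        "?f x = ?f y"
      obtain D1 D2 T D1' D2' T' where eq: "x = (D1, D2, T)" "y = (D1', D2', T')" by (metis surj_pair)
      have TT: "T' = T" using xy(3) eq by simp
      have a: "(D1, D2, T) \<in> \<Omega>" "(D1', D2', T) \<in> \<Omega>" "e (D1, D2, T) = e (D1', D2', T)" "D1 - D2 = D1' - D2'" "D1 \<inter> D2 - T = D1' \<inter> D2' - T"
        using xy unfolding eq TT by simp_all
      have T: "T \<subseteq> D1 \<inter> D2" "T \<subseteq> D1' \<inter> D2'" using a by (auto simp: \<Omega>_def)
      then have i: "D1 \<inter> D2 = D1' \<inter> D2'" using a(5) by blast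
      have "D1 = (D1 - D2) \<union> (D1 \<inter> D2)" "D1' = (D1' - D2') \<union> (D1' \<inter> D2')" by auto
      then have 1: "D1 = D1'" using i a(4) by metis
      have "D2 - D1 = e (D1, D2, T) - (D1 - D2) - T" "D2' - D1' = e (D1', D2', T) - (D1' - D2') - T"
        using T by (auto simp: e_def)
      then have "D2 - D1 = D2' - D1'" using a by metis
      moreover have "D2 = (D2 - D1) \<union> (D1 \<inter> D2)" "D2' = (D2' - D1') \<union> (D1' \<inter> D2')" by auto
      ultimately have "D2 = D2'" using i by metis
      then show "x = y" using 1 eq TT by simp
    qed
  qed (auto intro!: sum.cong)
  also have "\<dots> \<le> (\<Sum>(E, E1, T, V)\<in>?X. (?g E V))"
  proof (intro sum_mono2)
    have "finite (fam P (R^2))" using P by (intro finite_fam) (simp add: primesetD(1))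
    moreover have "finite (Pow E \<times> Pow E \<times> F)" if "E \<in> fam P (R^2)" for E
      using that fam_primeset[OF P that] finF by (simp add: primesetD(1))
    ultimately show "finite ?X" by (rule finite_SigmaI)
    show "?f ` \<Omega> \<subseteq> ?X"
    proof (rule image_subsetI)
      fix x assume x: "x \<in> \<Omega>"
      obtain D1 D2 T where eq: "x = (D1, D2, T)" by (metis surj_pair)
      then have D: "D1 \<in> F" "D2 \<in> F" "T \<subseteq> D1 \<inter> D2" using x by (auto simp: \<Omega>_def)
      have mono: "\<Prod>X \<le> \<Prod>Y" if "primeset Y" "X \<subseteq> Y" for X Y :: "nat set"
        using prod_dvd_prod_subset[of Y X id] prod_primeset_pos[OF that(1)] that primesetD(1)[OF that(1)]
        by (auto intro: dvd_imp_le)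
      have "D1 \<inter> D2 - T \<subseteq> P" using F(3)[OF D(1)] by auto
      moreover have "\<Prod>(D1 \<inter> D2 - T) \<le> R" using mono[of D1 "D1 \<inter> D2 - T"] F(1,4)[OF D(1)] by fastforce
      ultimately have V: "D1 \<inter> D2 - T \<in> F" unfolding F_def fam_def by simp
      have ps: "primeset (D1 \<union> D2)" by (intro primeset_Un F D)
      have "\<Prod>(e (D1, D2, T)) \<le> \<Prod>(D1 \<union> D2)" using D ps by (intro mono) (auto simp: e_def)
      also have "\<dots> \<le> \<Prod>(D1 \<union> D2) * \<Prod>(D1 \<inter> D2)"
        using prod_primeset_pos[OF primeset_subset[OF ps, of "D1 \<inter> D2"]] by fastforce
      also have "\<dots> = \<Prod>D1 * \<Prod>D2" using prod.union_inter[of D1 D2 id] F D by simp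
      also have "\<dots> \<le> R * R" using F D by (intro mult_le_mono) auto
      finally have "\<Prod>(e (D1, D2, T)) \<le> R^2" by (simp add: power2_eq_square)
      moreover have "e (D1, D2, T) \<subseteq> P" using F(3)[OF D(1)] F(3)[OF D(2)] D(3) by (auto simp: e_def)
      ultimately have "e (D1, D2, T) \<in> fam P (R^2)" by (simp add: fam_def)
      moreover have "D1 - D2 \<subseteq> e (D1, D2, T)" "T \<subseteq> e (D1, D2, T)" by (auto simp: e_def)
      ultimately show "(case x of (D1, D2, T) \<Rightarrow> (e (D1, D2, T), D1 - D2, T, D1 \<inter> D2 - T)) \<in> ?X"
        using V eq by simp
    qed
    fix x assume "x \<in> ?X - ?f ` \<Omega>"
    then obtain E E1 T V where x: "x = (E, E1, T, V)" "E \<in> fam P (R^2)" "V \<in> F" by auto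
    have "phi E > 0" "phi V > 0" using x F fam_primeset[OF P] by (auto intro!: phi_pos)
    then show "0 \<le> (case x of (E, E1, T, V) \<Rightarrow> (?g E V))" using x by simp
  qed
  also have "\<dots> = (\<Sum>E\<in>fam P (R^2). \<Sum>E1\<in>Pow E. \<Sum>T\<in>Pow E. \<Sum>V\<in>F. (?g E V))"
  proof -
    have "(\<Sum>(E, E1, T, V)\<in>?X. (?g E V)) =
      (\<Sum>E\<in>fam P (R^2). \<Sum>(E1, T, V)\<in>Pow E \<times> Pow E \<times> F. (?g E V))"
      using P finF fam_primeset[OF P] by (subst sum.Sigma) (auto simp: finite_fam primesetD(1))
    then show ?thesis by (simp only: sum.cartesian_product)
  qed
  also have "\<dots> = (\<Sum>E\<in>fam P (R^2). 4 ^ card E / phi E * \<bar>S E\<bar> * G)"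
  proof (intro sum.cong refl)
    fix E assume "E \<in> fam P (R^2)"
    then have fE: "finite E" using fam_primeset[OF P] by (simp add: primesetD(1))
    have "(\<Sum>V\<in>F. (?g E V)) = \<bar>S E\<bar> / phi E * G"
      unfolding G_def dens_def F_def sum_distrib_left by simp
    then show "(\<Sum>E1\<in>Pow E. \<Sum>T\<in>Pow E. \<Sum>V\<in>F. (?g E V)) = 4 ^ card E / phi E * \<bar>S E\<bar> * G"
      using fE by (simp add: card_Pow power_mult_distrib[symmetric])
  qed
  finally have "(\<Sum>j\<in>J. selberg P R (n j) ^ 2) \<le> (\<Sum>E\<in>fam P (R^2). 4 ^ card E / phi E * \<bar>S E\<bar> * G) / G ^ 2"
    by (simp add: divide_right_mono)
  also have "\<dots> = (\<Sum>E\<in>fam P (R^2). 4 ^ card E / phi E * \<bar>S E\<bar>) / G"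
    unfolding sum_distrib_right[symmetric] power2_eq_square using G by simp
  finally show ?thesis unfolding S_def G_def .
qed


text \<open>As w sums to O(Q^(1/8)) up to Q, the dyadic level 2^j z contributes O((2^j z)^(-3/4)).
  The ratio 2^(-3/4) \<le> 3/5 gives a geometric sum of at most 5/2, whence 5 = 2 * 5/2.\<close>

lemma dyadic_weighted_sum_le:
  fixes q :: "'a \<Rightarrow> nat" and w :: "'a \<Rightarrow> real"
  assumes "finite F" "z \<ge> 1" "B \<ge> 0" "\<And>E. E \<in> F \<Longrightarrow> q E > z" "\<And>E. E \<in> F \<Longrightarrow> 0 \<le> w E"
    and bound: "\<And>Q. Q \<ge> z \<Longrightarrow> (\<Sum>E | E \<in> F \<and> q E \<le> Q. w E) \<le> B * real Q powr (1/8)"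
  shows "(\<Sum>E\<in>F. real (q E) powr (-7/8) * w E) \<le> 5 * B * real z powr (-3/4)"
proof -
  define J where "J = Max (insert 0 (q ` F))"
  have J: "q E \<le> 2 ^ J * z" if "E \<in> F" for E
  proof -
    have "q E \<le> J" unfolding J_def using assms(1) that by (intro Max_ge) auto
    also have "J \<le> 2 ^ J" by (simp add: less_imp_le)
    also have "\<dots> \<le> 2 ^ J * z" using assms(2) by simp
    finally show ?thesis .
  qed
  define c where "c j = 2 * real (2 ^ j * z) powr (-7/8)" for j
  let ?W = "\<lambda>j. (\<Sum>E | E \<in> F \<and> q E \<le> 2 ^ j * z. w E)"
  let ?B = "2 * B * real z powr (-3/4)"
  \<comment> \<open>The levels are nested: E is charged to every j with q(E) \<le> 2^j z, which only
    enlarges the right side. The least such j suffices, as 2^j z \<le> 2 q(E) there; this is the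
    factor 2 \<ge> 2^(7/8) in \<open>c\<close>.\<close>
  have "real (q E) powr (-7/8) \<le> (\<Sum>j | j \<le> J \<and> q E \<le> 2 ^ j * z. c j)" if E: "E \<in> F" for E
  proof -
    define j where "j = (LEAST j. q E \<le> 2 ^ j * z)"
    have j: "q E \<le> 2 ^ j * z" "j \<le> J" unfolding j_def using J[OF E] by (auto intro: LeastI Least_le)
    have "j \<noteq> 0" using j(1) assms(4)[OF E] by (cases j) auto
    then obtain i where i: "j = Suc i" by (cases j) auto
    have "\<not> q E \<le> 2 ^ i * z" using not_less_Least[of i "\<lambda>j. q E \<le> 2 ^ j * z"] i unfolding j_def by simp
    then have "2 ^ j * z \<le> 2 * q E" using i by simp
    then have *: "real (2 ^ j * z) \<le> 2 * real (q E)" by (metis of_nat_le_iff of_nat_mult of_nat_numeral)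
    have zpos: "0 < real (2 ^ j * z)" using assms(2) by simp
    have qpos: "0 < real (q E)" using assms(4)[OF E] by simp
    have "(2 * real (q E)) powr (-7/8) \<le> real (2 ^ j * z) powr (-7/8)"
      using zpos * by (intro powr_mono2') auto
    then have "2 powr (-7/8) * real (q E) powr (-7/8) \<le> real (2 ^ j * z) powr (-7/8)"
      using qpos by (simp add: powr_mult)
    then have "2 powr (7/8) * (2 powr (-7/8) * real (q E) powr (-7/8)) \<le> 2 powr (7/8) * real (2 ^ j * z) powr (-7/8)"
      by (intro mult_left_mono) auto
    then have "real (q E) powr (-7/8) \<le> 2 powr (7/8) * real (2 ^ j * z) powr (-7/8)"
      by (simp add: mult.assoc[symmetric] powr_add[symmetric])
    also have "2 powr (7/8) \<le> (2::real)" using powr_mono[of "7/8" 1 "2::real"] by simp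
    then have "2 powr (7/8) * real (2 ^ j * z) powr (-7/8) \<le> c j" unfolding c_def by (intro mult_right_mono) auto
    also have "c j = (\<Sum>j\<in>{j}. c j)" by simp
    also have "\<dots> \<le> (\<Sum>j | j \<le> J \<and> q E \<le> 2 ^ j * z. c j)"
      using j by (intro sum_mono2) (auto simp: c_def)
    finally show ?thesis .
  qed
  then have "(\<Sum>E\<in>F. real (q E) powr (-7/8) * w E) \<le> (\<Sum>E\<in>F. (\<Sum>j | j \<le> J \<and> q E \<le> 2 ^ j * z. c j) * w E)"
    using assms(5) by (intro sum_mono mult_right_mono) auto
  also have "\<dots> = (\<Sum>E\<in>F. \<Sum>j\<le>J. if q E \<le> 2 ^ j * z then c j * w E else 0)"
  proof (intro sum.cong refl)
    fix E
    have "(\<Sum>j\<le>J. if q E \<le> 2 ^ j * z then c j * w E else 0) = (\<Sum>j | j \<le> J \<and> q E \<le> 2 ^ j * z. c j * w E)"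
      by (intro sum.mono_neutral_cong_right) auto
    then show "(\<Sum>j | j \<le> J \<and> q E \<le> 2 ^ j * z. c j) * w E = (\<Sum>j\<le>J. if q E \<le> 2 ^ j * z then c j * w E else 0)"
      by (simp add: sum_distrib_right)
  qed
  also have "\<dots> = (\<Sum>j\<le>J. \<Sum>E\<in>F. if q E \<le> 2 ^ j * z then c j * w E else 0)" by (rule sum.swap)
  also have "\<dots> = (\<Sum>j\<le>J. c j * (?W j))"
  proof (intro sum.cong refl)
    fix j
    have "(\<Sum>E\<in>F. if q E \<le> 2 ^ j * z then c j * w E else 0) = (\<Sum>E | E \<in> F \<and> q E \<le> 2 ^ j * z. c j * w E)"
      using assms(1) by (intro sum.mono_neutral_cong_right) auto
    then show "(\<Sum>E\<in>F. if q E \<le> 2 ^ j * z then c j * w E else 0) = c j * (?W j)"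
      by (simp add: sum_distrib_left)
  qed
  also have "\<dots> \<le> (\<Sum>j\<le>J. ?B * (3/5) ^ j)"
  proof (intro sum_mono)
    fix j
    define y where "y = real (2 ^ j * z)"
    have y: "y > 0" using assms(2) by (simp add: y_def)
    have "c j * (?W j) \<le> c j * (B * y powr (1/8))"
      unfolding y_def using assms(2) by (intro mult_left_mono bound) (auto simp: c_def)
    also have "\<dots> = 2 * B * (y powr (-7/8) * y powr (1/8))" by (simp add: c_def y_def)
    also have "y powr (-7/8) * y powr (1/8) = y powr (-3/4)" by (simp add: powr_add[symmetric])
    also have "y powr (-3/4) = real z powr (-3/4) * (2 powr (-3/4)) ^ j"
      using assms(2) by (simp add: y_def powr_mult powr_powr powr_realpow[symmetric] mult.commute)
    also have "(2::real) powr (-3/4) \<le> 3/5"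
    proof -
      have "((2::real) powr (-3/4)) ^ 4 = (2 powr (-3/4)) powr real 4" by (rule powr_realpow[symmetric]) simp
      also have "\<dots> = 2 powr (-3)" by (simp only: powr_powr) simp
      also have "\<dots> = 1/8" by (simp add: powr_minus_divide)
      also have "\<dots> \<le> (3/5) ^ 4" by (simp add: power_divide)
      finally show ?thesis by (subst (asm) power_mono_iff) auto
    qed
    then have "2 * B * (real z powr (-3/4) * (2 powr (-3/4)) ^ j) \<le> 2 * B * (real z powr (-3/4) * (3/5) ^ j)"
      using assms(3) by (intro mult_left_mono power_mono) auto
    finally show "c j * (?W j) \<le> ?B * (3/5) ^ j"
      by (simp add: mult_ac)
  qed
  also have "\<dots> = ?B * (\<Sum>j\<le>J. (3/5) ^ j)" by (simp add: sum_distrib_left)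
  also have "(\<Sum>j\<le>J. (3/5::real) ^ j) \<le> 5/2"
  proof -
    have "(\<Sum>j\<le>J. (3/5::real) ^ j) = (1 - (3/5) ^ Suc J) / (2/5)"
      by (subst sum_gp0) simp
    also have "\<dots> \<le> 5/2" by simp
    finally show ?thesis .
  qed
  then have "?B * (\<Sum>j\<le>J. (3/5) ^ j) \<le> ?B * (5/2)"
    using assms(3) by (intro mult_left_mono) auto
  finally show ?thesis by simp
qed

text \<open>390625 = 5^8: with t = p^(1/8) \<ge> 5 one has 4 t^7 + 1 \<le> 5 t^7 \<le> t^8 = p.
  Hence the factor 4^card E of the Selberg square costs only the power 1/8 of the modulus.\<close>

lemma four_div_pred_le_powr:
  fixes p :: real
  assumes "p \<ge> 390625"
  shows "4 / (p - 1) \<le> p powr (-7/8)"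
proof -
  define t where "t = p powr (1/8)"
  have t8: "t ^ 8 = p" using assms powr_realpow[of t 8, symmetric] by (simp add: t_def powr_powr)
  have "t \<ge> 5"
  proof (rule power_le_imp_le_base[of _ 7])
    show "5 ^ Suc 7 \<le> t ^ Suc 7" using t8 assms by simp
  qed (simp add: t_def)
  have "p powr (-7/8) = 1 / t ^ 7"
    using assms powr_realpow[of t 7, symmetric] by (simp add: t_def powr_powr powr_minus_divide)
  moreover have "4 * t ^ 7 \<le> p - 1"
  proof -
    have "t ^ 7 \<ge> 1" using \<open>t \<ge> 5\<close> by simp
    moreover have "5 * t ^ 7 \<le> t * t ^ 7" using \<open>t \<ge> 5\<close> by (intro mult_right_mono) auto
    moreover have "t * t ^ 7 = p" using t8 by (simp flip: power_Suc)
    ultimately show ?thesis by linarith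
  qed
  then have "4 / (p - 1) \<le> 1 / t ^ 7" using assms \<open>t \<ge> 5\<close> by (simp add: divide_simps mult.commute)
  ultimately show ?thesis by simp
qed

lemma weight_le_powr:
  assumes "primeset E" "\<And>p. p \<in> E \<Longrightarrow> p \<ge> 390625"
  shows "4 ^ card E / phi E \<le> real (\<Prod>E) powr (-7/8)"
proof -
  have "4 ^ card E / phi E = (\<Prod>p\<in>E. 4 / (real p - 1))"
    unfolding phi_def prod_dividef by simp
  also have "\<dots> \<le> (\<Prod>p\<in>E. real p powr (-7/8))"
  proof (intro prod_mono conjI)
    fix p assume "p \<in> E"
    then have "real p \<ge> 390625" using assms(2)[of p] by simp
    then show "0 \<le> 4 / (real p - 1)" "4 / (real p - 1) \<le> real p powr (-7/8)"
      using four_div_pred_le_powr by auto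
  qed
  also have "\<dots> = real (\<Prod>E) powr (-7/8)" unfolding of_nat_prod by (rule prod_powr_distrib[symmetric])
  finally show ?thesis .
qed

section \<open>Bounding the non-principal frequencies\<close>

definition residue_class :: "nat \<Rightarrow> nat \<Rightarrow> nat set \<Rightarrow> nat set" where "residue_class W u A = {a\<in>A. a mod W = u}"
text \<open>The energy is split over the classes modulo \<open>W\<close>, on which the condition of
  \<open>coprime_pairs\<close> is constant. Within a class the large sieve sees about X/W integers,
  which compensates the factor \<open>W\<close> lost in recombining the classes.\<close>

definition cenergy :: "nat \<Rightarrow> nat set \<Rightarrow> nat set \<Rightarrow> real" where "cenergy W E A = (\<Sum>u<W. energy E (residue_class W u A))"
definition coprime_pairs :: "nat \<Rightarrow> nat set \<Rightarrow> nat set \<Rightarrow> (nat \<times> nat) set" where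
  "coprime_pairs W A S = {(a, s) \<in> A \<times> S. coprime (int s - int a) (int W)}"

lemma cenergy_nonneg: "primeset E \<Longrightarrow> 0 \<le> cenergy W E A"
  unfolding cenergy_def by (intro sum_nonneg energy_nonneg)

lemma sum_residue_class: "finite A \<Longrightarrow> W > 0 \<Longrightarrow> (\<Sum>u<W. \<Sum>a\<in>residue_class W u A. f a) = (\<Sum>a\<in>A. f a)"
  unfolding residue_class_def by (rule sum.group) auto

lemma sum_card_residue_class: "finite A \<Longrightarrow> W > 0 \<Longrightarrow> (\<Sum>u<W. real (card (residue_class W u A))) = real (card A)"
  using sum_residue_class[of A W "\<lambda>_. 1::real"] by simp

lemma finite_coprime_pairs: "finite A \<Longrightarrow> finite S \<Longrightarrow> finite (coprime_pairs W A S)"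
  unfolding coprime_pairs_def by (rule finite_subset[of _ "A \<times> S"]) auto

lemma coprime_diff_cong:
  assumes "W > 0" "a mod W = u" "s mod W = v"
  shows "coprime (int s - int a) (int W) \<longleftrightarrow> coprime (int v - int u) (int W)"
proof -
  have "(int s - int a) mod int W = (int s mod int W - int a mod int W) mod int W" by (simp only: mod_diff_eq)
  moreover have "int s mod int W = int v" "int a mod int W = int u" using assms(2,3) by (simp_all flip: zmod_int)
  ultimately have "(int s - int a) mod int W = (int v - int u) mod int W" by simp
  moreover have "int W \<noteq> 0" using assms(1) by simp
  ultimately show ?thesis
    using coprime_mod_left_iff[of "int W" "int s - int a"] coprime_mod_left_iff[of "int W" "int v - int u"] by metis
qed

lemma sum_sqrt_le:
  assumes "\<And>u. u < W \<Longrightarrow> 0 \<le> x u"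
  shows "(\<Sum>u<W. sqrt (x u)) \<le> sqrt (real W * (\<Sum>u<W. x u))"
proof (rule real_le_rsqrt)
  have "(\<Sum>u<W. 1 * sqrt (x u)) ^ 2 \<le> (\<Sum>u<W. 1 ^ 2) * (\<Sum>u<W. sqrt (x u) ^ 2)"
    by (rule Cauchy_Schwarz_ineq_sum)
  then show "(\<Sum>u<W. sqrt (x u)) ^ 2 \<le> real W * (\<Sum>u<W. x u)" using assms by simp
qed

text \<open>Once the residues of a and s modulo \<open>W\<close> are fixed, so is the coprimality
  condition, and two energies bound the inner sum. Dropping the condition lets the sum over the
  residues factor; Cauchy-Schwarz over \<open>W\<close> classes loses sqrt W on each side.\<close>

lemma sum_coprime_pairs_Chi_le:
  assumes "primeset E" "W > 0" "finite A" "finite S"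
  shows "\<bar>\<Sum>(a, s)\<in>coprime_pairs W A S. Chi E (int s - int a)\<bar> \<le> real W * (sqrt (cenergy W E S) * sqrt (cenergy W E A))"
proof -
  define c where "c v u \<longleftrightarrow> coprime (int v - int u) (int W)" for v u :: nat
  have "(\<Sum>(a, s)\<in>coprime_pairs W A S. Chi E (int s - int a)) = (\<Sum>(a, s)\<in>A \<times> S. if c s a then Chi E (int s - int a) else 0)"
    unfolding coprime_pairs_def c_def using assms by (intro sum.mono_neutral_cong_left) (auto split: if_splits)
  also have "\<dots> = (\<Sum>a\<in>A. \<Sum>s\<in>S. if c s a then Chi E (int s - int a) else 0)"
    by (simp add: sum.cartesian_product)
  also have "\<dots> = (\<Sum>s\<in>S. \<Sum>a\<in>A. if c s a then Chi E (int s - int a) else 0)"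
    by (rule sum.swap)
  also have "\<dots> = (\<Sum>v<W. \<Sum>s\<in>residue_class W v S. \<Sum>u<W. \<Sum>a\<in>residue_class W u A. if c s a then Chi E (int s - int a) else 0)"
    using assms by (simp add: sum_residue_class)
  also have "\<dots> = (\<Sum>v<W. \<Sum>u<W. \<Sum>s\<in>residue_class W v S. \<Sum>a\<in>residue_class W u A. if c s a then Chi E (int s - int a) else 0)"
    by (intro sum.cong refl sum.swap)
  also have "\<dots> = (\<Sum>v<W. \<Sum>u<W. if c v u then \<Sum>s\<in>residue_class W v S. \<Sum>a\<in>residue_class W u A. Chi E (int s - int a) else 0)"
  proof (intro sum.cong refl)
    fix v u
    have "c s a = c v u" if "s \<in> residue_class W v S" "a \<in> residue_class W u A" for s a
      unfolding c_def by (rule coprime_diff_cong) (use that assms(2) in \<open>auto simp: residue_class_def\<close>)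
    then show "(\<Sum>s\<in>residue_class W v S. \<Sum>a\<in>residue_class W u A. if c s a then Chi E (int s - int a) else 0) =
      (if c v u then \<Sum>s\<in>residue_class W v S. \<Sum>a\<in>residue_class W u A. Chi E (int s - int a) else 0)"
      by simp
  qed
  also have "\<bar>\<dots>\<bar> \<le> (\<Sum>v<W. \<Sum>u<W. \<bar>if c v u then \<Sum>s\<in>residue_class W v S. \<Sum>a\<in>residue_class W u A. Chi E (int s - int a) else 0\<bar>)"
    by (rule order_trans[OF sum_abs]) (intro sum_mono sum_abs)
  also have "\<dots> \<le> (\<Sum>v<W. \<Sum>u<W. sqrt (energy E (residue_class W v S)) * sqrt (energy E (residue_class W u A)))"
    using sum_Chi_le[OF assms(1)] energy_nonneg[OF assms(1)] by (intro sum_mono) auto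
  also have "\<dots> = (\<Sum>v<W. sqrt (energy E (residue_class W v S))) * (\<Sum>u<W. sqrt (energy E (residue_class W u A)))"
    by (simp add: sum_product)
  also have "\<dots> \<le> sqrt (real W * cenergy W E S) * sqrt (real W * cenergy W E A)"
    unfolding cenergy_def using energy_nonneg[OF assms(1)]
    by (intro mult_mono sum_sqrt_le sum_nonneg) (auto intro!: sum_nonneg mult_nonneg_nonneg)
  also have "\<dots> = real W * (sqrt (cenergy W E S) * sqrt (cenergy W E A))"
    by (simp add: real_sqrt_mult)
  finally show ?thesis .
qed

lemma sum_cenergy_le:
  assumes P: "primeset P" "\<And>p. p \<in> P \<Longrightarrow> \<not> p dvd W" and "Q > 0" "W > 0" "S \<subseteq> {..X}"
  shows "(\<Sum>E\<in>fam P Q. cenergy W E S) \<le> 8 * real (X div W + 1 + Q ^ 2) * real (card S)"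
proof -
  have "(\<Sum>E\<in>fam P Q. cenergy W E S) = (\<Sum>u<W. \<Sum>E\<in>fam P Q. energy E (residue_class W u S))"
    unfolding cenergy_def by (rule sum.swap)
  also have "\<dots> \<le> (\<Sum>u<W. 8 * real (X div W + 1 + Q ^ 2) * real (card (residue_class W u S)))"
  proof (intro sum_mono sum_energy_le)
    fix E assume "E \<in> fam P Q"
    then show "primeset E \<and> \<Prod>E \<le> Q \<and> (\<forall>p\<in>E. \<not> p dvd W)"
      using fam_primeset[OF P(1)] P(2) by (auto simp: fam_def)
  qed (use assms in \<open>auto simp: residue_class_def intro!: finite_fam dest: primesetD(1)\<close>)
  also have "\<dots> = 8 * real (X div W + 1 + Q ^ 2) * (\<Sum>u<W. real (card (residue_class W u S)))"
    by (simp only: sum_distrib_left)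
  also have "(\<Sum>u<W. real (card (residue_class W u S))) = real (card S)"
    using assms finite_subset[OF assms(5)] by (intro sum_card_residue_class) auto
  finally show ?thesis .
qed

lemma sum_cenergy_prime_le:
  assumes P: "primeset P" "\<And>p. p \<in> P \<Longrightarrow> \<not> p dvd W" and "Q > 0" "R > 0" "W > 0" "A \<subseteq> {..X}"
    and A: "\<And>b p. b \<in> A \<Longrightarrow> p \<in> P \<Longrightarrow> \<not> p dvd b"
  shows "(\<Sum>E\<in>fam P Q. cenergy W E A) * dens {p\<in>P. p > Q} R \<le> 8 * real (X div W + 1 + (Q * R) ^ 2) * real (card A)"
proof -
  have "(\<Sum>E\<in>fam P Q. cenergy W E A) = (\<Sum>u<W. \<Sum>E\<in>fam P Q. energy E (residue_class W u A))"
    unfolding cenergy_def by (rule sum.swap)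
  then have "(\<Sum>E\<in>fam P Q. cenergy W E A) * dens {p\<in>P. p > Q} R = (\<Sum>u<W. (\<Sum>E\<in>fam P Q. energy E (residue_class W u A)) * dens {p\<in>P. p > Q} R)"
    by (simp add: sum_distrib_right)
  also have "\<dots> \<le> (\<Sum>u<W. 8 * real (X div W + 1 + (Q * R) ^ 2) * real (card (residue_class W u A)))"
  proof (intro sum_mono prime_large_sieve P assms(3-5))
    show "b \<le> X \<and> b mod W = u" if "b \<in> residue_class W u A" for b u using that assms(6) by (auto simp: residue_class_def)
    show "\<not> p dvd b" if "b \<in> residue_class W u A" "p \<in> P" for b u p using that A by (auto simp: residue_class_def)
  qed
  also have "\<dots> = 8 * real (X div W + 1 + (Q * R) ^ 2) * (\<Sum>u<W. real (card (residue_class W u A)))"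
    by (simp only: sum_distrib_left)
  also have "(\<Sum>u<W. real (card (residue_class W u A))) = real (card A)"
    using assms finite_subset[OF assms(6)] by (intro sum_card_residue_class) auto
  finally show ?thesis .
qed

section \<open>Combining the exact sieve with the Selberg weights\<close>

definition primorial :: "nat \<Rightarrow> nat" where "primorial z = (\<Prod>p | prime p \<and> p \<le> z. p)"

lemma primorial_pos: "primorial z > 0"
  unfolding primorial_def by (intro prod_pos) (auto simp: prime_gt_0_nat)

lemma primeset_le: "primeset {p. prime p \<and> p \<le> z}"
  by (auto simp: primeset_def)

lemma prime_dvd_primorial_iff: "prime p \<Longrightarrow> p dvd primorial z \<longleftrightarrow> p \<le> z"
proof
  assume p: "prime p" "p dvd primorial z"
  then obtain q where "prime q" "q \<le> z" "p dvd q"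
    using prime_dvd_prod_iff[of "{p. prime p \<and> p \<le> z}" p "\<lambda>p. p"] by (auto simp: primorial_def)
  then show "p \<le> z" using p primes_dvd_imp_eq by blast
next
  assume "prime p" "p \<le> z"
  then show "p dvd primorial z" unfolding primorial_def
    using dvd_prodI[of "{p. prime p \<and> p \<le> z}" p "\<lambda>p. p"] by auto
qed

lemma ln_le_powr_eighth: "(t::real) > 0 \<Longrightarrow> ln t \<le> 8 * t powr (1/8)"
  using ln_le_minus_one[of "t powr (1/8)"] by (simp add: ln_powr)

definition rough_primes :: "nat \<Rightarrow> nat \<Rightarrow> nat set" where "rough_primes z R = {p. prime p \<and> z < p \<and> p \<le> R}"

lemma primeset_rough: "primeset (rough_primes z R)"
  unfolding rough_primes_def primeset_def by (auto intro: finite_subset[of _ "{..R}"])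

lemma ln_le_mertens_dens:
  assumes "R > 0" "z \<le> Q"
  shows "ln R \<le> mertens_prod Q * dens {p\<in>rough_primes z R. p > Q} R"
  unfolding mertens_prod_def
proof (rule ln_le_dens)
  show "primeset {p \<in> rough_primes z R. Q < p}" by (rule primeset_subset[OF primeset_rough]) auto
qed (use assms primeset_le in \<open>auto simp: rough_primes_def\<close>)

text \<open>The empty support yields the number of coprime pairs; every other support has product
  above z. Cauchy-Schwarz over the supports separates the sets: for \<open>S\<close> the plain large
  sieve gives z^(-7/8), for \<open>A\<close> the prime large sieve gains log R and dyadic summation
  gives z^(-3/4). The geometric mean is z^(-13/16). The exponent 6 accommodates (R^2 * R)^2.\<close>

lemma sum_selberg_sq_pairs_le:
  "\<exists>K>0. \<forall>z R X A S. 390625 \<le> z \<longrightarrow> z \<le> R \<longrightarrow> A \<subseteq> {..X} \<longrightarrow> S \<subseteq> {..X} \<longrightarrow>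
     (\<forall>a\<in>A. \<forall>p. prime p \<longrightarrow> p \<le> R \<longrightarrow> \<not> p dvd a) \<longrightarrow> R ^ 6 * primorial z \<le> X \<longrightarrow>
     (\<Sum>(a, s)\<in>coprime_pairs (primorial z) A S. selberg (rough_primes z R) R (int s - int a) ^ 2) \<le>
       mertens_prod z / ln R * (card (coprime_pairs (primorial z) A S) +
         K * X * sqrt (real (card A) * real (card S) / ln R) * real z powr (-13/16))"
proof -
  obtain C where C: "C > 0" "\<And>N. N \<ge> 2 \<Longrightarrow> mertens_prod N \<le> C * ln (real N)"
    using mertens_prod_le by blast
  \<comment> \<open>23040 = 24 * 5 * 192, from the bounds for the sums over \<open>S\<close> and
    \<open>A\<close> under the square root.\<close>
  define K where "K = sqrt (23040 * C)"
  have K: "K > 0" using C by (simp add: K_def)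
  have main: "(\<Sum>(a, s)\<in>coprime_pairs (primorial z) A S. selberg (rough_primes z R) R (int s - int a) ^ 2) \<le>
       mertens_prod z / ln R * (card (coprime_pairs (primorial z) A S) +
         K * X * sqrt (real (card A) * real (card S) / ln R) * real z powr (-13/16))"
    if z: "390625 \<le> z" and zR: "z \<le> R" and A: "A \<subseteq> {..X}" and S: "S \<subseteq> {..X}"
    and Ap: "\<forall>a\<in>A. \<forall>p. prime p \<longrightarrow> p \<le> R \<longrightarrow> \<not> p dvd a" and X: "R ^ 6 * primorial z \<le> X"
    for z R X :: nat and A S :: "nat set"
  proof -
    define P W J where "P = rough_primes z R" and "W = primorial z" and "J = coprime_pairs W A S"
    have P: "primeset P" unfolding P_def by (rule primeset_rough)
    have W: "W > 0" unfolding W_def by (rule primorial_pos)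
    have PW: "\<not> p dvd W" if "p \<in> P" for p
      using that prime_dvd_primorial_iff[of p z] by (auto simp: P_def W_def rough_primes_def)
    have AP: "\<not> p dvd a" if "a \<in> A" "p \<in> P" for a p using Ap that by (auto simp: P_def rough_primes_def)
    have R: "R > 0" "ln (real R) > 0" using z zR by auto
    have fin: "finite A" "finite S" using A S finite_subset by blast+
    have R6: "real R ^ 6 \<le> X / W"
    proof -
      have "real (R ^ 6 * W) \<le> real X" using X by (simp only: of_nat_le_iff W_def)
      then show ?thesis using W by (simp add: pos_le_divide_eq)
    qed
    have XW1: "1 \<le> X / W" using R6 R one_le_power[of "real R" 6] by linarith
    have XW: "real (X div W + 1 + Y) \<le> 3 * (X / W)" if "real Y \<le> real R ^ 6" for Y
    proof -
      have "real (X div W) \<le> X / W" using floor_divide_of_nat_eq[of X W, where ?'a=real] by linarith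
      then show ?thesis using that R6 XW1 unfolding of_nat_add of_nat_1 by linarith
    qed
    define G where "G = dens P R"
    have G1: "G \<ge> 1" using dens_ge_1[OF P] R by (simp add: G_def)
    have "ln R \<le> mertens_prod z * dens {p\<in>rough_primes z R. p > z} R"
      by (rule ln_le_mertens_dens) (use R in auto)
    also have "{p\<in>rough_primes z R. p > z} = P" by (auto simp: P_def rough_primes_def)
    finally have Ginv: "1 / G \<le> mertens_prod z / ln R"
      using G1 R by (simp add: G_def field_simps)
    define F where "F = fam P (R ^ 2) - {{}}"
    have finfam: "finite (fam P Q)" for Q using P by (intro finite_fam) (simp add: primesetD(1))
    have F: "primeset E" "E \<subseteq> P" "\<Prod>E \<le> R^2" "\<Prod>E > z" "\<And>p. p \<in> E \<Longrightarrow> p \<ge> 390625" if E: "E \<in> F" for E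
    proof -
      show 1: "primeset E" using that fam_primeset[OF P] by (auto simp: F_def)
      show "E \<subseteq> P" "\<Prod>E \<le> R^2" using that by (auto simp: F_def fam_def)
      then show "p \<ge> 390625" if "p \<in> E" for p using that z by (auto simp: P_def rough_primes_def)
      obtain p where p: "p \<in> E" using E by (auto simp: F_def)
      have "z < p" using p \<open>E \<subseteq> P\<close> by (auto simp: P_def rough_primes_def)
      also have "p \<le> \<Prod>E" using p 1 by (intro dvd_prod_le prod_primeset_pos) (auto simp: primesetD(1))
      finally show "\<Prod>E > z" .
    qed
    define X' Y' where "X' E = cenergy W E A" and "Y' E = cenergy W E S" for E
    have nn: "X' E \<ge> 0" "Y' E \<ge> 0" if "E \<in> F" for E using F(1)[OF that] by (simp_all add: X'_def Y'_def cenergy_nonneg)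
    have empty: "{} \<in> fam P (R^2)" using R by (simp add: fam_def)
    have "(\<Sum>(a, s)\<in>J. selberg P R (int s - int a) ^ 2) \<le>
       (\<Sum>E\<in>fam P (R ^ 2). 4 ^ card E / phi E * \<bar>\<Sum>(a, s)\<in>J. Chi E (int s - int a)\<bar>) / G"
      using sum_selberg_sq_le[OF P, of R J "\<lambda>(a, s). int s - int a"] R finite_coprime_pairs[OF fin]
      unfolding J_def G_def by (simp add: case_prod_unfold)
    also have "(\<Sum>E\<in>fam P (R ^ 2). 4 ^ card E / phi E * \<bar>\<Sum>(a, s)\<in>J. Chi E (int s - int a)\<bar>) =
       real (card J) + (\<Sum>E\<in>F. 4 ^ card E / phi E * \<bar>\<Sum>(a, s)\<in>J. Chi E (int s - int a)\<bar>)"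
      unfolding F_def by (subst sum.remove[OF finfam empty]) (simp add: Chi_def)
    also have "(\<Sum>E\<in>F. 4 ^ card E / phi E * \<bar>\<Sum>(a, s)\<in>J. Chi E (int s - int a)\<bar>) \<le>
      (\<Sum>E\<in>F. real (\<Prod>E) powr (-7/8) * (real W * (sqrt (Y' E) * sqrt (X' E))))"
    proof (intro sum_mono mult_mono)
      fix E assume E: "E \<in> F"
      show "4 ^ card E / phi E \<le> real (\<Prod>E) powr (-7/8)" using F[OF E] by (intro weight_le_powr)
      show "\<bar>\<Sum>(a, s)\<in>J. Chi E (int s - int a)\<bar> \<le> real W * (sqrt (Y' E) * sqrt (X' E))"
        unfolding J_def X'_def Y'_def by (intro sum_coprime_pairs_Chi_le F(1)[OF E] W fin)
    qed auto
    also have "\<dots> = real W * (\<Sum>E\<in>F. sqrt (real (\<Prod>E) powr (-7/8) * Y' E) * sqrt (real (\<Prod>E) powr (-7/8) * X' E))"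
      unfolding sum_distrib_left
      by (intro sum.cong refl) (simp add: real_sqrt_mult mult_ac)
    also have "(\<Sum>E\<in>F. sqrt (real (\<Prod>E) powr (-7/8) * Y' E) * sqrt (real (\<Prod>E) powr (-7/8) * X' E)) \<le>
       sqrt ((\<Sum>E\<in>F. real (\<Prod>E) powr (-7/8) * Y' E) * (\<Sum>E\<in>F. real (\<Prod>E) powr (-7/8) * X' E))"
    proof (rule real_le_rsqrt)
      have "(\<Sum>E\<in>F. sqrt (real (\<Prod>E) powr (-7/8) * Y' E) * sqrt (real (\<Prod>E) powr (-7/8) * X' E)) ^ 2
        \<le> (\<Sum>E\<in>F. sqrt (real (\<Prod>E) powr (-7/8) * Y' E) ^ 2) * (\<Sum>E\<in>F. sqrt (real (\<Prod>E) powr (-7/8) * X' E) ^ 2)"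
        by (rule Cauchy_Schwarz_ineq_sum)
      then show "(\<Sum>E\<in>F. sqrt (real (\<Prod>E) powr (-7/8) * Y' E) * sqrt (real (\<Prod>E) powr (-7/8) * X' E)) ^ 2
        \<le> (\<Sum>E\<in>F. real (\<Prod>E) powr (-7/8) * Y' E) * (\<Sum>E\<in>F. real (\<Prod>E) powr (-7/8) * X' E)"
        using nn by simp
    qed
    also have "\<dots> \<le> sqrt ((real z powr (-7/8) * (24 * (X / W) * card S)) * (5 * (192 * C * (X / W) * card A / ln R) * real z powr (-3/4)))"
    proof (intro real_sqrt_le_mono mult_mono)
      have "(\<Sum>E\<in>F. real (\<Prod>E) powr (-7/8) * Y' E) \<le> (\<Sum>E\<in>F. real z powr (-7/8) * Y' E)"
      proof (intro sum_mono mult_right_mono)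
        fix E assume E: "E \<in> F"
        have "real z \<le> real (\<Prod>E)" using F(4)[OF E] by (simp only: of_nat_le_iff less_imp_le)
        then show "real (\<Prod>E) powr (-7/8) \<le> real z powr (-7/8)" using z by (intro powr_mono2') auto
      qed (rule nn)
      also have "\<dots> = real z powr (-7/8) * (\<Sum>E\<in>F. Y' E)" by (simp add: sum_distrib_left)
      also have "(\<Sum>E\<in>F. Y' E) \<le> (\<Sum>E\<in>fam P (R^2). Y' E)"
        using finfam fam_primeset[OF P] by (intro sum_mono2) (auto simp: F_def Y'_def cenergy_nonneg)
      also have "\<dots> \<le> 8 * real (X div W + 1 + (R^2) ^ 2) * real (card S)"
        unfolding Y'_def by (intro sum_cenergy_le P PW W S) (use R in auto)
      also have "\<dots> \<le> 8 * (3 * (X / W)) * real (card S)"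
        using R by (intro mult_right_mono mult_left_mono XW) (auto simp: power_mult[symmetric] intro!: power_increasing)
      finally show "(\<Sum>E\<in>F. real (\<Prod>E) powr (-7/8) * Y' E) \<le> real z powr (-7/8) * (24 * (X / W) * card S)"
        by (simp add: mult_left_mono)
      show "(\<Sum>E\<in>F. real (\<Prod>E) powr (-7/8) * X' E) \<le> 5 * (192 * C * (X / W) * card A / ln R) * real z powr (-3/4)"
      proof (rule dyadic_weighted_sum_le)
        fix Q assume Q: "z \<le> Q"
        \<comment> \<open>Supports in \<open>F\<close> have product at most R^2; capping Q there
          keeps (Q' R)^2 within R^6.\<close>
        define Q' where "Q' = min Q (R^2)"
        have "R \<le> R ^ 2" using R by (simp add: power2_eq_square)
        then have Q': "z \<le> Q'" "Q' \<le> R^2" "Q' \<le> Q" using Q zR by (auto simp: Q'_def)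
        have "(\<Sum>E | E \<in> F \<and> \<Prod>E \<le> Q. X' E) \<le> (\<Sum>E\<in>fam P Q'. X' E)"
        proof (intro sum_mono2 finfam)
          show "{E \<in> F. \<Prod>E \<le> Q} \<subseteq> fam P Q'" using F(2,3) by (auto simp: fam_def Q'_def)
        qed (use fam_primeset[OF P] in \<open>auto simp: X'_def intro!: cenergy_nonneg\<close>)
        also have "\<dots> \<le> 24 * (X / W) * card A / ln R * mertens_prod Q'"
        proof -
          define D where "D = dens {p\<in>P. p > Q'} R"
          have "primeset {p\<in>P. p > Q'}" by (rule primeset_subset[OF P]) auto
          then have D1: "D \<ge> 1" using R unfolding D_def by (intro dens_ge_1) auto
          have lnD: "ln R \<le> mertens_prod Q' * D" unfolding D_def P_def by (intro ln_le_mertens_dens R Q')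
          have "(\<Sum>E\<in>fam P Q'. X' E) * D \<le> 8 * real (X div W + 1 + (Q' * R) ^ 2) * real (card A)"
            unfolding X'_def D_def using Q' z R by (intro sum_cenergy_prime_le P PW W A AP) auto
          also have "\<dots> \<le> 8 * (3 * (X / W)) * real (card A)"
          proof (intro mult_right_mono mult_left_mono XW)
            have "(Q' * R) ^ 2 \<le> (R^2 * R) ^ 2" using Q' by (intro power_mono mult_right_mono) auto
            also have "\<dots> = R ^ 6" by (simp add: power_mult_distrib power_mult[symmetric] power_add[symmetric])
            finally show "real ((Q' * R) ^ 2) \<le> real R ^ 6" by (simp only: of_nat_power[symmetric] of_nat_le_iff)
          qed auto
          finally have 1: "(\<Sum>E\<in>fam P Q'. X' E) * D \<le> 24 * (X / W) * card A" by simp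
          have "(\<Sum>E\<in>fam P Q'. X' E) \<le> 24 * (X / W) * card A / D" using 1 D1 by (subst pos_le_divide_eq) auto
          also have "\<dots> = 24 * (X / W) * card A * (1 / D)" by simp
          also have "\<dots> \<le> 24 * (X / W) * card A * (mertens_prod Q' / ln R)"
            using lnD D1 R by (intro mult_left_mono) (auto simp: field_simps)
          finally show ?thesis by simp
        qed
        also have "\<dots> \<le> 24 * (X / W) * card A / ln R * (8 * C * real Q powr (1/8))"
        proof (intro mult_left_mono)
          \<comment> \<open>The primes up to Q' are lost in sieving \<open>A\<close>; the resulting
            factor log Q' is absorbed into Q^(1/8).\<close>
          have "mertens_prod Q' \<le> C * ln Q'" using C(2)[of Q'] Q' z by simp
          also have "\<dots> \<le> C * (8 * real Q' powr (1/8))" using C Q' z by (intro mult_left_mono ln_le_powr_eighth) auto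
          also have "\<dots> \<le> C * (8 * real Q powr (1/8))" using C Q' by (intro mult_left_mono powr_mono2) auto
          finally show "mertens_prod Q' \<le> 8 * C * real Q powr (1/8)" by simp
        qed (use R in auto)
        finally show "(\<Sum>E | E \<in> F \<and> \<Prod>E \<le> Q. X' E) \<le> 192 * C * (X / W) * card A / ln R * real Q powr (1/8)"
          by (simp add: mult_ac)
      qed (use F nn z R C finfam in \<open>auto simp: F_def\<close>)
    qed (use nn in \<open>auto intro!: sum_nonneg\<close>)
    also have "\<dots> = K * (X / W) * sqrt (real (card A) * real (card S) / ln R) * real z powr (-13/16)"
    proof -
      have zz: "real z powr (-7/8) * real z powr (-3/4) = (real z powr (-13/16)) ^ 2"
        using z by (simp add: powr_add[symmetric] power2_eq_square)
      have eq: "(real z powr (-7/8) * (24 * (X / W) * card S)) * (5 * (192 * C * (X / W) * card A / ln R) * real z powr (-3/4))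
        = (23040 * C) * (X / W) ^ 2 * (real (card A) * real (card S) / ln R) * (real z powr (-13/16)) ^ 2"
        unfolding zz[symmetric] by (simp add: power2_eq_square mult_ac)
      show ?thesis unfolding eq K_def real_sqrt_mult real_sqrt_abs by simp
    qed
    finally have "(\<Sum>(a, s)\<in>J. selberg P R (int s - int a) ^ 2) \<le>
       (real (card J) + real W * (K * (X / W) * sqrt (real (card A) * real (card S) / ln R) * real z powr (-13/16))) / G"
      using G1 by (simp add: divide_right_mono mult_left_mono)
    also have "real W * (K * (X / W) * sqrt (real (card A) * real (card S) / ln R) * real z powr (-13/16)) =
        K * X * sqrt (real (card A) * real (card S) / ln R) * real z powr (-13/16)" using W by simp
    also have "(real (card J) + K * X * sqrt (real (card A) * real (card S) / ln R) * real z powr (-13/16)) / G =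
       (1 / G) * (real (card J) + K * X * sqrt (real (card A) * real (card S) / ln R) * real z powr (-13/16))" by simp
    also have "\<dots> \<le> mertens_prod z / ln R * (real (card J) + K * X * sqrt (real (card A) * real (card S) / ln R) * real z powr (-13/16))"
      using Ginv K R by (intro mult_right_mono) auto
    finally show ?thesis unfolding J_def P_def W_def .
  qed
  show ?thesis by (intro exI[of _ K] conjI K allI impI) (rule main)
qed

section \<open>Moments over residue classes\<close>

text \<open>Jensen's inequality for t^k, cleared of division. Bernoulli's inequality for t/m puts
  t^k above its tangent at the mean m.\<close>

lemma power_mean_sum:
  fixes x :: "'a \<Rightarrow> real"
  assumes "finite I" "\<And>i. i \<in> I \<Longrightarrow> 0 \<le> x i"
  shows "(\<Sum>i\<in>I. x i) ^ k * card I \<le> real (card I) ^ k * (\<Sum>i\<in>I. x i ^ k)"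
proof (cases "I = {}")
  case False
  define m where "m = (\<Sum>i\<in>I. x i) / card I"
  have c: "real (card I) > 0" using False assms(1) by (simp add: card_gt_0_iff)
  have m: "m \<ge> 0" unfolding m_def using assms(2) by (intro divide_nonneg_nonneg sum_nonneg) auto
  have tangent: "m ^ k + real k * m ^ (k - 1) * (t - m) \<le> t ^ k" if "t \<ge> 0" for t
  proof (cases "k = 0 \<or> m = 0")
    case True
    then show ?thesis using that by (cases k; cases "k - 1") (auto simp: power_0_left)
  next
    case False
    then have "m > 0" "k > 0" using m by auto
    have "1 + real k * (t / m - 1) \<le> (1 + (t / m - 1)) ^ k"
      using that \<open>m > 0\<close> by (intro Bernoulli_inequality) auto
    then have "m ^ k * (1 + real k * (t / m - 1)) \<le> m ^ k * (t / m) ^ k"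
      using \<open>m > 0\<close> by (intro mult_left_mono) auto
    also have "m ^ k * (t / m) ^ k = t ^ k" using \<open>m > 0\<close> by (simp add: power_divide)
    also have "m ^ k * (1 + real k * (t / m - 1)) = m ^ k + real k * m ^ (k - 1) * (t - m)"
      using \<open>m > 0\<close> \<open>k > 0\<close> by (cases k) (simp_all add: field_simps)
    finally show ?thesis .
  qed
  have "card I * m ^ k = (\<Sum>i\<in>I. m ^ k + real k * m ^ (k - 1) * (x i - m))"
    using c by (simp add: sum.distrib sum_distrib_left[symmetric] sum_subtractf m_def)
  also have "\<dots> \<le> (\<Sum>i\<in>I. x i ^ k)" using assms(2) by (intro sum_mono tangent) auto
  finally have "real (card I) ^ k * (card I * m ^ k) \<le> real (card I) ^ k * (\<Sum>i\<in>I. x i ^ k)"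
    by (intro mult_left_mono) auto
  moreover have "real (card I) ^ k * (card I * m ^ k) = (\<Sum>i\<in>I. x i) ^ k * card I"
    using c by (simp add: m_def power_divide)
  ultimately show ?thesis by simp
qed simp

lemma crt_bij:
  assumes "coprime p (m::nat)" "p > 0" "m > 0"
  shows "bij_betw (\<lambda>c. (c mod p, c mod m)) {..<p * m} ({..<p} \<times> {..<m})"
proof -
  have inj: "inj_on (\<lambda>c. (c mod p, c mod m)) {..<p * m}"
  proof (rule inj_onI)
    fix c d assume a: "c \<in> {..<p * m}" "d \<in> {..<p * m}" "(c mod p, c mod m) = (d mod p, d mod m)"
    then have "[c = d] (mod p)" "[c = d] (mod m)" by (auto simp: cong_def)
    then have "[c = d] (mod p * m)" using assms(1) coprime_cong_mult_nat by blast
    then show "c = d" using a by (auto simp: cong_def)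
  qed
  have "(\<lambda>c. (c mod p, c mod m)) ` {..<p * m} = {..<p} \<times> {..<m}"
    by (rule card_subset_eq) (use assms inj in \<open>auto simp: card_image card_cartesian_product\<close>)
  then show ?thesis using inj by (simp add: bij_betw_def)
qed

text \<open>Residues modulo distinct primes are independent over a full period.\<close>

lemma sum_prod_residues:
  fixes f :: "nat \<Rightarrow> nat \<Rightarrow> real"
  assumes "finite U" "primeset U"
  shows "(\<Sum>c<\<Prod>U. \<Prod>p\<in>U. f p (c mod p)) = (\<Prod>p\<in>U. \<Sum>r<p. f p r)"
  using assms
proof (induction U rule: finite_induct)
  case (insert p U)
  have U: "primeset U" "prime p" using insert.prems by (auto simp: primeset_def)
  define m where "m = \<Prod>U"
  have m: "m > 0" unfolding m_def by (rule prod_primeset_pos[OF U(1)])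
  have cop: "coprime p m" unfolding m_def
    using U insert.hyps by (intro prod_coprime_right) (auto simp: primeset_def intro!: primes_coprime)
  have "(\<Sum>c<\<Prod>(insert p U). \<Prod>q\<in>insert p U. f q (c mod q)) = (\<Sum>c<p * m. f p (c mod p) * (\<Prod>q\<in>U. f q (c mod m mod q)))"
  proof -
    have "c mod m mod q = c mod q" if "q \<in> U" for c q
      using that insert.hyps dvd_prodI[of U q id] by (intro mod_mod_cancel) (simp add: m_def)
    then show ?thesis using insert.hyps by (simp add: m_def)
  qed
  also have "\<dots> = (\<Sum>(r, c)\<in>{..<p} \<times> {..<m}. f p r * (\<Prod>q\<in>U. f q (c mod q)))"
    using sum.reindex_bij_betw[OF crt_bij[OF cop prime_gt_0_nat[OF U(2)] m], of "\<lambda>(r, c). f p r * (\<Prod>q\<in>U. f q (c mod q))"]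
    by simp
  also have "\<dots> = (\<Sum>r<p. f p r) * (\<Sum>c<m. \<Prod>q\<in>U. f q (c mod q))"
    by (simp add: sum_product sum.cartesian_product)
  finally show ?case using insert U by (simp add: m_def)
qed simp

lemma sum_lessThan_periodic_le:
  fixes g :: "nat \<Rightarrow> real"
  assumes "M > 0" "M \<le> Y" "\<And>s. 0 \<le> g s" "\<And>s. g (s mod M) = g s"
  shows "(\<Sum>s<Y. g s) \<le> 2 * real Y / real M * (\<Sum>s<M. g s)"
proof -
  define t where "t = Y div M + 1"
  have blocks: "(\<Sum>s<n * M. g s) = real n * (\<Sum>s<M. g s)" for n
  proof -
    have "(\<Sum>s\<in>{m * M..<m * M + M}. g s) = (\<Sum>s<M. g s)" for m
    proof -
      have "(\<Sum>s\<in>{m * M..<m * M + M}. g s) = (\<Sum>s<M. g (m * M + s))"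
        by (rule sum.reindex_bij_witness[of _ "\<lambda>s. m * M + s" "\<lambda>s. s - m * M"]) auto
      also have "\<dots> = (\<Sum>s<M. g s)"
      proof (intro sum.cong refl)
        fix s assume "s \<in> {..<M}"
        then show "g (m * M + s) = g s" using assms(4)[of "m * M + s"] by simp
      qed
      finally show ?thesis .
    qed
    then show ?thesis using sum.nat_group[of g M n] by simp
  qed
  have "Y \<le> t * M" using assms(1) dividend_less_div_times[of M Y] by (simp add: t_def add.commute less_imp_le)
  then have "(\<Sum>s<Y. g s) \<le> (\<Sum>s<t * M. g s)" using assms(3) by (intro sum_mono2) auto
  also have "\<dots> = real t * (\<Sum>s<M. g s)" by (rule blocks)
  also have "\<dots> \<le> 2 * real Y / real M * (\<Sum>s<M. g s)"
  proof (intro mult_right_mono sum_nonneg assms(3))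
    have "real (Y div M) \<le> Y / M" using floor_divide_of_nat_eq[of Y M, where ?'a=real] by linarith
    moreover have "1 \<le> real Y / real M" using assms by simp
    ultimately show "real t \<le> 2 * real Y / real M" by (simp add: t_def)
  qed
  finally show ?thesis .
qed

lemma sum_inverse_squares_tail_le:
  assumes "finite U" "\<And>p. p \<in> U \<Longrightarrow> n < p" "n > 0"
  shows "(\<Sum>p\<in>U. 1 / real p ^ 2) \<le> 1 / real n"
proof -
  have tele: "(\<Sum>p\<in>{n<..m}. 1 / (real p * (real p - 1))) = 1 / n - 1 / m" if "m \<ge> n" for m
    using that
  proof (induction m rule: dec_induct)
    case (step m)
    have "{n<..Suc m} = insert (Suc m) {n<..m}" using step by auto
    moreover have "1 / (real (Suc m) * (real (Suc m) - 1)) = 1 / m - 1 / Suc m"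
      using step assms(3) by (simp add: field_simps)
    ultimately show ?case using step by simp
  qed simp
  define m where "m = Max (insert n U)"
  have "m \<ge> n" unfolding m_def using assms(1) by simp
  have "(\<Sum>p\<in>U. 1 / real p ^ 2) \<le> (\<Sum>p\<in>U. 1 / (real p * (real p - 1)))"
  proof (intro sum_mono)
    fix p assume "p \<in> U"
    then have "real p > 1" using assms(2)[of p] assms(3) by linarith
    then show "1 / real p ^ 2 \<le> 1 / (real p * (real p - 1))"
      by (intro frac_le) (auto simp: power2_eq_square)
  qed
  also have "\<dots> \<le> (\<Sum>p\<in>{n<..m}. 1 / (real p * (real p - 1)))"
    using assms by (intro sum_mono2) (auto simp: m_def)
  also have "\<dots> \<le> 1 / n" using tele[OF \<open>m \<ge> n\<close>] by simp
  finally show ?thesis .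
qed

text \<open>The factor by which adding the residue of \<open>s\<close> to forbidden classes \<open>T\<close> that may already contain it exceeds the generic \<open>\<Prod>(1 - 1/p)\<close>.\<close>

definition hits :: "nat set \<Rightarrow> (nat \<Rightarrow> nat set) \<Rightarrow> nat \<Rightarrow> real" where
  "hits U T s = (\<Prod>p\<in>U. if s mod p \<in> T p then real p / (real p - 1) else 1)"

text \<open>With u = k/p \<le> 1/2, Bernoulli gives (1 - 1/p)^k \<ge> 1 - u, and 1/(1-u) \<le> 1 +
  2u. Here the size of the primes relative to k enters.\<close>

lemma pow_ratio_le:
  assumes "k \<ge> 1" "2 * k \<le> p" "p \<ge> 2"
  shows "(real p / (real p - 1)) ^ k \<le> 1 + 2 * real k / real p"
proof -
  have p: "real p > 1" "2 * real k \<le> real p" using assms by auto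
  have "1 + real k * (- 1 / real p) \<le> (1 + (- 1 / real p)) ^ k"
    using p by (intro Bernoulli_inequality) auto
  then have 1: "1 - real k / p \<le> ((real p - 1) / p) ^ k" using p by (simp add: diff_divide_distrib)
  have "(real p / (real p - 1)) ^ k = 1 / ((real p - 1) / p) ^ k" by (simp add: power_divide)
  also have "\<dots> \<le> 1 / (1 - real k / p)" using 1 p by (intro divide_left_mono) (auto simp: field_simps)
  also have "\<dots> \<le> 1 + 2 * real k / real p"
  proof -
    have "1 \<le> (1 + 2 * (real k / p)) * (1 - real k / p)"
    proof -
      define t where "t = real k / p"
      have "0 \<le> t" "t \<le> 1/2" using p by (auto simp: t_def field_simps)
      then have "0 \<le> t * (1 - 2 * t)" by simp
      then show ?thesis unfolding t_def[symmetric] by (simp add: algebra_simps)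
    qed
    moreover have "1 - real k / p > 0" using p by (simp add: field_simps)
    ultimately show ?thesis by (simp add: pos_divide_le_eq)
  qed
  finally show ?thesis .
qed

text \<open>Over a full period the k-th moment is a product with factors p (1 + 2 k^2/p^2); the sum
  of 1/p^2 over p > 2k is at most 1/(2k), so the mean is at most e^k. Restriction to
  \<open>S\<close> costs its inverse density e^(bk), the 2 in the hypothesis paying for incomplete
  periods. The k-th root leaves e^(b+1).\<close>

lemma sum_hits_le:
  assumes U: "primeset U" "\<And>p. p \<in> U \<Longrightarrow> 2 * k < p" and k: "k \<ge> 1"
    and T: "\<And>p. p \<in> U \<Longrightarrow> T p \<subseteq> {..<p} \<and> card (T p) \<le> k"
    and S: "S \<subseteq> {..<Y}" "\<Prod>U \<le> Y" "2 * real Y \<le> real (card S) * exp (b * real k)"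
  shows "(\<Sum>s\<in>S. hits U T s) \<le> exp (b + 1) * real (card S)"
proof -
  define M where "M = \<Prod>U"
  have M: "M > 0" unfolding M_def by (rule prod_primeset_pos[OF U(1)])
  have finU: "finite U" using U(1) by (rule primesetD(1))
  have finS: "finite S" using S(1) finite_subset by blast
  have p2: "p \<ge> 2" if "p \<in> U" for p using primesetD(3)[OF U(1) that] .
  have hits0: "0 \<le> hits U T s" for s unfolding hits_def using p2 by (intro prod_nonneg) force
  have pw: "hits U T s ^ k = (\<Prod>p\<in>U. if s mod p \<in> T p then (real p / (real p - 1)) ^ k else 1)" for s
    unfolding hits_def prod_power_distrib by (intro prod.cong) auto
  let ?k = "\<lambda>p. 2 * real k ^ 2 * (1 / real p ^ 2)"
  have "(\<Sum>s<M. hits U T s ^ k) = (\<Prod>p\<in>U. \<Sum>r<p. if r \<in> T p then (real p / (real p - 1)) ^ k else 1)"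
    unfolding pw M_def by (rule sum_prod_residues[OF finU U(1)])
  also have "\<dots> \<le> (\<Prod>p\<in>U. real p * exp ((?k p)))"
  proof (intro prod_mono conjI sum_nonneg)
    fix p assume p: "p \<in> U"
    have pp: "real p > 1" using p2[OF p] by simp
    have "(\<Sum>r<p. if r \<in> T p then (real p / (real p - 1)) ^ k else 1) =
        (\<Sum>r<p. 1) + (\<Sum>r<p. if r \<in> T p then (real p / (real p - 1)) ^ k - 1 else 0)"
      unfolding sum.distrib[symmetric] by (intro sum.cong) auto
    also have "(\<Sum>r<p. if r \<in> T p then (real p / (real p - 1)) ^ k - 1 else 0) = (\<Sum>r\<in>T p. (real p / (real p - 1)) ^ k - 1)"
      using T[OF p] by (intro sum.mono_neutral_cong_right) auto
    also have "\<dots> = card (T p) * ((real p / (real p - 1)) ^ k - 1)" by simp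
    also have "\<dots> \<le> real k * (2 * real k / real p)"
      using T[OF p] pow_ratio_le[OF k, of p] U(2)[OF p] p2[OF p] pp
      by (intro mult_mono) (auto intro!: one_le_power)
    also have "(\<Sum>r<p. 1) + real k * (2 * real k / real p) = real p * (1 + (?k p))"
      using pp by (simp add: field_simps power2_eq_square)
    also have "\<dots> \<le> real p * exp ((?k p))"
      by (intro mult_left_mono exp_ge_add_one_self) auto
    finally show "(\<Sum>r<p. if r \<in> T p then (real p / (real p - 1)) ^ k else 1) \<le> real p * exp ((?k p))"
      by simp
  next
    fix p r assume "p \<in> U"
    then show "0 \<le> (if r \<in> T p then (real p / (real p - 1)) ^ k else 1)" using p2[of p] by auto
  qed
  also have "\<dots> = real M * exp (2 * real k ^ 2 * (\<Sum>p\<in>U. 1 / real p ^ 2))"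
    using finU by (simp add: prod.distrib exp_sum sum_distrib_left M_def)
  also have "\<dots> \<le> real M * exp (2 * real k ^ 2 * (1 / real (2 * k)))"
    using finU U(2) k by (intro mult_left_mono iffD2[OF exp_le_cancel_iff] sum_inverse_squares_tail_le) auto
  also have "2 * real k ^ 2 * (1 / real (2 * k)) = real k" using k by (simp add: power2_eq_square)
  finally have mom: "(\<Sum>s<M. hits U T s ^ k) \<le> real M * exp k" .
  let ?H = "(\<Sum>s\<in>S. hits U T s)"
  have "(\<Sum>s\<in>S. hits U T s ^ k) \<le> (\<Sum>s<Y. hits U T s ^ k)"
    using S(1) hits0 by (intro sum_mono2) auto
  also have "\<dots> \<le> 2 * real Y / real M * (\<Sum>s<M. hits U T s ^ k)"
  proof (rule sum_lessThan_periodic_le[OF M])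
    show "hits U T (s mod M) ^ k = hits U T s ^ k" for s
    proof -
      have "s mod M mod p = s mod p" if "p \<in> U" for p
        using that finU dvd_prodI[of U p id] by (intro mod_mod_cancel) (simp add: M_def)
      then show ?thesis unfolding hits_def by simp
    qed
  qed (use S hits0 in \<open>auto simp: M_def\<close>)
  also have "\<dots> \<le> 2 * real Y / real M * (real M * exp k)" using mom by (intro mult_left_mono) auto
  also have "\<dots> = 2 * real Y * exp k" using M by simp
  also have "\<dots> \<le> real (card S) * exp (b * k) * exp k" using S(3) by (intro mult_right_mono) auto
  also have "\<dots> = real (card S) * exp (b + 1) ^ k"
    by (simp add: exp_of_nat_mult[symmetric] exp_add[symmetric] algebra_simps)
  finally have 1: "(\<Sum>s\<in>S. hits U T s ^ k) \<le> real (card S) * exp (b + 1) ^ k" .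
  show ?thesis
  proof (cases "S = {}")
    case False
    then have c: "real (card S) > 0" using finS by (simp add: card_gt_0_iff)
    have "?H ^ k * card S \<le> real (card S) ^ k * (\<Sum>s\<in>S. hits U T s ^ k)"
      by (rule power_mean_sum[OF finS hits0])
    also have "\<dots> \<le> real (card S) ^ k * (real (card S) * exp (b + 1) ^ k)" using 1 by (intro mult_left_mono) auto
    finally have "?H ^ k * card S \<le> (exp (b + 1) * real (card S)) ^ k * card S"
      by (simp add: power_mult_distrib mult_ac)
    then have "?H ^ k \<le> (exp (b + 1) * real (card S)) ^ k" using c by simp
    then show ?thesis using k by (subst (asm) power_mono_iff) (auto intro!: sum_nonneg hits0)
  qed simp
qed

definition avoid :: "nat set \<Rightarrow> (nat \<Rightarrow> nat set) \<Rightarrow> nat set" where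
  "avoid U T = {c. c < \<Prod>U \<and> (\<forall>p\<in>U. c mod p \<notin> T p)}"
text \<open>By \<open>coprime_pairs_prod_iff\<close> these are the s with s - c prime to
  \<open>\<Prod>U\<close>; the set depends only on c modulo \<open>\<Prod>U\<close>.\<close>

definition free :: "nat set \<Rightarrow> nat set \<Rightarrow> nat \<Rightarrow> nat set" where
  "free U S c = {s\<in>S. \<forall>p\<in>U. s mod p \<noteq> c mod p}"

lemma finite_avoid [simp]: "finite (avoid U T)"
  unfolding avoid_def by (rule finite_subset[of _ "{..<\<Prod>U}"]) auto

text \<open>The exact count is the product of p - card (T p). Bernoulli's inequality turns it into
  powers of 1 - 1/p, so that each new forbidden class modulo p costs the same factor.\<close>

lemma card_avoid_le:
  assumes U: "primeset U" and T: "\<And>p. p \<in> U \<Longrightarrow> T p \<subseteq> {..<p}"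
  shows "real (card (avoid U T)) \<le> real (\<Prod>U) * (\<Prod>p\<in>U. (1 - 1 / real p) ^ card (T p))"
proof -
  have finU: "finite U" using U by (rule primesetD(1))
  have "real (card (avoid U T)) = (\<Sum>c<\<Prod>U. if \<forall>p\<in>U. c mod p \<notin> T p then 1 else 0)"
  proof -
    have "(\<Sum>c<\<Prod>U. if \<forall>p\<in>U. c mod p \<notin> T p then 1 else 0) = (\<Sum>c\<in>avoid U T. 1::real)"
      by (intro sum.mono_neutral_cong_right) (auto simp: avoid_def)
    then show ?thesis by simp
  qed
  also have "\<dots> = (\<Sum>c<\<Prod>U. \<Prod>p\<in>U. if c mod p \<in> T p then 0 else 1)"
  proof (intro sum.cong refl)
    fix c
    show "(if \<forall>p\<in>U. c mod p \<notin> T p then 1 else 0) = (\<Prod>p\<in>U. if c mod p \<in> T p then 0 else 1 :: real)"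
      using finU by (auto intro!: prod.neutral[symmetric] prod_zero[symmetric])
  qed
  also have "\<dots> = (\<Prod>p\<in>U. \<Sum>r<p. if r \<in> T p then 0 else 1)" by (rule sum_prod_residues[OF finU U])
  also have "\<dots> \<le> (\<Prod>p\<in>U. real p * (1 - 1 / real p) ^ card (T p))"
  proof (intro prod_mono conjI sum_nonneg)
    fix p assume p: "p \<in> U"
    have p2: "p \<ge> 2" using primesetD(3)[OF U p] .
    have fT: "finite (T p)" using T[OF p] finite_subset by blast
    have "(\<Sum>r<p. if r \<in> T p then 0 else 1::real) = (\<Sum>r\<in>{..<p} - T p. 1)"
      by (intro sum.mono_neutral_cong_right) auto
    also have "\<dots> = real p - card (T p)" using T[OF p] fT card_mono[OF _ T[OF p]] by (simp add: card_Diff_subset of_nat_diff)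
    also have "\<dots> = real p * (1 + real (card (T p)) * (- 1 / real p))" using p2 by (simp add: field_simps)
    also have "\<dots> \<le> real p * (1 + (- 1 / real p)) ^ card (T p)"
      using p2 by (intro mult_left_mono Bernoulli_inequality) auto
    finally show "(\<Sum>r<p. if r \<in> T p then 0 else 1) \<le> real p * (1 - 1 / real p) ^ card (T p)" by simp
  qed auto
  also have "\<dots> = real (\<Prod>U) * (\<Prod>p\<in>U. (1 - 1 / real p) ^ card (T p))" by (simp add: prod.distrib)
  finally show ?thesis .
qed

text \<open>Splitting off one element \<open>s\<close> of \<open>S\<close> adds its residues to the forbidden classes, which drives the induction on \<open>r\<close>.\<close>

lemma moment_le:
  assumes U: "primeset U" "\<And>p. p \<in> U \<Longrightarrow> 2 * k < p" and k: "k \<ge> 1"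
    and S: "S \<subseteq> {..<Y}" "\<Prod>U \<le> Y" "2 * real Y \<le> real (card S) * exp (b * real k)"
    and T: "\<And>p. p \<in> U \<Longrightarrow> T p \<subseteq> {..<p} \<and> card (T p) + r \<le> k + 1"
  defines "\<delta> \<equiv> (\<Prod>p\<in>U. 1 - 1 / real p)"
  shows "(\<Sum>c\<in>avoid U T. real (card (free U S c)) ^ r) \<le>
     real (\<Prod>U) * (\<Prod>p\<in>U. (1 - 1 / real p) ^ card (T p)) * (exp (b + 1) * \<delta> * real (card S)) ^ r"
  using T
proof (induction r arbitrary: T)
  case 0
  then show ?case using card_avoid_le[OF U(1), of T] by simp
next
  case (Suc r)
  have finU: "finite U" using U(1) by (rule primesetD(1))
  have finS: "finite S" using S(1) finite_subset by blast
  have p2: "p \<ge> 2" if "p \<in> U" for p using primesetD(3)[OF U(1) that] .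
  define T' where "T' s p = insert (s mod p) (T p)" for s p
  define B where "B = (exp (b + 1) * \<delta> * real (card S)) ^ r"
  have \<delta>: "\<delta> \<ge> 0" unfolding \<delta>_def using p2 by (intro prod_nonneg) (force simp: field_simps)
  have B: "B \<ge> 0" unfolding B_def using \<delta> by simp
  have "(\<Sum>c\<in>avoid U T. real (card (free U S c)) ^ Suc r) =
      (\<Sum>c\<in>avoid U T. \<Sum>s\<in>S. if \<forall>p\<in>U. s mod p \<noteq> c mod p then real (card (free U S c)) ^ r else 0)"
  proof (intro sum.cong refl)
    fix c
    have "(\<Sum>s\<in>S. if \<forall>p\<in>U. s mod p \<noteq> c mod p then real (card (free U S c)) ^ r else 0) =
       (\<Sum>s\<in>free U S c. real (card (free U S c)) ^ r)"
      unfolding free_def using finS by (intro sum.mono_neutral_cong_right) auto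
    then show "real (card (free U S c)) ^ Suc r = (\<Sum>s\<in>S. if \<forall>p\<in>U. s mod p \<noteq> c mod p then real (card (free U S c)) ^ r else 0)"
      by simp
  qed
  also have "\<dots> = (\<Sum>s\<in>S. \<Sum>c\<in>avoid U T. if \<forall>p\<in>U. s mod p \<noteq> c mod p then real (card (free U S c)) ^ r else 0)"
    by (rule sum.swap)
  also have "\<dots> = (\<Sum>s\<in>S. \<Sum>c\<in>avoid U (T' s). real (card (free U S c)) ^ r)"
    by (intro sum.cong refl sum.mono_neutral_cong_right) (auto simp: avoid_def T'_def)
  also have "\<dots> \<le> (\<Sum>s\<in>S. real (\<Prod>U) * (\<Prod>p\<in>U. (1 - 1 / real p) ^ card (T' s p)) * B)"
  proof (intro sum_mono)
    fix s
    have "T' s p \<subseteq> {..<p} \<and> card (T' s p) + r \<le> k + 1" if "p \<in> U" for p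
    proof -
      have "finite (T p)" using Suc.prems[OF that] finite_subset by blast
      then have "card (T' s p) \<le> Suc (card (T p))" unfolding T'_def by (simp add: card_insert_if)
      then show ?thesis using Suc.prems[OF that] p2[OF that] by (auto simp: T'_def)
    qed
    then show "(\<Sum>c\<in>avoid U (T' s). real (card (free U S c)) ^ r) \<le> real (\<Prod>U) * (\<Prod>p\<in>U. (1 - 1 / real p) ^ card (T' s p)) * B"
      unfolding B_def by (rule Suc.IH)
  qed
  also have "\<dots> = (\<Sum>s\<in>S. real (\<Prod>U) * (\<Prod>p\<in>U. (1 - 1 / real p) ^ card (T p)) * \<delta> * B * hits U T s)"
  proof (intro sum.cong refl)
    fix s
    \<comment> \<open>A residue of s already in \<open>T p\<close> brings no new factor 1 - 1/p; the
      p/(p-1) in \<open>hits\<close> makes up for it.\<close>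
    have "(\<Prod>p\<in>U. (1 - 1 / real p) ^ card (T' s p)) = (\<Prod>p\<in>U. (1 - 1 / real p) ^ card (T p) * (1 - 1 / real p) * (if s mod p \<in> T p then real p / (real p - 1) else 1))"
    proof (intro prod.cong refl)
      fix p assume p: "p \<in> U"
      have "finite (T p)" using Suc.prems[OF p] finite_subset by blast
      have eq: "(1 - 1 / real p) * (real p / (real p - 1)) = 1" using p2[OF p] by (simp add: field_simps)
      show "(1 - 1 / real p) ^ card (T' s p) = (1 - 1 / real p) ^ card (T p) * (1 - 1 / real p) * (if s mod p \<in> T p then real p / (real p - 1) else 1)"
      proof (cases "s mod p \<in> T p")
        case True
        then have "T' s p = T p" by (simp add: T'_def insert_absorb)
        then show ?thesis by (simp only: True if_True mult.assoc eq mult_1_right)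
      qed (simp add: T'_def \<open>finite (T p)\<close>)
    qed
    then show "real (\<Prod>U) * (\<Prod>p\<in>U. (1 - 1 / real p) ^ card (T' s p)) * B = real (\<Prod>U) * (\<Prod>p\<in>U. (1 - 1 / real p) ^ card (T p)) * \<delta> * B * hits U T s"
      by (simp add: prod.distrib \<delta>_def hits_def mult_ac)
  qed
  also have "\<dots> = real (\<Prod>U) * (\<Prod>p\<in>U. (1 - 1 / real p) ^ card (T p)) * \<delta> * B * (\<Sum>s\<in>S. hits U T s)"
    by (simp only: sum_distrib_left)
  also have "\<dots> \<le> real (\<Prod>U) * (\<Prod>p\<in>U. (1 - 1 / real p) ^ card (T p)) * \<delta> * B * (exp (b + 1) * real (card S))"
  proof (intro mult_left_mono)
    \<comment> \<open>With exponent r + 1 the budget k + 1 leaves at most k forbidden classes, as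
      \<open>sum_hits_le\<close> demands.\<close>
    have "T p \<subseteq> {..<p} \<and> card (T p) \<le> k" if "p \<in> U" for p using Suc.prems[OF that] by auto
    from sum_hits_le[OF U k this S] show "(\<Sum>s\<in>S. hits U T s) \<le> exp (b + 1) * real (card S)" by blast
    show "0 \<le> real (\<Prod>U) * (\<Prod>p\<in>U. (1 - 1 / real p) ^ card (T p)) * \<delta> * B"
    proof (intro mult_nonneg_nonneg prod_nonneg zero_le_power \<delta> B)
      show "0 \<le> 1 - 1 / real p" if "p \<in> U" for p using p2[OF that] by simp
    qed (rule of_nat_0_le_iff)
  qed
  finally show ?case by (simp add: B_def mult_ac)
qed

lemma coprime_pairs_prod_iff:
  assumes "primeset U"
  shows "coprime (int s - int a) (int (\<Prod>U)) \<longleftrightarrow> (\<forall>p\<in>U. s mod p \<noteq> a mod p)"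
proof -
  have finU: "finite U" using assms by (rule primesetD(1))
  have "coprime (int s - int a) (int (\<Prod>U)) \<longleftrightarrow> (\<forall>p\<in>U. coprime (int s - int a) (int p))"
  proof (intro iffI ballI)
    fix p assume a: "coprime (int s - int a) (int (\<Prod>U))" and p: "p \<in> U"
    have "int p dvd int (\<Prod>U)" using finU p dvd_prodI[of U p id] by (simp only: int_dvd_int_iff) simp
    then show "coprime (int s - int a) (int p)" using a coprime_divisors[OF dvd_refl] by blast
  qed (auto intro: prod_coprime_right)
  also have "\<dots> \<longleftrightarrow> (\<forall>p\<in>U. \<not> int p dvd int s - int a)"
  proof (intro ball_cong refl)
    fix p assume "p \<in> U"
    then have "prime (int p)" using primesetD(2)[OF assms] by simp
    then show "coprime (int s - int a) (int p) \<longleftrightarrow> \<not> int p dvd int s - int a"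
      by (metis coprime_commute prime_imp_coprime coprime_absorb_left not_prime_unit)
  qed
  also have "\<dots> \<longleftrightarrow> (\<forall>p\<in>U. s mod p \<noteq> a mod p)"
    by (metis mod_eq_dvd_iff of_nat_eq_iff zmod_int)
  finally show ?thesis .
qed

text \<open>By the last hypothesis no class holds more than e^(bk) times the average of A over the
  reduced classes. So the k-th moment of \<open>card (free U S a)\<close> over A is at most e^(bk)
  times the bound (e^(b+1) \<delta> card S)^k that \<open>moment_le\<close> gives for its mean over
  reduced residues. The k-th root yields e^(2b+1).\<close>

lemma card_coprime_pairs_le:
  assumes U: "primeset U" "\<And>p. p \<in> U \<Longrightarrow> 2 * k < p" and k: "k \<ge> 1"
    and S: "S \<subseteq> {..<Y}" "\<Prod>U \<le> Y" "2 * real Y \<le> real (card S) * exp (b * real k)"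
    and A: "finite A" "\<And>a p. a \<in> A \<Longrightarrow> p \<in> U \<Longrightarrow> \<not> p dvd a"
  defines "\<delta> \<equiv> (\<Prod>p\<in>U. 1 - 1 / real p)"
  assumes d: "\<And>c. real (card (residue_class (\<Prod>U) c A)) * (real (\<Prod>U) * \<delta>) \<le> real (card A) * exp (b * real k)"
  shows "real (card (coprime_pairs (\<Prod>U) A S)) \<le> exp (2 * b + 1) * \<delta> * real (card A) * real (card S)"
proof (cases "A = {}")
  case False
  define M where "M = \<Prod>U"
  have M: "M > 0" unfolding M_def by (rule prod_primeset_pos[OF U(1)])
  have finU: "finite U" using U(1) by (rule primesetD(1))
  have finS: "finite S" using S(1) finite_subset by blast
  have p2: "p \<ge> 2" if "p \<in> U" for p using primesetD(3)[OF U(1) that] .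
  have \<delta>: "\<delta> > 0" unfolding \<delta>_def using p2 by (intro prod_pos) (force simp: field_simps)
  have cA: "real (card A) > 0" using False A(1) by (simp add: card_gt_0_iff)
  \<comment> \<open>No element of A is 0 modulo a prime of U, so each prime starts with one
    forbidden class; hence the budget k + 1 in \<open>moment_le\<close>. The resulting factor
    \<delta> cancels the one in the average over reduced classes.\<close>
  define T where "T p = {0::nat}" for p :: nat
  have free_mod: "free U S (a mod M) = free U S a" for a
  proof -
    have "a mod M mod p = a mod p" if "p \<in> U" for p
      using that finU dvd_prodI[of U p id] by (intro mod_mod_cancel) (simp add: M_def)
    then show ?thesis unfolding free_def by auto
  qed
  have "coprime_pairs M A S = Sigma A (free U S)"
    unfolding coprime_pairs_def free_def M_def using coprime_pairs_prod_iff[OF U(1)] by auto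
  then have pairs: "real (card (coprime_pairs M A S)) = (\<Sum>a\<in>A. real (card (free U S a)))"
    using A(1) finS by (simp add: free_def)
  have "(\<Sum>a\<in>A. real (card (free U S a)) ^ k) = (\<Sum>c<M. \<Sum>a\<in>residue_class M c A. real (card (free U S a)) ^ k)"
    by (rule sum_residue_class[OF A(1) M, symmetric])
  also have "\<dots> = (\<Sum>c<M. real (card (residue_class M c A)) * real (card (free U S c)) ^ k)"
  proof (intro sum.cong refl)
    fix c
    have "card (free U S a) = card (free U S c)" if "a \<in> residue_class M c A" for a
      using that free_mod[of a] by (simp add: residue_class_def)
    then show "(\<Sum>a\<in>residue_class M c A. real (card (free U S a)) ^ k) = real (card (residue_class M c A)) * real (card (free U S c)) ^ k"
      by simp
  qed
  also have "\<dots> = (\<Sum>c\<in>avoid U T. real (card (residue_class M c A)) * real (card (free U S c)) ^ k)"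
  proof (intro sum.mono_neutral_right ballI)
    fix c assume c: "c \<in> {..<M} - avoid U T"
    then obtain p where p: "p \<in> U" "c mod p = 0" by (auto simp: avoid_def T_def M_def)
    have "residue_class M c A = {}"
    proof (rule ccontr)
      assume "residue_class M c A \<noteq> {}"
      then obtain a where a: "a \<in> A" "a mod M = c" by (auto simp: residue_class_def)
      have "c mod p = a mod p" unfolding a(2)[symmetric]
        using p finU dvd_prodI[of U p id] by (intro mod_mod_cancel) (simp add: M_def)
      then show False using A(2)[OF a(1) p(1)] p(2) by auto
    qed
    then show "real (card (residue_class M c A)) * real (card (free U S c)) ^ k = 0" by simp
  qed (auto simp: avoid_def M_def)
  also have "\<dots> \<le> (\<Sum>c\<in>avoid U T. real (card A) * exp (b * k) / (real M * \<delta>) * real (card (free U S c)) ^ k)"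
    using d M \<delta> by (intro sum_mono mult_right_mono) (auto simp: M_def[symmetric] pos_le_divide_eq)
  also have "\<dots> = real (card A) * exp (b * k) / (real M * \<delta>) * (\<Sum>c\<in>avoid U T. real (card (free U S c)) ^ k)"
    by (simp only: sum_distrib_left)
  also have "\<dots> \<le> real (card A) * exp (b * k) / (real M * \<delta>) * (real M * (\<Prod>p\<in>U. (1 - 1 / real p) ^ card (T p)) * (exp (b + 1) * \<delta> * real (card S)) ^ k)"
  proof (intro mult_left_mono)
    have "T p \<subseteq> {..<p} \<and> card (T p) + k \<le> k + 1" if "p \<in> U" for p using p2[OF that] by (simp add: T_def)
    from moment_le[OF U k S, of T, OF _ this]
    show "(\<Sum>c\<in>avoid U T. real (card (free U S c)) ^ k) \<le> real M * (\<Prod>p\<in>U. (1 - 1 / real p) ^ card (T p)) * (exp (b + 1) * \<delta> * real (card S)) ^ k"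
      unfolding M_def \<delta>_def by blast
  qed (use \<delta> in auto)
  also have "\<dots> = real (card A) * exp (b * k) * (exp (b + 1) * \<delta> * real (card S)) ^ k"
    using M \<delta> by (simp add: T_def \<delta>_def[symmetric])
  also have "\<dots> = real (card A) * (exp (2 * b + 1) * \<delta> * real (card S)) ^ k"
    by (simp add: power_mult_distrib exp_of_nat_mult[symmetric] exp_add[symmetric] algebra_simps)
  finally have mom: "(\<Sum>a\<in>A. real (card (free U S a)) ^ k) \<le> real (card A) * (exp (2 * b + 1) * \<delta> * real (card S)) ^ k" .
  have "(\<Sum>a\<in>A. real (card (free U S a))) ^ k * card A \<le> real (card A) ^ k * (\<Sum>a\<in>A. real (card (free U S a)) ^ k)"
    by (rule power_mean_sum[OF A(1)]) auto
  also have "\<dots> \<le> real (card A) ^ k * (real (card A) * (exp (2 * b + 1) * \<delta> * real (card S)) ^ k)"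
    using mom by (intro mult_left_mono) auto
  finally have "(\<Sum>a\<in>A. real (card (free U S a))) ^ k * card A \<le> (exp (2 * b + 1) * \<delta> * real (card A) * real (card S)) ^ k * card A"
    by (simp add: power_mult_distrib mult_ac)
  then have "(\<Sum>a\<in>A. real (card (free U S a))) ^ k \<le> (exp (2 * b + 1) * \<delta> * real (card A) * real (card S)) ^ k"
    using cA by simp
  then have "(\<Sum>a\<in>A. real (card (free U S a))) \<le> exp (2 * b + 1) * \<delta> * real (card A) * real (card S)"
    using k \<delta> by (subst (asm) power_mono_iff) (auto intro!: sum_nonneg)
  then show ?thesis using pairs by (simp add: M_def)
qed (simp add: coprime_pairs_def)

section \<open>Proof of the theorem\<close>

lemma card_sq_le_sum_selberg_sq:
  assumes A: "finite A" "\<And>a. a \<in> A \<Longrightarrow> prime a \<and> R < a" and S: "finite S" "\<And>a b. a \<in> A \<Longrightarrow> b \<in> A \<Longrightarrow> a + b \<in> S"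
    and R: "R \<ge> 1" "z \<le> R"
  shows "real (card A) ^ 2 \<le> (\<Sum>(a, s)\<in>coprime_pairs (primorial z) A S. selberg (rough_primes z R) R (int s - int a) ^ 2)"
proof -
  have not_dvd: "\<not> p dvd b" if "b \<in> A" "prime p" "p \<le> R" for b p
    using A(2)[OF that(1)] that(2,3) primes_dvd_imp_eq[of p b] by auto
  have inj: "inj_on (\<lambda>(a, b). (a, a + b)) (A \<times> A)" by (auto simp: inj_on_def)
  have "real (card A) ^ 2 = (\<Sum>(a, b)\<in>A \<times> A. 1)" using A(1) by (simp add: card_cartesian_product power2_eq_square)
  also have "\<dots> = (\<Sum>(a, b)\<in>A \<times> A. selberg (rough_primes z R) R (int (a + b) - int a) ^ 2)"
  proof (intro sum.cong refl, clarify)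
    fix a b assume ab: "a \<in> A" "b \<in> A"
    have "selberg (rough_primes z R) R (int b) = 1"
      using not_dvd[OF ab(2)] R by (intro selberg_coprime primeset_rough) (auto simp: rough_primes_def)
    then show "1 = selberg (rough_primes z R) R (int (a + b) - int a) ^ 2" by simp
  qed
  also have "\<dots> = (\<Sum>(a, s)\<in>(\<lambda>(a, b). (a, a + b)) ` (A \<times> A). selberg (rough_primes z R) R (int s - int a) ^ 2)"
    by (subst sum.reindex[OF inj]) (simp add: case_prod_unfold)
  also have "\<dots> \<le> (\<Sum>(a, s)\<in>coprime_pairs (primorial z) A S. selberg (rough_primes z R) R (int s - int a) ^ 2)"
  proof (intro sum_mono2)
    have "coprime b (primorial z)" if "b \<in> A" for b
      unfolding primorial_def
    proof (intro prod_coprime_right)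
      fix p assume "p \<in> {p. prime p \<and> p \<le> z}"
      then show "coprime b p" using not_dvd[OF that, of p] R
        by (metis coprime_commute le_trans mem_Collect_eq prime_imp_coprime)
    qed
    then have "coprime (int b) (int (primorial z))" if "b \<in> A" for b using that by (simp add: coprime_int_iff)
    then show "(\<lambda>(a, b). (a, a + b)) ` (A \<times> A) \<subseteq> coprime_pairs (primorial z) A S"
      using S(2) by (auto simp: coprime_pairs_def)
  qed (auto simp: finite_coprime_pairs A S)
  finally show ?thesis .
qed

text \<open>The primes in (y, z], exploited fully by the moment bound, cancel from the Mertens
  product; those up to y remain as a loss.\<close>

lemma mertens_prod_split:
  assumes "y \<le> z"
  shows "mertens_prod z * (\<Prod>p\<in>rough_primes y z. 1 - 1 / real p) = mertens_prod y"
proof -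
  have "{p. prime p \<and> p \<le> z} = {p. prime p \<and> p \<le> y} \<union> rough_primes y z"
    using assms by (auto simp: rough_primes_def)
  then have "mertens_prod z = mertens_prod y * (\<Prod>p\<in>rough_primes y z. real p / (real p - 1))"
    unfolding mertens_prod_def using primesetD(1)[OF primeset_rough]
    by (simp only:) (subst prod.union_disjoint, auto simp: rough_primes_def)
  moreover have "(\<Prod>p\<in>rough_primes y z. real p / (real p - 1)) * (\<Prod>p\<in>rough_primes y z. 1 - 1 / real p) = 1"
    unfolding prod.distrib[symmetric]
  proof (intro prod.neutral ballI)
    fix p assume "p \<in> rough_primes y z"
    then have "real p \<ge> 2" using primesetD(3)[OF primeset_rough] by fastforce
    then show "real p / (real p - 1) * (1 - 1 / real p) = 1" by (simp add: field_simps)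
  qed
  ultimately show ?thesis by (simp add: mult.assoc)
qed

lemma rough_prod_dvd_primorial: "\<Prod>(rough_primes y z) dvd primorial z"
  unfolding primorial_def
  using prod_dvd_prod_subset[of "{p. prime p \<and> p \<le> z}" "rough_primes y z" "\<lambda>p. p"] by (auto simp: rough_primes_def)

lemma coprime_pairs_mono_dvd:
  assumes "finite A" "finite S" "M dvd W"
  shows "card (coprime_pairs W A S) \<le> card (coprime_pairs M A S)"
proof (intro card_mono finite_coprime_pairs assms subsetI)
  fix x assume "x \<in> coprime_pairs W A S"
  then obtain a s where x: "x = (a, s)" "a \<in> A" "s \<in> S" "coprime (int s - int a) (int W)"
    by (auto simp: coprime_pairs_def)
  have "coprime (int s - int a) (int M)"
    by (rule coprime_divisors[OF dvd_refl _ x(4)]) (use assms(3) in simp)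
  then show "x \<in> coprime_pairs M A S" using x by (simp add: coprime_pairs_def)
qed

text \<open>The Brun-Titchmarsh inequality modulo M = \<open>\<Prod>U\<close>. The sieve uses the
  primes up to R outside U; stripping those of U from the harmonic sum produces \<delta> =
  phi(M)/M.\<close>

lemma brun_titchmarsh_le:
  assumes A: "finite A" "\<And>a. a \<in> A \<Longrightarrow> prime a \<and> R < a \<and> a \<le> X" and R: "R \<ge> 2" and U: "primeset U"
    and X: "R ^ 2 * \<Prod>U \<le> X"
  shows "real (card (residue_class (\<Prod>U) c A)) * (real (\<Prod>U) * (\<Prod>p\<in>U. 1 - 1 / real p)) \<le> 24 * real X / ln (real R)"
proof -
  define M \<delta> P where "M = \<Prod>U" and "\<delta> = (\<Prod>p\<in>U. 1 - 1 / real p)" and "P = {p. prime p \<and> p \<le> R \<and> p \<notin> U}"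
  have M: "M > 0" unfolding M_def by (rule prod_primeset_pos[OF U])
  have finU: "finite U" using U by (rule primesetD(1))
  have p2: "real p \<ge> 2" if "p \<in> U" for p using primesetD(3)[OF U that] by simp
  have \<delta>: "\<delta> > 0" unfolding \<delta>_def using p2 by (intro prod_pos) (force simp: field_simps)
  have P: "primeset P" unfolding primeset_def P_def by auto
  have "\<not> p dvd M" if pP: "p \<in> P" for p
  proof
    assume "p dvd M"
    then obtain q where q: "q \<in> U" "p dvd q"
      using prime_dvd_prod_iff[of U p id] finU pP by (auto simp: M_def P_def)
    then have "p = q" using that primesetD(2)[OF U q(1)] primes_dvd_imp_eq by (auto simp: P_def)
    then show False using q that by (simp add: P_def)
  qed
  moreover have "\<not> p dvd b" if "b \<in> A" "p \<in> P" for b p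
    using A(2)[OF that(1)] that(2) primes_dvd_imp_eq[of p b] by (auto simp: P_def)
  ultimately have 1: "real (card (residue_class M c A)) * dens P R \<le> 8 * real (X div M + 1 + R ^ 2)"
    using A R M by (intro sieve_bound[OF P]) (auto simp: residue_class_def)
  also have "\<dots> \<le> 24 * (X / M)"
  proof -
    have "real (X div M) \<le> X / M" using floor_divide_of_nat_eq[of X M, where ?'a=real] by linarith
    moreover have "real (R ^ 2 * M) \<le> real X" using X by (simp only: M_def of_nat_le_iff)
    then have "real (R ^ 2) \<le> X / M" using M by (simp add: pos_le_divide_eq)
    moreover have "1 \<le> real (R ^ 2)" using R by simp
    ultimately show ?thesis unfolding of_nat_add of_nat_1 by argo
  qed
  finally have 1: "real (card (residue_class M c A)) * dens P R \<le> 24 * (X / M)" .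
  have "ln R \<le> (\<Prod>p\<in>U. real p / (real p - 1)) * dens P R"
    using R by (intro ln_le_dens U P) (auto simp: P_def)
  also have "(\<Prod>p\<in>U. real p / (real p - 1)) = 1 / \<delta>"
  proof -
    have "(\<Prod>p\<in>U. real p / (real p - 1)) * \<delta> = 1" unfolding \<delta>_def prod.distrib[symmetric]
    proof (intro prod.neutral ballI)
      fix p assume "p \<in> U"
      from p2[OF this] show "real p / (real p - 1) * (1 - 1 / real p) = 1" by (simp add: field_simps)
    qed
    then show ?thesis using \<delta> by (simp add: field_simps)
  qed
  finally have "\<delta> * ln R \<le> dens P R" using \<delta> by (simp add: field_simps)
  then have "real (card (residue_class M c A)) * (\<delta> * ln R) \<le> real (card (residue_class M c A)) * dens P R"
    by (intro mult_left_mono) auto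
  also note 1
  finally have "real (card (residue_class M c A)) * (\<delta> * ln R) * M \<le> 24 * X" using M by (simp add: pos_le_divide_eq)
  then show ?thesis using R unfolding M_def[symmetric] \<delta>_def[symmetric] by (simp add: pos_le_divide_eq mult_ac)
qed

text \<open>R is about x^(1/20) and z at most K (log x)^(3/4) + 1, so the primorial of z is at most
  x^(7/10) and R^6 times it at most x. Other conditions give log R \<ge> (log x)/40, 2 R \<le> |A|,
  and a target size of at least 1.\<close>

lemma eventually_sieve_parameters:
  assumes "K > 0" "c' > (0::real)"
  shows "\<forall>\<^sub>F x::real in at_top. 
     ln (ln x) \<ge> 1 \<and> x powr (1/20) - 1 \<ge> x powr (1/40) \<and> 2 * x powr (1/20) \<le> x * ln x powr (-3/2) \<and>
     10002 * (K * ln x powr (3/4) + 1) \<le> 7/10 * ln x \<and> K * ln x powr (3/4) + 1 \<le> x powr (1/20) - 1 \<and>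
     x powr (1/40) \<ge> 2 \<and> c' / 3 * x / ln x \<ge> 1 \<and>
     real (card {p::nat. prime p \<and> real p \<le> x}) \<le> 11/10 * x / ln x"
proof -
  have "\<forall>\<^sub>F x::real in at_top. ln (ln x) \<ge> 1" by real_asymp
  moreover have "\<forall>\<^sub>F x::real in at_top. x powr (1/20) - 1 \<ge> x powr (1/40)" by real_asymp
  moreover have "\<forall>\<^sub>F x::real in at_top. 2 * x powr (1/20) \<le> x * ln x powr (-3/2)" by real_asymp
  moreover have "\<forall>\<^sub>F x::real in at_top. 10002 * (K * ln x powr (3/4) + 1) \<le> 7/10 * ln x" using assms by real_asymp
  moreover have "\<forall>\<^sub>F x::real in at_top. K * ln x powr (3/4) + 1 \<le> x powr (1/20) - 1" using assms by real_asymp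
  moreover have "\<forall>\<^sub>F x::real in at_top. x powr (1/40) \<ge> 2" by real_asymp
  moreover have "\<forall>\<^sub>F x::real in at_top. c' / 3 * x / ln x \<ge> 1" using assms by real_asymp
  moreover note prime_count_le
  ultimately show ?thesis by eventually_elim auto
qed

lemma lnln_ratio_pos: "ln (30/11::real) > 1"
proof -
  have "exp 1 < (30/11::real)" using e_less_272 by simp
  then show ?thesis by (metis exp_gt_zero ln_exp ln_less_cancel_iff order_less_trans)
qed

theorem theorem1p1:
  "\<exists>(c::real) > 0. \<exists>(c'::real) > 0. \<exists>x0::real. \<forall>x \<ge> x0. \<forall>(A::nat set) (\<alpha>::real).
     (\<forall>p\<in>A. prime p) \<longrightarrow> real ` A \<subseteq> {1..x} \<longrightarrow>
     real (card A) = \<alpha> * x * inverse (ln x) \<longrightarrow>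
     \<alpha> \<ge> c * (ln x) powr (-1/2) * ln (ln x) \<longrightarrow>
     real (card (A + A)) \<ge> c' * (ln x / ln (ln (3 * inverse \<alpha>))) * real (card A)"
proof -
  obtain C0 where C0: "C0 > 0" "\<And>N. N \<ge> 2 \<Longrightarrow> mertens_prod N \<le> C0 * ln (real N)"
    using mertens_prod_le by blast
  define C where "C = max 1 C0"
  have C1: "C \<ge> 1" by (simp add: C_def)
  have C: "mertens_prod N \<le> C * ln (real N)" if "N \<ge> 2" for N
    using C0(2)[OF that] that by (auto simp: C_def intro: order_trans mult_right_mono)
  obtain K where K: "K > 0" and sieve: "\<And>z R X A S. 390625 \<le> z \<Longrightarrow> z \<le> R \<Longrightarrow> A \<subseteq> {..X} \<Longrightarrow> S \<subseteq> {..X} \<Longrightarrow>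
     \<forall>a\<in>A. \<forall>p. prime p \<longrightarrow> p \<le> R \<longrightarrow> \<not> p dvd a \<Longrightarrow> R ^ 6 * primorial z \<le> X \<Longrightarrow>
     (\<Sum>(a, s)\<in>coprime_pairs (primorial z) A S. selberg (rough_primes z R) R (int s - int a) ^ 2) \<le>
       mertens_prod z / ln R * (card (coprime_pairs (primorial z) A S) +
         K * X * sqrt (real (card A) * real (card S) / ln R) * real z powr (-13/16))"
    using sum_selberg_sq_pairs_le by metis
  \<comment> \<open>A positive lower bound for log log (3/\<alpha>), since \<alpha> \<le> 11/10 and
    30/11 > e.\<close>
  define l0 where "l0 = ln (ln (30/11::real))"
  have l0: "l0 > 0" using lnln_ratio_pos by (simp add: l0_def)
  \<comment> \<open>Makes log 10 + l \<le> D l for l \<ge> l0, which bounds log (2k) by a multiple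
    of log log (3/\<alpha>).\<close>
  define D where "D = 1 + ln 10 / l0"
  have D1: "D \<ge> 1" using l0 by (simp add: D_def)
  text \<open>As \<open>k \<ge> 4\<close> below, \<open>exp (b * k)\<close> contains \<open>exp (4 * b)\<close>, which beats the loss \<open>exp (2 * b + 1)\<close> in \<open>card_coprime_pairs_le\<close>.\<close>
  define b where "b = max 3 (ln (8 * C * D * exp 9) / 2)"
  have b3: "b \<ge> 3" by (simp add: b_def)
  have bexp: "8 * C * D * exp 9 \<le> exp (2 * b)"
  proof -
    have "ln (8 * C * D * exp 9) \<le> 2 * b" by (simp add: b_def)
    then have "exp (ln (8 * C * D * exp 9)) \<le> exp (2 * b)" by (simp only: exp_le_cancel_iff)
    moreover have "8 * C * D * exp 9 > 0" using C1 D1 by simp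
    ultimately show ?thesis by (simp only: exp_ln)
  qed
  \<comment> \<open>The first entry makes the main term at most a quarter of |A1|^2, with 640 = 80 *
    2 * 4; the second keeps the target size t below x.\<close>
  define c' where "c' = min (exp (- 2 * b - 1) / (640 * C * D)) (l0 / 2)"
  have c'0: "c' > 0" using C1 D1 l0 by (simp add: c'_def)
  have c'1: "640 * C * D * exp (2 * b + 1) * c' \<le> 1"
  proof -
    have "640 * C * D * exp (2 * b + 1) * c' \<le> 640 * C * D * exp (2 * b + 1) * (exp (- 2 * b - 1) / (640 * C * D))"
      using C1 D1 by (intro mult_left_mono) (auto simp: c'_def)
    also have "\<dots> = 1" using C1 D1 by (simp add: field_simps exp_add[symmetric])
    finally show ?thesis .
  qed
  have c'2: "c' \<le> l0 / 2" by (simp add: c'_def)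
  \<comment> \<open>Needed for 6 x \<le> (c' \<alpha>^2 x / 3) (50/\<alpha>)^2 e^(4(b-2)), whence
    18/2500 = 6 * 3 / 2500.\<close>
  have c'3: "18 / 2500 \<le> c' * exp (4 * b - 8)"
  proof -
    have "18 / 2500 \<le> exp (- 2 * b - 1) / (640 * C * D) * exp (4 * b - 8)"
    proof -
      have "exp (- 2 * b - 1) / (640 * C * D) * exp (4 * b - 8) = exp (2 * b) / exp 9 / (640 * C * D)"
        by (simp add: exp_add[symmetric] exp_diff[symmetric])
      moreover have "8 * C * D \<le> exp (2 * b) / exp 9" using bexp by (simp add: pos_le_divide_eq)
      then have "8 * C * D / (640 * C * D) \<le> exp (2 * b) / exp 9 / (640 * C * D)"
        using C1 D1 by (intro divide_right_mono) auto
      moreover have "8 * C * D / (640 * C * D) = 1 / 80" using C1 D1 by (simp add: field_simps)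
      ultimately show ?thesis by linarith
    qed
    moreover have "18 / 2500 \<le> l0 / 2 * exp (4 * b - 8)"
    proof -
      have "l0 * D = l0 + ln 10" using l0 by (simp add: D_def distrib_left)
      moreover have "ln (3::real) \<le> ln 10" by simp
      ultimately have "1 \<le> l0 * D" using l0 ln3_gt_1 by linarith
      also have "\<dots> \<le> l0 * exp (4 * b - 8)"
      proof (intro mult_left_mono)
        have "D \<le> 8 * C * D * exp 9 * exp (- 2)"
        proof -
          have "1 * 1 \<le> (8 * C) * (exp 9 * exp (- 2))" using C1 by (intro mult_mono) (auto simp: exp_add[symmetric])
          then have "1 * D \<le> (8 * C) * (exp 9 * exp (- 2)) * D" using D1 by (intro mult_right_mono) auto
          then show ?thesis by (simp add: mult_ac)
        qed
        also have "\<dots> \<le> exp (2 * b) * exp (2 * b - 8)" using bexp b3 by (intro mult_mono) auto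
        also have "\<dots> = exp (4 * b - 8)" by (simp add: exp_add[symmetric])
        finally show "D \<le> exp (4 * b - 8)" .
      qed (use l0 in auto)
      finally show ?thesis by simp
    qed
    ultimately show ?thesis by (simp add: c'_def min_def)
  qed
  \<comment> \<open>429688 \<ge> 390625 * 11/10, so K1/\<alpha> \<ge> 390625 and the primes above z
    are large enough for \<open>weight_le_powr\<close>. The second entry serves the tail
    estimate.\<close>
  define K1 where "K1 = max 429688 (8 * 640 * C * K * sqrt (80 * c' / l0))"
  have K1: "K1 \<ge> 429688" "8 * 640 * C * K * sqrt (80 * c' / l0) \<le> K1" by (simp_all add: K1_def)
  define K2 where "K2 = K1 powr (3/2)"
  have K2: "K2 > 0" using K1 by (simp add: K2_def)
  obtain x0 where x0: "\<And>x. x \<ge> x0 \<Longrightarrow> ln (ln x) \<ge> 1 \<and> x powr (1/20) - 1 \<ge> x powr (1/40) \<and> 2 * x powr (1/20) \<le> x * ln x powr (-3/2) \<and>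
     10002 * (K2 * ln x powr (3/4) + 1) \<le> 7/10 * ln x \<and> K2 * ln x powr (3/4) + 1 \<le> x powr (1/20) - 1 \<and>
     x powr (1/40) \<ge> 2 \<and> c' / 3 * x / ln x \<ge> 1 \<and>
     real (card {p::nat. prime p \<and> real p \<le> x}) \<le> 11/10 * x / ln x"
    using eventually_sieve_parameters[OF K2 c'0] unfolding eventually_at_top_linorder by blast
  have main: "real (card (A + A)) \<ge> c' * (ln x / ln (ln (3 * inverse \<alpha>))) * real (card A)"
    if x: "x \<ge> max 3 x0" and Ap: "\<forall>p\<in>A. prime p" and Ax: "real ` A \<subseteq> {1..x}"
    and cardA: "real (card A) = \<alpha> * x * inverse (ln x)"
    and \<alpha>: "\<alpha> \<ge> 1 * (ln x) powr (-1/2) * ln (ln x)" for x \<alpha> :: real and A :: "nat set"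
  proof -
    define L where "L = ln x"
    have x3: "x \<ge> 3" using x by simp
    have E: "ln L \<ge> 1" "x powr (1/20) - 1 \<ge> x powr (1/40)" "2 * x powr (1/20) \<le> x * L powr (-3/2)"
       "10002 * (K2 * L powr (3/4) + 1) \<le> 7/10 * L" "K2 * L powr (3/4) + 1 \<le> x powr (1/20) - 1"
       "x powr (1/40) \<ge> 2" "c' / 3 * x / L \<ge> 1"
       "real (card {p::nat. prime p \<and> real p \<le> x}) \<le> 11/10 * x / L"
      using x0[of x] x by (auto simp: L_def)
    have L0: "L > 0" using x3 by (simp add: L_def)
    have L1: "L \<ge> 1" using E(1) L0 by (metis ln_ge_iff exp_ge_add_one_self order_trans add_increasing2 zero_le_one le_add_same_cancel1 one_le_exp_iff)
    have \<alpha>L: "\<alpha> \<ge> L powr (-1/2)"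
    proof -
      have "L powr (-1/2) * 1 \<le> L powr (-1/2) * ln L" using E(1) by (intro mult_left_mono) auto
      then show ?thesis using \<alpha> by (simp add: L_def)
    qed
    have \<alpha>0: "\<alpha> > 0" using \<alpha>L L0 by (smt (verit) powr_gt_zero)
    have A_eq: "real (card A) = \<alpha> * x / L" using cardA by (simp add: L_def field_simps)
    have finA: "finite A" using A_eq \<alpha>0 x3 L0 by (intro card_ge_0_finite) (metis divide_pos_pos mult_pos_pos of_nat_0_less_iff less_le_trans zero_less_numeral)
    have Ale: "real a \<le> x" if "a \<in> A" for a using Ax that by auto
    have \<alpha>1: "\<alpha> \<le> 11/10"
    proof -
      have "{p::nat. prime p \<and> real p \<le> x} \<subseteq> {..nat \<lfloor>x\<rfloor>}" by (auto simp: le_nat_iff le_floor_iff)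
      then have "finite {p::nat. prime p \<and> real p \<le> x}" using finite_subset by blast
      then have "card A \<le> card {p::nat. prime p \<and> real p \<le> x}" using Ap Ale by (intro card_mono) auto
      then have "\<alpha> * x / L \<le> 11/10 * x / L" using E(8) A_eq by linarith
      then have "x / L * \<alpha> \<le> x / L * (11/10)" by (simp add: mult.commute)
      moreover have "0 < x / L" using x3 L0 by simp
      ultimately show ?thesis by (simp only: mult_le_cancel_left_pos)
    qed
    define v where "v = ln (3 / \<alpha>)"
    have v1: "v \<ge> ln (30/11)" unfolding v_def using \<alpha>0 \<alpha>1 by (subst ln_le_cancel_iff) (auto simp: field_simps)
    have v: "v > 1" using v1 lnln_ratio_pos by simp
    define l where "l = ln v"
    have l: "l \<ge> l0" unfolding l_def l0_def using v1 lnln_ratio_pos by (subst ln_le_cancel_iff) auto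
    have lpos: "l > 0" using l l0 by simp
    have l\<alpha>: "l \<le> 3 / \<alpha>"
    proof -
      have "l \<le> v" unfolding l_def using v ln_le_minus_one[of v] by simp
      also have "v \<le> 3 / \<alpha>" unfolding v_def using \<alpha>0 ln_le_minus_one[of "3 / \<alpha>"] by simp
      finally show ?thesis .
    qed
    define t where "t = c' * \<alpha> * x / l"
    have goal_eq: "c' * (ln x / ln (ln (3 * inverse \<alpha>))) * real (card A) = t"
      using L0 unfolding A_eq t_def l_def v_def by (simp add: L_def divide_inverse)
    show ?thesis
    proof (rule ccontr)
      assume "\<not> ?thesis"
      then have small: "real (card (A + A)) < t" unfolding goal_eq by simp
      define N R where "N = nat \<lfloor>x\<rfloor>" and "R = nat \<lfloor>x powr (1/20)\<rfloor>"
      have N: "real N \<le> x" "x < real N + 1" using x3 by (simp_all add: N_def)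
      have R: "real R \<le> x powr (1/20)" "real R > x powr (1/20) - 1" by (simp_all add: R_def)
      have lnR: "ln (real R) \<ge> L / 40"
      proof -
        have "x powr (1/40) \<le> real R" using E(2) R by linarith
        moreover have "0 < x powr (1/40)" using x3 by simp
        ultimately have "ln (x powr (1/40)) \<le> ln (real R)" by (intro ln_mono)
        then show ?thesis using x3 by (simp add: ln_powr L_def)
      qed
      have R2: "R \<ge> 2" using E(2,6) R by linarith
      have lnR0: "ln (real R) > 0" using lnR L0 by linarith
      \<comment> \<open>Primes up to R may be hit by the sieve; discarding them costs at most half
        of A, as 2 R \<le> |A|.\<close>
      define A1 where "A1 = {a\<in>A. R < a}"
      have finA1: "finite A1" using finA by (simp add: A1_def)
      have A1p: "prime a \<and> R < a \<and> a \<le> N" if "a \<in> A1" for a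
        using that Ap Ale[of a] by (auto simp: A1_def N_def le_nat_iff le_floor_iff)
      have RA: "2 * real R \<le> real (card A)"
      proof -
        have "2 * real R \<le> x * L powr (-3/2)" using E(3) R by linarith
        also have "\<dots> = L powr (-1/2) * x / L" using L0 by (simp add: powr_minus_divide powr_add[of L 1 "1/2", simplified] field_simps)
        also have "\<dots> \<le> \<alpha> * x / L" using \<alpha>L x3 L0 by (intro divide_right_mono mult_right_mono) auto
        finally show ?thesis by (simp add: A_eq)
      qed
      have cardA1: "real (card A) \<le> 2 * real (card A1)" "real (card A1) \<le> real (card A)"
      proof -
        have "A \<subseteq> A1 \<union> {1..R}" using Ap by (auto simp: A1_def prime_ge_1_nat Suc_le_eq prime_gt_0_nat)
        then have "card A \<le> card (A1 \<union> {1..R})" using finA1 by (intro card_mono) auto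
        also have "\<dots> \<le> card A1 + R" using card_Un_le[of A1 "{1..R}"] by simp
        finally show "real (card A) \<le> 2 * real (card A1)" using RA by linarith
        show "real (card A1) \<le> real (card A)" using finA by (auto intro: card_mono simp: A1_def)
      qed
      have A0: "real (card A) > 0" unfolding A_eq using \<alpha>0 x3 L0 by simp
      have A10: "real (card A1) > 0" using cardA1 A0 by linarith
      have t1: "t \<ge> 1"
      proof -
        have "1 \<le> c' / 3 * x / L" by (rule E(7))
        also have "\<dots> = c' * (L powr (-1/2) * L powr (-1/2)) * x / 3" using L0 by (simp add: powr_add[symmetric] powr_minus_divide)
        also have "\<dots> \<le> c' * (\<alpha> * \<alpha>) * x / 3" using c'0 \<alpha>L \<alpha>0 x3
          by (intro divide_right_mono mult_right_mono mult_left_mono mult_mono) auto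
        also have "\<dots> = c' * \<alpha> * x / (3 / \<alpha>)" by simp
        also have "\<dots> \<le> t" unfolding t_def using l\<alpha> lpos c'0 \<alpha>0 x3 by (intro divide_left_mono) auto
        finally show ?thesis .
      qed
      define m where "m = nat \<lceil>t\<rceil>"
      have m: "t \<le> real m" "real m \<le> 2 * t" using t1 unfolding m_def by linarith+
      have tx: "t \<le> x"
      proof -
        have "c' * \<alpha> \<le> l" 
        proof -
          have "c' * \<alpha> \<le> l0 / 2 * (11/10)" using c'2 \<alpha>1 \<alpha>0 c'0 l0 by (intro mult_mono) auto
          then show ?thesis using l l0 by linarith
        qed
        then have "c' * \<alpha> * x \<le> l * x" using x3 by (intro mult_right_mono) auto
        then show ?thesis unfolding t_def using lpos by (simp add: pos_divide_le_eq mult.commute)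
      qed
      text \<open>
        The sumset is enlarged to size about \<open>t\<close>: the moment bound needs a lower bound for the density of \<open>S\<close>
        by a power of \<open>\<alpha>\<close>.
      \<close>
      obtain S where S: "A1 + A1 \<subseteq> S" "S \<subseteq> {..2 * N}" "card S = m"
      proof -
        have sub: "A1 + A1 \<subseteq> {..2 * N}"
        proof
          fix s assume "s \<in> A1 + A1"
          then obtain a b where ab: "s = a + b" "a \<in> A1" "b \<in> A1" by (rule set_plus_elim)
          then show "s \<in> {..2 * N}" using A1p[OF ab(2)] A1p[OF ab(3)] by simp
        qed
        have "A1 + A1 \<subseteq> A + A" by (intro set_plus_mono2) (auto simp: A1_def)
        then have "card (A1 + A1) \<le> card (A + A)" using finA by (intro card_mono finite_set_plus) auto
        then have 1: "card (A1 + A1) \<le> m" using small m by linarith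
        have "real m \<le> real (card {..2 * N})" using N tx x3 unfolding m_def by simp linarith
        then have 2: "m \<le> card {..2 * N}" by (simp only: of_nat_le_iff)
        from exists_subset_between[OF 1 2 sub] that show ?thesis by auto
      qed
      have finS: "finite S" using S(2) finite_subset by blast
      \<comment> \<open>The summand 4 gives e^k \<ge> 50/\<alpha>, as e^4 \<ge> 50. The exponent 3/2
        exceeds 16/11, so that z^(-11/16) \<le> \<alpha>/K1 in the tail.\<close>
      define k z where "k = nat \<lceil>ln (1 / \<alpha>)\<rceil> + 4" and "z = nat \<lceil>(K1 / \<alpha>) powr (3/2)\<rceil>"
      define y where "y = 2 * k"
      have inv\<alpha>: "1 / \<alpha> \<ge> 10/11" using \<alpha>0 \<alpha>1 by (simp add: field_simps)
      have k: "k \<ge> 4" "real k \<ge> ln (1 / \<alpha>) + 4" "real k \<le> v + 4"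
      proof -
        show "k \<ge> 4" "real k \<ge> ln (1 / \<alpha>) + 4" unfolding k_def by linarith+
        have "ln (1 / \<alpha>) = v - ln 3" unfolding v_def using \<alpha>0 by (simp add: ln_div)
        moreover have "ln (3::real) \<ge> 1" using ln3_gt_1 by simp
        ultimately have "ln (1 / \<alpha>) \<le> v - 1" by linarith
        then show "real k \<le> v + 4" using v unfolding k_def by linarith
      qed
      have expk: "exp (real k) \<ge> 50 / \<alpha>"
      proof -
        have "50 \<le> exp (4::real)"
        proof -
          have "50 \<le> (27/10::real) ^ 4" by (simp add: power_divide)
          also have "\<dots> \<le> exp 1 ^ 4" using exp_1_ge by (intro power_mono) auto
          also have "\<dots> = exp (4::real)" by (simp add: exp_of_nat_mult[symmetric])
          finally show ?thesis .
        qed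
        then have "50 / \<alpha> \<le> exp 4 * (1 / \<alpha>)" using \<alpha>0 by (simp add: divide_right_mono)
        also have "\<dots> = exp (ln (1 / \<alpha>) + 4)" using \<alpha>0 by (simp add: exp_add)
        also have "\<dots> \<le> exp (real k)" using k by simp
        finally show ?thesis .
      qed
      have K1\<alpha>: "K1 / \<alpha> \<ge> 390625" "K1 / \<alpha> \<le> (K1 / \<alpha>) powr (3/2)"
      proof -
        have "390625 \<le> K1 * (10/11)" using K1 by simp
        also have "\<dots> \<le> K1 * (1 / \<alpha>)" using inv\<alpha> K1 by (intro mult_left_mono) auto
        finally show 1: "K1 / \<alpha> \<ge> 390625" by simp
        have "(K1 / \<alpha>) powr 1 \<le> (K1 / \<alpha>) powr (3/2)" using 1 by (intro powr_mono) auto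
        moreover have "(K1 / \<alpha>) powr 1 = K1 / \<alpha>" by (rule powr_one) (use 1 in linarith)
        ultimately show "K1 / \<alpha> \<le> (K1 / \<alpha>) powr (3/2)" by linarith
      qed
      have zr: "real z \<ge> (K1 / \<alpha>) powr (3/2)" "real z \<le> (K1 / \<alpha>) powr (3/2) + 1"
        unfolding z_def using K1\<alpha> by linarith+
      have z0: "z \<ge> 390625" using zr K1\<alpha> by linarith
      have zL: "real z \<le> K2 * L powr (3/4) + 1"
      proof -
        have "1 / \<alpha> \<le> L powr (1/2)" using \<alpha>L \<alpha>0 L0 by (simp add: powr_minus_divide field_simps)
        then have "(1 / \<alpha>) powr (3/2) \<le> (L powr (1/2)) powr (3/2)" using \<alpha>0 by (intro powr_mono2) auto
        also have "\<dots> = L powr (3/4)" by (simp add: powr_powr)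
        finally have "K2 * (1 / \<alpha>) powr (3/2) \<le> K2 * L powr (3/4)" using K2 by (intro mult_left_mono) auto
        moreover have "(K1 / \<alpha>) powr (3/2) = K2 * (1 / \<alpha>) powr (3/2)"
          using powr_mult[of K1 "1 / \<alpha>" "3/2"] K1 \<alpha>0 by (simp add: K2_def)
        ultimately show ?thesis using zr by linarith
      qed
      have zR: "z \<le> R" using zL E(5) R by linarith
      have yz: "y \<le> z"
      proof -
        have "real y \<le> 2 * (3 / \<alpha> + 4)" 
        proof -
          have "v \<le> 3 / \<alpha>" unfolding v_def using \<alpha>0 ln_le_minus_one[of "3 / \<alpha>"] by simp
          then show ?thesis using k unfolding y_def by simp
        qed
        also have "\<dots> \<le> 15 * (1 / \<alpha>)" using inv\<alpha> by simp
        also have "\<dots> \<le> K1 * (1 / \<alpha>)" using K1 \<alpha>0 by (intro mult_right_mono) auto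
        finally have "real y \<le> real z" using K1\<alpha> zr by simp
        then show ?thesis by simp
      qed
      define X where "X = 2 * N"
      have X: "x \<le> real X" "real X \<le> 2 * x" using N x3 unfolding X_def by linarith+
      define U where "U = rough_primes y z"
      have U: "primeset U" unfolding U_def by (rule primeset_rough)
      define \<delta> where "\<delta> = (\<Prod>p\<in>U. 1 - 1 / real p)"
      have Wx: "R ^ 6 * primorial z \<le> X"
      proof -
        have "real (primorial z) \<le> exp (10002 * real z)" unfolding primorial_def using primorial_le[of z] by simp
        also have "\<dots> \<le> exp (7/10 * L)" using zL E(4) by simp
        also have "\<dots> = x powr (7/10)" using x3 by (simp add: powr_def L_def)
        finally have 1: "real (primorial z) \<le> x powr (7/10)" .
        have "real R ^ 6 \<le> (x powr (1/20)) ^ 6" using R by (intro power_mono) auto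
        also have "\<dots> = x powr (3/10)" using powr_realpow[of "x powr (1/20)" 6] x3 by (simp add: powr_powr)
        finally have "real R ^ 6 * real (primorial z) \<le> x powr (3/10) * x powr (7/10)" using 1 by (intro mult_mono) auto
        also have "\<dots> = x" using x3 by (simp add: powr_add[symmetric])
        also have "\<dots> \<le> real X" by (rule X)
        finally have "real (R ^ 6 * primorial z) \<le> real X" by simp
        then show ?thesis by (simp only: of_nat_le_iff)
      qed
      have UW: "\<Prod>U dvd primorial z" unfolding U_def by (rule rough_prod_dvd_primorial)
      have UX: "R ^ 2 * \<Prod>U \<le> X"
      proof -
        have "R ^ 2 * \<Prod>U \<le> R ^ 6 * primorial z"
          using R2 UW primorial_pos[of z] by (intro mult_le_mono power_increasing dvd_imp_le) auto
        then show ?thesis using Wx by simp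
      qed
      have pairs: "real (card (coprime_pairs (\<Prod>U) A1 S)) \<le> exp (2 * b + 1) * \<delta> * real (card A1) * real (card S)"
        unfolding \<delta>_def
      proof (rule card_coprime_pairs_le[OF U])
        show "2 * k < p" if "p \<in> U" for p using that by (simp add: U_def rough_primes_def y_def)
        show "1 \<le> k" using k by simp
        show "S \<subseteq> {..<X + 1}" using S by (auto simp: X_def)
        have "1 * \<Prod>U \<le> R ^ 2 * \<Prod>U" using R2 by (intro mult_le_mono) auto
        then have "\<Prod>U \<le> R ^ 2 * \<Prod>U" by (simp only: mult_1)
        then show "\<Prod>U \<le> X + 1" using UX by linarith
        \<comment> \<open>As l \<le> 3/\<alpha>, the density of S is at least of order \<alpha>^2;
          the concentration of A1 in a class costs at most order 1/\<alpha>. Both are covered by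
          e^(2k) \<ge> (50/\<alpha>)^2, and e^((b-2)k) is left for the constants.\<close>
        have bk: "exp (b * real k) = exp (real k) ^ 2 * exp ((b - 2) * real k)" 
          by (simp add: power2_eq_square exp_add[symmetric] algebra_simps)
        have "(50 / \<alpha>) ^ 2 \<le> exp (real k) ^ 2" using expk \<alpha>0 by (intro power_mono) auto
        moreover have "exp ((b - 2) * 4) \<le> exp ((b - 2) * real k)"
          unfolding exp_le_cancel_iff using b3 k(1) by (intro mult_left_mono) auto
        ultimately have eb: "(50 / \<alpha>) ^ 2 * exp ((b - 2) * 4) \<le> exp (b * real k)"
          unfolding bk by (intro mult_mono) auto
        show "2 * real (X + 1) \<le> real (card S) * exp (b * real k)"
        proof -
          have "2 * real (X + 1) \<le> 6 * x" using X x3 by simp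
          also have "\<dots> = 2500 / 3 * x * (18 / 2500)" by simp
          also have "\<dots> \<le> 2500 / 3 * x * (c' * exp (4 * b - 8))" using c'3 x3 by (intro mult_left_mono) auto
          also have "\<dots> = (c' * \<alpha> * x / (3 / \<alpha>)) * ((50 / \<alpha>) ^ 2 * exp ((b - 2) * 4))"
            using \<alpha>0 by (simp add: power2_eq_square field_simps)
          also have "\<dots> \<le> real (card S) * exp (b * real k)"
          proof (intro mult_mono eb)
            have "c' * \<alpha> * x / (3 / \<alpha>) \<le> t" unfolding t_def using l\<alpha> lpos c'0 \<alpha>0 x3 by (intro divide_left_mono) auto
            then show "c' * \<alpha> * x / (3 / \<alpha>) \<le> real (card S)" using m S(3) by simp
          qed (use \<alpha>0 in auto)
          finally show ?thesis .
        qed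
        show "finite A1" by (rule finA1)
        show "\<not> p dvd a" if "a \<in> A1" "p \<in> U" for a p
          using A1p[OF that(1)] that(2) primes_dvd_imp_eq[of p a] zR by (auto simp: U_def rough_primes_def)
        show "real (card (residue_class (\<Prod>U) c A1)) * (real (\<Prod>U) * (\<Prod>p\<in>U. 1 - 1 / real p)) \<le> real (card A1) * exp (b * real k)" for c
        proof -
          have "real (card (residue_class (\<Prod>U) c A1)) * (real (\<Prod>U) * (\<Prod>p\<in>U. 1 - 1 / real p)) \<le> 24 * real X / ln (real R)"
          proof (intro brun_titchmarsh_le finA1 U R2 UX)
            show "prime a \<and> R < a \<and> a \<le> X" if "a \<in> A1" for a using A1p[OF that] by (simp add: X_def)
          qed
          also have "\<dots> \<le> 24 * (2 * x) / (L / 40)" using X lnR L0 x3 by (intro frac_le) auto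
          also have "\<dots> = 1920 / \<alpha> * (\<alpha> * x / L)" using \<alpha>0 L0 by (simp add: field_simps)
          also have "\<dots> \<le> 1920 / \<alpha> * (2 * real (card A1))" using cardA1(1) \<alpha>0 unfolding A_eq by (intro mult_left_mono) auto
          also have "\<dots> = real (card A1) * (3840 / \<alpha>)" by simp
          also have "\<dots> \<le> real (card A1) * exp (b * real k)"
          proof (intro mult_left_mono)
            have "3840 / \<alpha> \<le> (50 / \<alpha>) ^ 2 * 2"
            proof -
              have "3840 * (1 / \<alpha>) \<le> 5000 * (10 / 11) * (1 / \<alpha>)" using \<alpha>0 by (intro mult_right_mono) auto
              also have "\<dots> \<le> 5000 * (1 / \<alpha>) * (1 / \<alpha>)" using inv\<alpha> \<alpha>0 by (intro mult_right_mono mult_left_mono) auto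
              finally show ?thesis by (simp add: power2_eq_square)
            qed
            also have "\<dots> \<le> (50 / \<alpha>) ^ 2 * exp ((b - 2) * 4)"
            proof (intro mult_left_mono)
              have "2 \<le> 1 + (b - 2) * 4" using b3 by simp
              also have "\<dots> \<le> exp ((b - 2) * 4)" by (rule exp_ge_add_one_self)
              finally show "2 \<le> exp ((b - 2) * 4)" .
            qed simp
            finally show "3840 / \<alpha> \<le> exp (b * real k)" using eb by simp
          qed auto
          finally show ?thesis .
        qed
      qed
      have mert0: "mertens_prod N \<ge> 0" for N unfolding mertens_prod_def
        by (intro prod_nonneg) (auto dest: prime_gt_0_nat)
      have sq: "real (card A1) ^ 2 \<le> mertens_prod z / ln R * (card (coprime_pairs (primorial z) A1 S) +
         K * X * sqrt (real (card A1) * real (card S) / ln R) * real z powr (-13/16))"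
      proof -
        have "real (card A1) ^ 2 \<le> (\<Sum>(a, s)\<in>coprime_pairs (primorial z) A1 S. selberg (rough_primes z R) R (int s - int a) ^ 2)"
        proof (intro card_sq_le_sum_selberg_sq finA1 finS zR)
          show "prime a \<and> R < a" if "a \<in> A1" for a using A1p[OF that] by simp
          show "a + b' \<in> S" if "a \<in> A1" "b' \<in> A1" for a b' using S(1) set_plus_intro[OF that] by blast
        qed (use R2 in simp)
        also have "\<dots> \<le> mertens_prod z / ln R * (card (coprime_pairs (primorial z) A1 S) +
         K * X * sqrt (real (card A1) * real (card S) / ln R) * real z powr (-13/16))"
        proof (rule sieve[OF z0 zR])
          show "A1 \<subseteq> {..X}"
          proof
            fix a assume "a \<in> A1"
            from A1p[OF this] show "a \<in> {..X}" by (simp add: X_def)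
          qed
          show "S \<subseteq> {..X}" using S by (simp add: X_def)
          show "\<forall>a\<in>A1. \<forall>p. prime p \<longrightarrow> p \<le> R \<longrightarrow> \<not> p dvd a"
          proof (intro ballI allI impI)
            fix a p assume "a \<in> A1" "prime p" "p \<le> R"
            then show "\<not> p dvd a" using A1p[of a] primes_dvd_imp_eq[of p a] by auto
          qed
        qed (rule Wx)
        finally show ?thesis .
      qed
      have main_term: "mertens_prod z / ln R * card (coprime_pairs (primorial z) A1 S) \<le> real (card A1) ^ 2 / 4"
      proof -
        have "real (card (coprime_pairs (primorial z) A1 S)) \<le> exp (2 * b + 1) * \<delta> * real (card A1) * real (card S)"
          using pairs coprime_pairs_mono_dvd[OF finA1 finS UW] by linarith
        then have "mertens_prod z / ln R * card (coprime_pairs (primorial z) A1 S) \<le> mertens_prod z / ln R * (exp (2 * b + 1) * \<delta> * real (card A1) * real (card S))"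
          using mert0 lnR0 by (intro mult_left_mono) auto
        also have "\<dots> = (mertens_prod z * \<delta>) / ln R * (exp (2 * b + 1) * real (card A1) * real (card S))"
          by simp
        also have "mertens_prod z * \<delta> = mertens_prod y"
          unfolding \<delta>_def U_def by (rule mertens_prod_split[OF yz])
        also have "mertens_prod y / ln R \<le> (C * D * l) / (L / 40)"
        proof (intro frac_le)
          have "mertens_prod y \<le> C * ln (real y)" using k by (intro C) (simp add: y_def)
          also have "ln (real y) \<le> ln (10 * v)" using k v by (subst ln_le_cancel_iff) (auto simp: y_def)
          also have "\<dots> = ln 10 + l" using v by (simp add: ln_mult l_def)
          also have "\<dots> \<le> D * l"
          proof -
            have "ln 10 = ln 10 / l0 * l0" using l0 by simp
            also have "\<dots> \<le> ln 10 / l0 * l" using l l0 by (intro mult_left_mono) auto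
            finally show ?thesis by (simp add: D_def algebra_simps)
          qed
          finally show "mertens_prod y \<le> C * D * l" using C1 by (simp add: mult_left_mono mult.assoc)
        qed (use lnR L0 C1 D1 lpos in auto)
        also have "(C * D * l) / (L / 40) * (exp (2 * b + 1) * real (card A1) * real (card S)) \<le>
            (C * D * l) / (L / 40) * (exp (2 * b + 1) * real (card A1) * (2 * t))"
          using m S(3) C1 D1 lpos L0 by (intro mult_left_mono) auto
        \<comment> \<open>The l from the Mertens product up to 2k cancels the denominator of t; this
          is the origin of the log log in the theorem.\<close>
        also have "\<dots> = 80 * C * D * exp (2 * b + 1) * c' * real (card A1) * (\<alpha> * x / L)"
          using lpos L0 by (simp add: t_def field_simps)
        also have "\<dots> \<le> 80 * C * D * exp (2 * b + 1) * c' * real (card A1) * (2 * real (card A1))"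
          using cardA1(1) C1 D1 c'0 unfolding A_eq by (intro mult_left_mono) auto
        also have "\<dots> = (640 * C * D * exp (2 * b + 1) * c') * (real (card A1) ^ 2 / 4)"
          by (simp add: power2_eq_square)
        also have "\<dots> \<le> 1 * (real (card A1) ^ 2 / 4)" using c'1 by (intro mult_right_mono) auto
        finally show ?thesis using mert0 lnR0 by (simp add: mult_right_mono)
      qed
      have tail: "mertens_prod z / ln R * (K * X * sqrt (real (card A1) * real (card S) / ln R) * real z powr (-13/16)) \<le> real (card A1) ^ 2 / 2"
      proof -
        \<comment> \<open>The logarithm of the Mertens factor is traded for z^(1/8), which leaves
          z^(1/8 - 13/16) = z^(-11/16).\<close>
        define q where "q = real z powr (1/8)"
        have zpos: "real z > 0" using z0 by simp
        have 1: "mertens_prod z / ln R \<le> (C * (8 * q)) / (L / 40)"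
        proof (intro frac_le)
          have "mertens_prod z \<le> C * ln (real z)" using z0 by (intro C) simp
          also have "\<dots> \<le> C * (8 * q)" unfolding q_def using zpos C1 by (intro mult_left_mono ln_le_powr_eighth) auto
          finally show "mertens_prod z \<le> C * (8 * q)" .
        qed (use lnR L0 C1 in \<open>auto simp: q_def\<close>)
        have 2: "sqrt (real (card A1) * real (card S) / ln R) \<le> \<alpha> * x / L * sqrt (80 * c' / l0)"
        proof -
          have "real (card A1) * real (card S) / ln R \<le> ((\<alpha> * x / L) * (2 * (c' * \<alpha> * x / l0))) / (L / 40)"
          proof (intro frac_le mult_mono)
            show "real (card A1) \<le> \<alpha> * x / L" using cardA1 A_eq by simp
            have "real (card S) \<le> 2 * t" using m S(3) by simp
            also have "t \<le> c' * \<alpha> * x / l0" unfolding t_def using l l0 c'0 \<alpha>0 x3 by (intro divide_left_mono) auto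
            finally show "real (card S) \<le> 2 * (c' * \<alpha> * x / l0)" by simp
          qed (use lnR L0 \<alpha>0 x3 c'0 l0 in auto)
          also have "\<dots> = (\<alpha> * x / L) ^ 2 * (80 * c' / l0)" by (simp add: power2_eq_square mult_ac)
          finally have "sqrt (real (card A1) * real (card S) / ln R) \<le> sqrt ((\<alpha> * x / L) ^ 2 * (80 * c' / l0))"
            by (rule real_sqrt_le_mono)
          then show ?thesis using \<alpha>0 x3 L0 by (simp only: real_sqrt_mult real_sqrt_abs) simp
        qed
        have 3: "q * real z powr (-13/16) \<le> \<alpha> / K1"
        proof -
          have "q * real z powr (-13/16) = real z powr (-11/16)" unfolding q_def by (simp add: powr_add[symmetric])
          also have "\<dots> \<le> ((K1 / \<alpha>) powr (3/2)) powr (-11/16)" using zr K1\<alpha> by (intro powr_mono2') auto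
          also have "\<dots> = (K1 / \<alpha>) powr (-33/32)" by (simp add: powr_powr)
          also have "\<dots> \<le> (K1 / \<alpha>) powr (-1)" using K1\<alpha> by (intro powr_mono) auto
          also have "\<dots> = 1 / (K1 / \<alpha>)" unfolding powr_minus_divide
            by (subst powr_one) (use K1\<alpha> in auto)
          also have "\<dots> = \<alpha> / K1" by simp
          finally show ?thesis .
        qed
        have "mertens_prod z / ln R * (K * X * sqrt (real (card A1) * real (card S) / ln R) * real z powr (-13/16)) \<le>
            (C * (8 * q)) / (L / 40) * (K * (2 * x) * (\<alpha> * x / L * sqrt (80 * c' / l0)) * real z powr (-13/16))"
          using 1 2 K X mert0 lnR0 \<alpha>0 x3 L0 c'0 l0 C1
          by (intro mult_mono) (auto simp: q_def intro!: mult_nonneg_nonneg divide_nonneg_nonneg)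
        also have "\<dots> = 640 * C * K * sqrt (80 * c' / l0) * (x / L) * (\<alpha> * x / L) * (q * real z powr (-13/16))"
          using L0 by (simp add: field_simps)
        also have "\<dots> \<le> 640 * C * K * sqrt (80 * c' / l0) * (x / L) * (\<alpha> * x / L) * (\<alpha> / K1)"
          using 3 C1 K c'0 l0 x3 L0 \<alpha>0 by (intro mult_left_mono) auto
        also have "\<dots> = (8 * 640 * C * K * sqrt (80 * c' / l0)) / K1 * ((\<alpha> * x / L) ^ 2 / 8)"
          by (simp add: power2_eq_square mult_ac)
        also have "\<dots> \<le> 1 * ((\<alpha> * x / L) ^ 2 / 8)" using K1 by (intro mult_right_mono) auto
        also have "\<dots> \<le> (2 * real (card A1)) ^ 2 / 8"
        proof -
          have "(\<alpha> * x / L) ^ 2 \<le> (2 * real (card A1)) ^ 2"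
            using cardA1(1) \<alpha>0 x3 L0 unfolding A_eq by (intro power_mono) auto
          then show ?thesis by simp
        qed
        also have "\<dots> = real (card A1) ^ 2 / 2" by (simp add: power2_eq_square)
        finally show ?thesis .
      qed
      have "real (card A1) ^ 2 \<le> real (card A1) ^ 2 / 4 + real (card A1) ^ 2 / 2"
        using sq main_term tail by (simp only: distrib_left)
      moreover have "real (card A1) ^ 2 > 0" using A10 by simp
      ultimately show False by linarith
    qed
  qed
  show ?thesis
    by (intro exI[of _ 1] exI[of _ c'] exI[of _ "max 3 x0"] conjI allI impI zero_less_one c'0) (rule main)
qed

end
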